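(* Let $\mathfrak h\subset\mathfrak{so}(E)=\mathfrak{so}_n$ be a weak-Berger algebra with $\mathfrak z(\mathfrak h)\ne\{0\}$, let $m=\dim\mathfrak z(\mathfrak h)$, and let $u_1,\dots,u_m$ be the basis of $\mathfrak z(\mathfrak h)$ described in the context. Then the connected Lie subgroup of $SO_{1,n+1}$ corresponding to a Lie algebra $\mathfrak g_3^{\mathfrak h,\varphi}$ of type 3 (resp. $\mathfrak g_4^{\mathfrak h,\psi}$ of type 4) is closed if and only if there exists a basis $v_1,\dots,v_l$ of the vector space $\ker\varphi\subset\mathfrak z(\mathfrak h)$ (resp. $\ker\psi\subset\mathfrak z(\mathfrak h)$), where $l=\dim\ker\varphi$ (resp. $l=\dim\ker\psi$), such that for every $i=1,\dots,l$ the coordinates of $v_i$ with respect to the basis $u_1,\dots,u_m$ are integers.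
   Context: $(V,\eta)$ is a real vector space of dimension $n+2$ with a metric $\eta$ of signature $(1,n+1)$, with a basis $p,e_1,\dots,e_n,q$ such that $\eta(p,p)=\eta(q,q)=0$, $\eta(p,q)=1$, $\eta(p,e_i)=\eta(q,e_i)=0$, $\eta(e_i,e_j)=-\delta_{ij}$. $E=\mathrm{span}(e_1,\dots,e_n)$ is a Euclidean space with inner product $-\eta|_E$. The Lie algebra $\mathfrak{so}(V)=\mathfrak{so}_{1,n+1}$ is identified with $V\wedge V$ by $(u\wedge v)(w)=\eta(u,w)v-\eta(v,w)u$; $\mathfrak{so}(E)=\mathfrak{so}_n$ acts trivially on $\mathbb Rp\oplus\mathbb Rq$. For a subalgebra $\mathfrak h\subset\mathfrak{so}(E)$ put $\mathcal P(\mathfrak h)=\{P\in\mathrm{Hom}(E,\mathfrak h):\eta(P(u)v,w)+\eta(P(v)w,u)+\eta(P(w)u,v)=0\ \forall u,v,w\in E\}$; $\mathfrak h$ is a weak-Berger algebra if $\mathrm{span}\{P(u):P\in\mathcal P(\mathfrak h),u\in E\}=\mathfrak h$. Write $\mathfrak h=\mathfrak h'\oplus\mathfrak z(\mathfrak h)$ (commutant and center). - Type 3: for a non-zero linear map $\varphi:\mathfrak z(\mathfrak h)\to\mathbb R$, extended to $\mathfrak h$ by $\varphi|_{\mathfrak h'}=0$, $\mathfrak g_3^{\mathfrak h,\varphi}=p\wedge E+\{A+\varphi(A)p\wedge q:A\in\mathfrak h\}$. - Type 4: for an orthogonal decomposition $E=E_0\oplus E_1$ with $E_0\neq\{0\}$,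 $\mathfrak h\subset\mathfrak{so}(E_1)$, $\dim\mathfrak z(\mathfrak h)\geq\dim E_0$, and a surjective linear map $\psi:\mathfrak z(\mathfrak h)\to E_0$, extended to $\mathfrak h$ by $\psi|_{\mathfrak h'}=0$, $\mathfrak g_4^{\mathfrak h,\psi}=p\wedge E_1+\{A+p\wedge\psi(A):A\in\mathfrak h\}$. Here $\ker\varphi$ and $\ker\psi$ denote the kernels of the maps $\varphi,\psi$ defined on $\mathfrak z(\mathfrak h)$. The basis $u_1,\dots,u_m$: let $T\subset SO_n$ be the connected Lie subgroup corresponding to $\mathfrak z(\mathfrak h)$. For $\mathfrak h$ weak-Berger, $T$ is closed, hence a compact torus of dimension $m=\dim\mathfrak z(\mathfrak h)$; write $T=S_1\times\cdots\times S_m$, where each $S_i$ is a closed Lie subgroup of $T$ isomorphic to the unit circle $S^1$. Then $u_i\in\mathfrak z(\mathfrak h)$ is the tangent vector to $S_i$ at the identity corresponding, under such an isomorphism, to a unit tangent vector of $S^1$ at its identity element. *)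

theory Defs
  imports "HOL-Analysis.Analysis" "HOL-Algebra.FiniteProduct" "HOL-Algebra.Product_Groups"
begin

text \<open>
  The space \<open>V\<close> is modelled as \<open>real ^ 'k\<close> with \<open>CARD('k) = n + 2\<close>, carrying an arbitrary
  bilinear form \<open>\<eta>\<close> and an arbitrary Witt basis \<open>p, e 1, \<dots>, e n, q\<close>; the signature
  \<open>(1, n + 1)\<close> of \<open>\<eta>\<close> is forced by the values of \<open>\<eta>\<close> on this basis.  Endomorphisms of
  \<open>V\<close> are matrices.
\<close>

definition witt_basis ::
  "(real^'k \<Rightarrow> real^'k \<Rightarrow> real) \<Rightarrow> nat \<Rightarrow> real^'k \<Rightarrow> (nat \<Rightarrow> real^'k) \<Rightarrow> real^'k \<Rightarrow> bool" where
  "witt_basis \<eta> n p e q \<longleftrightarrow>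
     bilinear \<eta> \<and> (\<forall>v w. \<eta> v w = \<eta> w v) \<and>
     CARD('k) = n + 2 \<and> span ({p, q} \<union> e ` {1..n}) = UNIV \<and>
     \<eta> p p = 0 \<and> \<eta> q q = 0 \<and> \<eta> p q = 1 \<and>
     (\<forall>i\<in>{1..n}. \<eta> p (e i) = 0 \<and> \<eta> q (e i) = 0) \<and>
     (\<forall>i\<in>{1..n}. \<forall>j\<in>{1..n}. \<eta> (e i) (e j) = (if i = j then - 1 else 0))"

definition wedge ::
  "(real^'k \<Rightarrow> real^'k \<Rightarrow> real) \<Rightarrow> real^'k \<Rightarrow> real^'k \<Rightarrow> real^'k^'k" where
  "wedge \<eta> u v = matrix (\<lambda>w. \<eta> u w *\<^sub>R v - \<eta> v w *\<^sub>R u)"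

definition linear_on :: "'a::real_vector set \<Rightarrow> ('a \<Rightarrow> 'b::real_vector) \<Rightarrow> bool" where
  "linear_on S f \<longleftrightarrow>
     (\<forall>x\<in>S. \<forall>y\<in>S. f (x + y) = f x + f y) \<and> (\<forall>c. \<forall>x\<in>S. f (c *\<^sub>R x) = c *\<^sub>R f x)"

subsection \<open>Lie algebras\<close>

definition lie_bracket :: "real^'k^'k \<Rightarrow> real^'k^'k \<Rightarrow> real^'k^'k" where
  "lie_bracket A B = A ** B - B ** A"

text \<open>
  For a nondegenerate subspace \<open>W\<close> of \<open>V\<close>, \<open>so_on \<eta> W\<close> is \<open>so(W)\<close>, regarded as the
  subalgebra of \<open>so(V)\<close> acting trivially on the \<open>\<eta>\<close>-orthogonal complement of \<open>W\<close>.
\<close>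

definition so_on :: "(real^'k \<Rightarrow> real^'k \<Rightarrow> real) \<Rightarrow> (real^'k) set \<Rightarrow> (real^'k^'k) set" where
  "so_on \<eta> W = {A. (\<forall>v w. \<eta> (A *v v) w + \<eta> v (A *v w) = 0) \<and>
                   (\<forall>x. (\<forall>w\<in>W. \<eta> w x = 0) \<longrightarrow> A *v x = 0)}"

definition lie_subalgebra :: "(real^'k^'k) set \<Rightarrow> (real^'k^'k) set \<Rightarrow> bool" where
  "lie_subalgebra h g \<longleftrightarrow>
     subspace h \<and> h \<subseteq> g \<and> (\<forall>A\<in>h. \<forall>B\<in>h. lie_bracket A B \<in> h)"

definition commutant :: "(real^'k^'k) set \<Rightarrow> (real^'k^'k) set" where
  "commutant h = span {lie_bracket A B | A B. A \<in> h \<and> B \<in> h}"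

definition lie_center :: "(real^'k^'k) set \<Rightarrow> (real^'k^'k) set" where
  "lie_center h = {A \<in> h. \<forall>B\<in>h. lie_bracket A B = 0}"

definition weak_curvature ::
  "(real^'k \<Rightarrow> real^'k \<Rightarrow> real) \<Rightarrow> (real^'k) set \<Rightarrow> (real^'k^'k) set \<Rightarrow>
   (real^'k \<Rightarrow> real^'k^'k) set" where
  "weak_curvature \<eta> E h =
     {P. linear_on E P \<and> P ` E \<subseteq> h \<and>
         (\<forall>u\<in>E. \<forall>v\<in>E. \<forall>w\<in>E.
            \<eta> (P u *v v) w + \<eta> (P v *v w) u + \<eta> (P w *v u) v = 0)}"

definition weak_berger ::
  "(real^'k \<Rightarrow> real^'k \<Rightarrow> real) \<Rightarrow> (real^'k) set \<Rightarrow> (real^'k^'k) set \<Rightarrow> bool" where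
  "weak_berger \<eta> E h \<longleftrightarrow>
     lie_subalgebra h (so_on \<eta> E) \<and> span {P u | P u. P \<in> weak_curvature \<eta> E h \<and> u \<in> E} = h"

text \<open>
  In types 3 and 4 the maps \<open>\<phi>\<close> and \<open>\<psi>\<close> stand for the extensions to \<open>h\<close> (vanishing on the
  commutant) of the given linear maps on the center; only their values on \<open>h\<close> are relevant.
\<close>

definition type3_data :: "(real^'k^'k) set \<Rightarrow> (real^'k^'k \<Rightarrow> real) \<Rightarrow> bool" where
  "type3_data h \<phi> \<longleftrightarrow>
     linear_on h \<phi> \<and> (\<forall>A\<in>commutant h. \<phi> A = 0) \<and> (\<exists>Z\<in>lie_center h. \<phi> Z \<noteq> 0)"

definition g3 ::
  "(real^'k \<Rightarrow> real^'k \<Rightarrow> real) \<Rightarrow> real^'k \<Rightarrow> real^'k \<Rightarrow> (real^'k) set \<Rightarrow>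
   (real^'k^'k) set \<Rightarrow> (real^'k^'k \<Rightarrow> real) \<Rightarrow> (real^'k^'k) set" where
  "g3 \<eta> p q E h \<phi> = {wedge \<eta> p x + (A + \<phi> A *\<^sub>R wedge \<eta> p q) | x A. x \<in> E \<and> A \<in> h}"

definition type4_data ::
  "(real^'k \<Rightarrow> real^'k \<Rightarrow> real) \<Rightarrow> (real^'k) set \<Rightarrow> (real^'k) set \<Rightarrow> (real^'k) set \<Rightarrow>
   (real^'k^'k) set \<Rightarrow> (real^'k^'k \<Rightarrow> real^'k) \<Rightarrow> bool" where
  "type4_data \<eta> E E0 E1 h \<psi> \<longleftrightarrow>
     subspace E0 \<and> subspace E1 \<and> {x + y | x y. x \<in> E0 \<and> y \<in> E1} = E \<and> E0 \<inter> E1 = {0} \<and>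
     (\<forall>x\<in>E0. \<forall>y\<in>E1. \<eta> x y = 0) \<and> E0 \<noteq> {0} \<and>
     h \<subseteq> so_on \<eta> E1 \<and> dim (lie_center h) \<ge> dim E0 \<and>
     linear_on h \<psi> \<and> (\<forall>A\<in>commutant h. \<psi> A = 0) \<and> \<psi> ` lie_center h = E0"

definition g4 ::
  "(real^'k \<Rightarrow> real^'k \<Rightarrow> real) \<Rightarrow> real^'k \<Rightarrow> (real^'k) set \<Rightarrow>
   (real^'k^'k) set \<Rightarrow> (real^'k^'k \<Rightarrow> real^'k) \<Rightarrow> (real^'k^'k) set" where
  "g4 \<eta> p E1 h \<psi> = {wedge \<eta> p x + (A + wedge \<eta> p (\<psi> A)) | x A. x \<in> E1 \<and> A \<in> h}"

definition center_kernel ::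
  "(real^'k^'k) set \<Rightarrow> (real^'k^'k \<Rightarrow> 'b::real_vector) \<Rightarrow> (real^'k^'k) set" where
  "center_kernel h f = {Z \<in> lie_center h. f Z = 0}"

subsection \<open>Lie groups\<close>

text \<open>
  The class-based \<open>exp\<close> and \<open>^\<close> do not apply here: \<open>*\<close> on type \<open>vec\<close> is componentwise.
\<close>

definition mexp :: "real^'k^'k \<Rightarrow> real^'k^'k" where
  "mexp A = (\<Sum>k. (1 / fact k) *\<^sub>R (((**) A ^^ k) (mat 1)))"

definition SO :: "(real^'k \<Rightarrow> real^'k \<Rightarrow> real) \<Rightarrow> (real^'k^'k) set" where
  "SO \<eta> = {g. (\<forall>v w. \<eta> (g *v v) (g *v w) = \<eta> v w) \<and> det g = 1}"

definition mat_group :: "(real^'k^'k) set \<Rightarrow> (real^'k^'k) monoid" where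
  "mat_group H = \<lparr>carrier = H, monoid.mult = (**), one = mat 1\<rparr>"

text \<open>
  The connected Lie subgroup of \<open>SO(V)\<close> corresponding to a subalgebra \<open>g\<close> of \<open>so(V)\<close> is the
  subgroup generated by \<open>exp g\<close>.
\<close>

definition connected_lie_subgroup ::
  "(real^'k \<Rightarrow> real^'k \<Rightarrow> real) \<Rightarrow> (real^'k^'k) set \<Rightarrow> (real^'k^'k) set" where
  "connected_lie_subgroup \<eta> g = generate (mat_group (SO \<eta>)) (mexp ` g)"

definition circle_group :: "complex monoid" where
  "circle_group = \<lparr>carrier = sphere 0 1, monoid.mult = (*), one = 1\<rparr>"

text \<open>
  A continuous isomorphism of Lie groups is automatically smooth.  The unit tangent vectors of
  the circle at \<open>1\<close> are the velocities at \<open>t = 0\<close> of \<open>cis (s * t)\<close> for \<open>s = 1\<close> and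
  \<open>s = - 1\<close>.
\<close>

definition circle_tangent :: "(real^'k^'k) set \<Rightarrow> real^'k^'k \<Rightarrow> bool" where
  "circle_tangent S u \<longleftrightarrow>
     (\<exists>\<theta> s. \<theta> \<in> iso circle_group (mat_group S) \<and>
            (\<exists>\<theta>'. homeomorphism (sphere 0 1) S \<theta> \<theta>') \<and> \<bar>s\<bar> = 1 \<and>
            ((\<lambda>t. \<theta> (cis (s * t))) has_vector_derivative u) (at 0))"

text \<open>
  \<open>T = S 1 \<times> \<dots> \<times> S m\<close> as an internal direct product of closed subgroups; the multiplication
  map is then automatically a homeomorphism, the factors being compact.
\<close>

definition torus_basis :: "(real^'k^'k) set \<Rightarrow> nat \<Rightarrow> (nat \<Rightarrow> real^'k^'k) \<Rightarrow> bool" where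
  "torus_basis T m u \<longleftrightarrow>
     (\<exists>S. (\<forall>i\<in>{1..m}. subgroup (S i) (mat_group T) \<and> closedin (top_of_set T) (S i) \<and>
                       circle_tangent (S i) (u i)) \<and>
          (\<lambda>s. finprod (mat_group T) s {1..m})
            \<in> iso (product_group {1..m} (\<lambda>i. mat_group (S i))) (mat_group T))"

definition has_integer_basis ::
  "nat \<Rightarrow> (nat \<Rightarrow> 'a::real_vector) \<Rightarrow> 'a set \<Rightarrow> bool" where
  "has_integer_basis m u K \<longleftrightarrow>
     (\<exists>v. inj_on v {1..dim K} \<and> independent (v ` {1..dim K}) \<and> span (v ` {1..dim K}) = K \<and>
          (\<forall>i\<in>{1..dim K}. \<exists>c :: nat \<Rightarrow> int. v i = (\<Sum>j = 1..m. of_int (c j) *\<^sub>R u j)))"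

end

theory Submission
  imports Defs
begin

text \<open>
  Let \<open>H'\<close> be the group of \<open>h' = [h,h]\<close> and \<open>K\<close> the kernel of \<open>\<phi>\<close> or \<open>\<psi>\<close> on the
  center.  The groups of types 3 and 4 consist of the products of an element of a vector group,
  an element of \<open>H'\<close> and a twisted exponential \<open>exp (Z + f Z)\<close> of a central \<open>Z\<close>; the first and
  the \<open>f\<close>-component can be read off properly from the product.  As \<open>H'\<close> is compact and meets the
  torus \<open>T\<close> in a discrete set, such a group is closed iff \<open>exp K\<close> is a closed subgroup of \<open>T\<close>, and
  by Dirichlet approximation this holds iff \<open>K\<close> is spanned by lattice vectors.

  \<open>H'\<close> is compact because a limiting direction \<open>Y\<close> of its closure transversal to \<open>h'\<close> would
  centralize \<open>h\<close>; a complex determinant on an eigenspace of \<open>Y\<^sup>2\<close> is trivial on \<open>H'\<close>, as its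
  derivative kills brackets, but not on \<open>exp (t Y)\<close>.
\<close>

subsection \<open>The matrix exponential\<close>

text \<open>The torus and \<open>H'\<close> may intersect, so an element of the group does not
  determine its central logarithm. If \<open>K\<close> has an integral basis, \<open>exp K\<close>
  is already attained on a bounded box, which restores compactness. Conversely, the central
  logarithms of elements of \<open>H'\<close> form a uniformly discrete, hence countable, set; if
  \<open>exp (t X)\<close> lies in the group for all \<open>t \<ge> 0\<close>, two parameters leave
  the same residue modulo \<open>K\<close>, and \<open>X\<close> lies in \<open>K\<close>. The
  algebra is skew for the indefinite \<open>\<eta>\<close>, not for the standard inner product. As
  it kills \<open>p\<close> and \<open>q\<close>, a Witt frame conjugates it to skew matrices, and
  the trace form, unlike the Killing form, is definite there including the centre. Limiting
  directions arise from integer multiples of small vectors and give information for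
  \<open>t \<ge> 0\<close> only, hence the one-sided differentiation.\<close>

text \<open>
  A Banach algebra in the sense of the type classes, giving access to the library exponential for
  matrices (\<open>'a = real^'k\<close>) and for operators such as \<open>ad B\<close> (\<open>'a = real^'k^'k\<close>).
\<close>

typedef (overloaded) ('a::euclidean_space) endo = "UNIV :: ('a \<Rightarrow>\<^sub>L 'a) set"
  morphisms endo_map Endo by simp

setup_lifting type_definition_endo

instantiation endo :: (euclidean_space) real_normed_algebra_1
begin

lift_definition zero_endo :: "'a endo" is 0 .
lift_definition one_endo :: "'a endo" is id_blinfun .
lift_definition plus_endo :: "'a endo \<Rightarrow> 'a endo \<Rightarrow> 'a endo" is "(+)" .
lift_definition minus_endo :: "'a endo \<Rightarrow> 'a endo \<Rightarrow> 'a endo" is "(-)" .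
lift_definition uminus_endo :: "'a endo \<Rightarrow> 'a endo" is uminus .
lift_definition scaleR_endo :: "real \<Rightarrow> 'a endo \<Rightarrow> 'a endo" is "(*\<^sub>R)" .
lift_definition times_endo :: "'a endo \<Rightarrow> 'a endo \<Rightarrow> 'a endo" is "(o\<^sub>L)" .
lift_definition norm_endo :: "'a endo \<Rightarrow> real" is norm .
definition dist_endo :: "'a endo \<Rightarrow> 'a endo \<Rightarrow> real" where "dist_endo x y = norm (x - y)"
definition sgn_endo :: "'a endo \<Rightarrow> 'a endo" where "sgn_endo x = scaleR (inverse (norm x)) x"
definition uniformity_endo :: "('a endo \<times> 'a endo) filter" where
  "uniformity_endo = (INF e\<in>{0 <..}. principal {(x, y). dist x y < e})"
definition open_endo :: "'a endo set \<Rightarrow> bool" where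
  "open_endo S = (\<forall>x\<in>S. \<forall>\<^sub>F (x', y) in uniformity. x' = x \<longrightarrow> y \<in> S)"

instance
proof
  fix x y z :: "'a endo" and a b :: real
  show "x + y + z = x + (y + z)" "x + y = y + x" "0 + x = x" "- x + x = 0" "x - y = x + - y"
    by (transfer, simp)+
  show "a *\<^sub>R (x + y) = a *\<^sub>R x + a *\<^sub>R y" "(a + b) *\<^sub>R x = a *\<^sub>R x + b *\<^sub>R x"
    "a *\<^sub>R b *\<^sub>R x = (a * b) *\<^sub>R x" "1 *\<^sub>R x = x"
    by (transfer, simp add: algebra_simps)+
  show "x * y * z = x * (y * z)" by (transfer, rule blinfun_eqI) simp
  show "(x + y) * z = x * z + y * z" "x * (y + z) = x * y + x * z"
    by (transfer, rule blinfun_eqI, simp add: blinfun.bilinear_simps)+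
  show "a *\<^sub>R x * y = a *\<^sub>R (x * y)" "x * a *\<^sub>R y = a *\<^sub>R (x * y)"
    by (transfer, rule blinfun_eqI, simp add: blinfun.bilinear_simps)+
  show "1 * x = x" "x * 1 = x" by (transfer, rule blinfun_eqI, simp)+
  show "norm (1 :: 'a endo) = 1" by transfer simp
  then show "(0 :: 'a endo) \<noteq> 1" by (auto simp: norm_endo.rep_eq zero_endo.rep_eq dest: sym)
  show "norm x = 0 \<longleftrightarrow> x = 0" by transfer simp
  show "norm (x + y) \<le> norm x + norm y" by transfer (rule norm_triangle_ineq)
  show "norm (a *\<^sub>R x) = \<bar>a\<bar> * norm x" by transfer simp
  show "norm (x * y) \<le> norm x * norm y" by transfer (rule norm_blinfun_compose)
qed (simp_all add: dist_endo_def sgn_endo_def uniformity_endo_def open_endo_def)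

end

instance endo :: (euclidean_space) banach
proof
  fix X :: "nat \<Rightarrow> 'a endo"
  assume "Cauchy X"
  then have "Cauchy (\<lambda>n. endo_map (X n))"
    by (simp add: Cauchy_def dist_norm norm_endo.rep_eq minus_endo.rep_eq)
  then obtain L where "(\<lambda>n. endo_map (X n)) \<longlonglongrightarrow> L"
    using Cauchy_convergent_iff convergent_def by metis
  then have "X \<longlonglongrightarrow> Endo L"
    by (simp add: LIMSEQ_iff norm_endo.rep_eq minus_endo.rep_eq Endo_inverse)
  then show "convergent X" by (auto simp: convergent_def)
qed

definition endo_apply :: "'a::euclidean_space endo \<Rightarrow> 'a \<Rightarrow> 'a" where
  "endo_apply T = blinfun_apply (endo_map T)"

definition endo_of :: "('a \<Rightarrow> 'a::euclidean_space) \<Rightarrow> 'a endo" where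
  "endo_of f = Endo (Blinfun f)"

lemma endo_apply_endo_of: "linear f \<Longrightarrow> endo_apply (endo_of f) = f"
  by (simp add: endo_apply_def endo_of_def Endo_inverse bounded_linear_Blinfun_apply
      linear_conv_bounded_linear)

lemma endo_eqI: "(\<And>x. endo_apply S x = endo_apply T x) \<Longrightarrow> S = T"
  unfolding endo_apply_def by (metis blinfun_eqI endo_map_inject)

lemma endo_apply_simps [simp]:
  "endo_apply (S * T) x = endo_apply S (endo_apply T x)"
  "endo_apply (S + T) x = endo_apply S x + endo_apply T x"
  "endo_apply (S - T) x = endo_apply S x - endo_apply T x"
  "endo_apply (- S) x = - endo_apply S x"
  "endo_apply (c *\<^sub>R S) x = c *\<^sub>R endo_apply S x"
  "endo_apply 1 x = x" "endo_apply 0 x = 0"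
  by (simp_all add: endo_apply_def times_endo.rep_eq plus_endo.rep_eq scaleR_endo.rep_eq
      minus_endo.rep_eq uminus_endo.rep_eq
      one_endo.rep_eq zero_endo.rep_eq blinfun.bilinear_simps)

lemma bounded_bilinear_endo_apply: "bounded_bilinear endo_apply"
proof -
  have "norm (endo_apply S x) \<le> norm S * norm x * 1" for S :: "'a endo" and x
    by (simp add: endo_apply_def norm_endo.rep_eq norm_blinfun)
  then show ?thesis
    unfolding bounded_bilinear_def
    by (auto simp: endo_apply_def plus_endo.rep_eq scaleR_endo.rep_eq blinfun.bilinear_simps simp del: mult_1_right)
qed

interpretation endo: bounded_bilinear endo_apply by (rule bounded_bilinear_endo_apply)

definition endo_mat :: "real^'k^'k \<Rightarrow> (real^'k) endo" where
  "endo_mat A = endo_of ((*v) A)"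

definition mat_endo :: "(real^'k) endo \<Rightarrow> real^'k^'k" where
  "mat_endo T = matrix (endo_apply T)"

lemma endo_apply_mat [simp]: "endo_apply (endo_mat A) = (*v) A"
  by (simp add: endo_mat_def endo_apply_endo_of)

lemma mat_endo_inverse [simp]: "mat_endo (endo_mat A) = A"
  by (simp add: mat_endo_def)

lemma endo_mat_inverse [simp]: "endo_mat (mat_endo T) = T"
  by (rule endo_eqI) (simp add: mat_endo_def matrix_vector_mul endo.bounded_linear_right
      bounded_linear.linear matrix_works)

lemma endo_mat_simps:
  "endo_mat (A ** B) = endo_mat A * endo_mat B"
  "endo_mat (A + B) = endo_mat A + endo_mat B"
  "endo_mat (c *\<^sub>R A) = c *\<^sub>R endo_mat A"
  "endo_mat (mat 1) = 1"
  by (rule endo_eqI, simp add: matrix_vector_mul_assoc matrix_vector_mult_add_rdistrib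
      scaleR_matrix_vector_assoc)+

lemma bounded_linear_endo_mat: "bounded_linear endo_mat"
  by (simp add: linear_conv_bounded_linear [symmetric] linearI endo_mat_simps)

lemma bounded_linear_mat_endo: "bounded_linear mat_endo"
proof (rule bounded_linear_intro)
  show "mat_endo (x + y) = mat_endo x + mat_endo y" for x y :: "(real^'k) endo"
    by (metis endo_mat_inverse endo_mat_simps(2) mat_endo_inverse)
  show "mat_endo (c *\<^sub>R x) = c *\<^sub>R mat_endo x" for c and x :: "(real^'k) endo"
    by (metis endo_mat_inverse endo_mat_simps(3) mat_endo_inverse)
  fix T :: "(real^'k) endo"
  have "norm (mat_endo T) \<le> (\<Sum>i\<in>UNIV. norm (mat_endo T $ i))"
    by (simp add: norm_vec_def L2_set_le_sum)
  also have "\<dots> \<le> (\<Sum>i\<in>UNIV. \<Sum>j\<in>UNIV. \<bar>mat_endo T $ i $ j\<bar>)"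
    by (intro sum_mono norm_le_l1_cart)
  also have "\<dots> \<le> (\<Sum>i\<in>(UNIV::'k set). \<Sum>j\<in>(UNIV::'k set). norm T)"
  proof (intro sum_mono)
    fix i j :: 'k
    have "\<bar>mat_endo T $ i $ j\<bar> \<le> norm (endo_apply T (axis j 1))"
      by (simp add: mat_endo_def matrix_def component_le_norm_cart)
    also have "\<dots> \<le> norm T * norm (axis j (1::real))"
      unfolding endo_apply_def norm_endo.rep_eq by (rule norm_blinfun)
    finally show "\<bar>mat_endo T $ i $ j\<bar> \<le> norm T" by simp
  qed
  also have "\<dots> = norm T * (real CARD('k) * real CARD('k))" by simp
  finally show "norm (mat_endo T) \<le> norm T * (real CARD('k) * real CARD('k))" .
qed

lemma mat_endo_simps: "mat_endo (S * T) = mat_endo S ** mat_endo T" "mat_endo 1 = mat 1"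
  by (metis endo_mat_inverse endo_mat_simps mat_endo_inverse)+

lemma endo_mat_power: "endo_mat (((**) A ^^ k) (mat 1)) = endo_mat A ^ k"
  by (induction k) (simp_all add: endo_mat_simps)

section \<open>Series, derivative and continuity of the matrix exponential\<close>

lemma mexp_sums: "(\<lambda>k. (1 / fact k) *\<^sub>R (((**) A ^^ k) (mat 1))) sums mat_endo (exp (endo_mat A))"
proof -
  have "mat_endo (endo_mat A ^ k /\<^sub>R fact k) = (1 / fact k) *\<^sub>R (((**) A ^^ k) (mat 1))" for k
    by (simp add: endo_mat_power [symmetric] endo_mat_simps(3) [symmetric] inverse_eq_divide)
  then show ?thesis
    using bounded_linear.sums [OF bounded_linear_mat_endo exp_converges [of "endo_mat A"]] by simp
qed

lemma mexp_eq: "mexp A = mat_endo (exp (endo_mat A))"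
  unfolding mexp_def using mexp_sums by (rule sums_unique [symmetric])

lemma endo_mat_mexp: "endo_mat (mexp A) = exp (endo_mat A)"
  by (simp add: mexp_eq)

lemma mexp_zero [simp]: "mexp 0 = mat 1"
  by (simp add: mexp_eq linear_0[OF bounded_linear.linear[OF bounded_linear_endo_mat]] mat_endo_simps)

lemma mexp_add: "A ** B = B ** A \<Longrightarrow> mexp (A + B) = mexp A ** mexp B"
  by (simp add: mexp_eq endo_mat_simps exp_add_commuting mat_endo_simps
      flip: endo_mat_simps(1))

lemma mexp_minus [simp]: "mexp A ** mexp (- A) = mat 1" "mexp (- A) ** mexp A = mat 1"
  using mexp_add[of A "-A"] mexp_add[of "-A" A] by (simp_all add: matrix_matrix_mult_def sum_negf)

lemma bounded_bilinear_matrix_mult: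
  "bounded_bilinear ((**) :: real^'k^'k \<Rightarrow> real^'k^'k \<Rightarrow> real^'k^'k)"
  unfolding bilinear_conv_bounded_bilinear[symmetric] bilinear_def
  by (intro conjI allI linearI) (auto simp: matrix_matrix_mult_def vec_eq_iff sum.distrib
      sum_distrib_left algebra_simps)

interpretation mat_mult: bounded_bilinear "(**) :: real^'k^'k \<Rightarrow> real^'k^'k \<Rightarrow> real^'k^'k"
  by (rule bounded_bilinear_matrix_mult)

lemma mexp_has_vector_derivative:
  "((\<lambda>t. mexp (t *\<^sub>R A)) has_vector_derivative mexp (t *\<^sub>R A) ** A) (at t within T)"
  using bounded_linear.has_vector_derivative
    [OF bounded_linear_mat_endo exp_scaleR_has_vector_derivative_right[of "endo_mat A" t T]]
  by (simp add: mexp_eq endo_mat_simps mat_endo_simps)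

text \<open>Beyond its linear term the series is at most \<open>norm x ^ 2\<close> times that of
  \<open>exp (norm x)\<close>. Only the point \<open>0\<close> is treated; elsewhere, commuting
  factorizations lead back to it.\<close>

lemma exp_has_derivative_0:
  "((exp :: 'a \<Rightarrow> 'a) has_derivative (\<lambda>x. x)) (at (0::'a::{real_normed_algebra_1,banach}))"
proof -
  have bound: "norm (exp x - 1 - x) \<le> norm x ^ 2 * exp (norm x)" for x :: 'a
  proof -
    let ?f = "\<lambda>n. inverse (fact (n + 2)) *\<^sub>R (x ^ (n + 2))"
    have eq: "exp x - 1 - x = suminf ?f" using exp_first_two_terms[of x] by simp
    have le: "norm (?f n) \<le> norm x ^ 2 * (norm x ^ n /\<^sub>R fact n)" for n
    proof -
      have "norm (?f n) \<le> inverse (fact (n + 2)) * norm x ^ (n + 2)"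
        by (simp add: norm_power_ineq del: power_Suc fact_Suc)
      also have "\<dots> \<le> inverse (fact n) * norm x ^ (n + 2)"
        by (intro mult_right_mono le_imp_inverse_le fact_mono) (auto simp: fact_mono)
      finally show ?thesis by (simp add: power_add power2_eq_square mult_ac)
    qed
    have s: "summable (\<lambda>n. norm x ^ 2 * (norm x ^ n /\<^sub>R fact n))"
      by (intro summable_mult summable_exp_generic)
    have "norm (suminf ?f) \<le> (\<Sum>n. norm x ^ 2 * (norm x ^ n /\<^sub>R fact n))"
      using le s by (intro norm_suminf_le)
    also have "\<dots> = norm x ^ 2 * exp (norm x)"
      by (subst suminf_mult[OF summable_exp_generic]) (simp add: exp_def)
    finally show ?thesis by (simp only: eq)
  qed
  show ?thesis
  proof (rule has_derivativeI_sandwich [where e = 1])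
    have "((\<lambda>x::'a. norm x * exp (norm x)) \<longlongrightarrow> norm (0::'a) * exp (norm (0::'a))) (at 0)"
      by (intro tendsto_intros)
    then show "((\<lambda>x::'a. norm x * exp (norm x)) \<longlongrightarrow> 0) (at 0)" by simp
    show "norm (exp y - exp 0 - (y - 0)) / norm (y - 0) \<le> norm y * exp (norm y)"
      if "y \<noteq> 0" for y :: 'a
      using bound[of y] that by (simp add: divide_le_eq power2_eq_square mult_ac)
  qed auto
qed

lemma mexp_has_derivative_0: "((mexp :: real^'k^'k \<Rightarrow> _) has_derivative (\<lambda>x. x)) (at 0)"
proof -
  have 0: "endo_mat (0::real^'k^'k) = 0"
    by (rule linear_0[OF bounded_linear.linear[OF bounded_linear_endo_mat]])
  have "((\<lambda>A::real^'k^'k. mat_endo (exp (endo_mat A))) has_derivative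
        (\<lambda>A. mat_endo (endo_mat A))) (at 0)"
    by (intro bounded_linear.has_derivative[OF bounded_linear_mat_endo]
       has_derivative_compose[of endo_mat endo_mat 0 UNIV exp "\<lambda>x. x"])
      (auto simp: exp_has_derivative_0 0 intro: bounded_linear_imp_has_derivative bounded_linear_endo_mat)
  then show ?thesis by (simp add: mexp_eq[abs_def])
qed

lemma continuous_on_exp_algebra:
  "continuous_on S (exp :: 'a \<Rightarrow> 'a::{real_normed_algebra_1,banach})"
proof -
  have "continuous_on (cball 0 R) (exp :: 'a \<Rightarrow> 'a)" for R
  proof (rule uniform_limit_theorem)
    show "uniform_limit (cball 0 R) (\<lambda>n x. \<Sum>i<n. x ^ i /\<^sub>R fact i :: 'a) exp sequentially"
      unfolding exp_def
    proof (rule Weierstrass_m_test)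
      show "summable (\<lambda>n. R ^ n /\<^sub>R fact n)" by (rule summable_exp_generic)
      show "norm (x ^ n /\<^sub>R fact n) \<le> R ^ n /\<^sub>R fact n" if "x \<in> cball 0 R" for n and x :: 'a
      proof -
        have "norm (x ^ n) \<le> R ^ n"
          using that order_trans[OF norm_power_ineq power_mono] by auto
        then show ?thesis by (simp add: divide_inverse mult_left_mono)
      qed
    qed
  qed (auto intro!: always_eventually continuous_intros)
  then have "isCont (exp :: 'a \<Rightarrow> 'a) x" for x
    using continuous_on_interior[of "cball 0 (norm x + 1)" exp x] by (auto simp: interior_cball)
  then show ?thesis by (simp add: continuous_at_imp_continuous_on)
qed

lemma continuous_on_mexp [continuous_intros]:
  "continuous_on S f \<Longrightarrow> continuous_on S (\<lambda>x. mexp (f x))"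
proof -
  assume "continuous_on S f"
  then have "continuous_on S (\<lambda>x. mat_endo (exp (endo_mat (f x))))"
    by (intro bounded_linear.continuous_on[OF bounded_linear_mat_endo]
        continuous_on_compose2[OF continuous_on_exp_algebra[of UNIV]]
        bounded_linear.continuous_on[OF bounded_linear_endo_mat]) auto
  then show ?thesis by (simp add: mexp_eq)
qed

lemma tendsto_mexp: "(f \<longlongrightarrow> A) F \<Longrightarrow> ((\<lambda>x. mexp (f x)) \<longlongrightarrow> mexp A) F"
  using continuous_on_tendsto_compose[OF continuous_on_mexp[OF continuous_on_id, of UNIV], of f A F]
  by simp

lemma mexp_commute:
  assumes "A ** B = B ** A"
  shows "A ** mexp B = mexp B ** A"
proof -
  have c: "endo_mat B * endo_mat A = endo_mat A * endo_mat B"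
    using assms by (simp flip: endo_mat_simps)
  have "endo_mat A * exp (endo_mat B) = (\<Sum>n. endo_mat A * (endo_mat B ^ n /\<^sub>R fact n))"
    unfolding exp_def by (rule suminf_mult[symmetric, OF summable_exp_generic])
  also have "\<dots> = (\<Sum>n. (endo_mat B ^ n /\<^sub>R fact n) * endo_mat A)"
    using power_commuting_commutes[OF c] by simp
  also have "\<dots> = exp (endo_mat B) * endo_mat A"
    unfolding exp_def by (rule suminf_mult2[symmetric, OF summable_exp_generic])
  finally have "endo_mat (A ** mexp B) = endo_mat (mexp B ** A)"
    by (simp only: endo_mat_mexp endo_mat_simps)
  then show ?thesis by (metis mat_endo_inverse)
qed

lemma mexp_scaleR_add: "mexp ((s + t) *\<^sub>R A) = mexp (s *\<^sub>R A) ** mexp (t *\<^sub>R A)"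
  unfolding scaleR_left_distrib
  by (rule mexp_add) (simp only: mat_mult.scaleR_left mat_mult.scaleR_right scaleR_scaleR mult.commute)

lemma mexp_algebra_hom:
  fixes c :: "real^'k^'k \<Rightarrow> real^'k^'k"
  assumes "linear c" and "\<And>A B. c (A ** B) = c A ** c B" and "c (mat 1) = mat 1"
  shows "mexp (c A) = c (mexp A)"
proof -
  have pow: "((**) (c A) ^^ k) (mat 1) = c (((**) A ^^ k) (mat 1))" for k
    by (induction k) (simp_all add: assms)
  have "(\<lambda>k. c ((1 / fact k) *\<^sub>R (((**) A ^^ k) (mat 1)))) sums c (mexp A)"
    unfolding mexp_eq
    by (rule bounded_linear.sums[OF _ mexp_sums]) (rule assms(1)[unfolded linear_conv_bounded_linear])
  then have "(\<lambda>k. (1 / fact k) *\<^sub>R (((**) (c A) ^^ k) (mat 1))) sums c (mexp A)"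
    by (simp add: pow linear_scale[OF assms(1)])
  then show ?thesis
    unfolding mexp_eq using mexp_sums sums_unique2 by blast
qed

section \<open>Exponentials acting on vectors and on subspaces\<close>

lemma bounded_linear_matrix_vector: "bounded_linear (\<lambda>M::real^'k^'k. M *v x)"
  unfolding linear_conv_bounded_linear[symmetric]
  by (intro linearI) (simp_all add: matrix_vector_mult_add_rdistrib scaleR_matrix_vector_assoc)

lemma mexp_matrix_vector_sums:
  fixes A :: "real^'k^'k"
  shows "(\<lambda>k. (1 / fact k) *\<^sub>R (((*v) A ^^ k) x)) sums (mexp A *v x)"
proof -
  have pow: "((**) A ^^ k) (mat 1) *v x = ((*v) A ^^ k) x" for k
    by (induction k) (simp_all add: matrix_vector_mul_assoc[symmetric])
  from bounded_linear.sums[OF bounded_linear_matrix_vector[of x] mexp_sums[of A]]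
  show ?thesis by (simp add: mexp_eq pow flip: scaleR_matrix_vector_assoc)
qed

lemma mexp_eigenvector:
  assumes "A *v x = c *\<^sub>R x"
  shows "mexp A *v x = exp c *\<^sub>R x"
proof -
  have pow: "((*v) A ^^ k) x = c ^ k *\<^sub>R x" for k
    by (induction k) (simp_all add: assms matrix_vector_mult_scaleR)
  have "(\<lambda>k. (c ^ k /\<^sub>R fact k) *\<^sub>R x) sums (exp c *\<^sub>R x)"
    by (intro bounded_linear.sums[OF bounded_linear_scaleR_left] exp_converges)
  then show ?thesis
    using mexp_matrix_vector_sums[of A x] by (simp add: pow divide_inverse mult.commute sums_unique2)
qed

lemma mexp_fixes: "A *v x = 0 \<Longrightarrow> mexp A *v x = x"
  using mexp_eigenvector[of A x 0] by simp

text \<open>Meant for \<open>wedge \<eta> p x\<close> with \<open>x\<close> in \<open>E\<close>,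
  which sends \<open>q\<close> to \<open>x\<close>, \<open>x\<close> to a multiple of
  \<open>p\<close>, and \<open>p\<close> to \<open>0\<close>.\<close>

lemma mexp_nilpotent:
  assumes "A *v (A *v (A *v x)) = 0"
  shows "mexp A *v x = x + A *v x + (1/2) *\<^sub>R (A *v (A *v x))"
proof -
  have zero: "((*v) A ^^ (k + 3)) x = 0" for k
    by (induction k) (simp_all add: assms numeral_3_eq_3)
  have "(\<lambda>k. (1 / fact k) *\<^sub>R (((*v) A ^^ k) x)) sums
    (\<Sum>k<3. (1 / fact k) *\<^sub>R (((*v) A ^^ k) x))"
  proof (rule sums_finite)
    fix k assume "k \<notin> {..<3::nat}"
    then obtain j where "k = j + 3" by (metis add.commute le_Suc_ex lessThan_iff not_le)
    then show "(1 / fact k) *\<^sub>R (((*v) A ^^ k) x) = 0" by (simp only: zero scaleR_zero_right)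
  qed simp
  then show ?thesis
    using sums_unique2[OF mexp_matrix_vector_sums[of A x]]
    by (simp add: numeral_3_eq_3)
qed

lemma endo_exp_sums: "(\<lambda>n. endo_apply (T ^ n) x /\<^sub>R fact n) sums endo_apply (exp T) x"
  using bounded_linear.sums[OF endo.bounded_linear_left exp_converges[of T], of x] by simp

lemma linear_lie_bracket: "linear (lie_bracket B)"
  unfolding lie_bracket_def
  by (rule linear_compose_sub[OF bounded_linear.linear[OF mat_mult.bounded_linear_right]
      bounded_linear.linear[OF mat_mult.bounded_linear_left]])

lemma lie_bracket_neg: "lie_bracket A B = - lie_bracket B A"
  unfolding lie_bracket_def by (rule minus_diff_eq[symmetric])

text \<open>\<open>Ad (exp B) = exp (ad B)\<close>, and \<open>ad B\<close> is the sum of the commuting operators of left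
  multiplication by \<open>B\<close> and right multiplication by \<open>- B\<close>.\<close>

lemma mexp_conj_eq:
  fixes X B :: "real^'k^'k"
  shows "endo_apply (exp (endo_of (lie_bracket B))) X = mexp B ** X ** mexp (- B)"
proof -
  define L where "L = endo_of (\<lambda>X::real^'k^'k. B ** X)"
  define R where "R = endo_of (\<lambda>X::real^'k^'k. X ** - B)"
  have L: "endo_apply L X = B ** X" for X
    unfolding L_def by (subst endo_apply_endo_of) (auto intro!: bounded_linear.linear mat_mult.bounded_linear_right)
  have R: "endo_apply R X = X ** - B" for X
    unfolding R_def by (subst endo_apply_endo_of) (simp_all add: bounded_linear.linear mat_mult.bounded_linear_left)
  have ad: "endo_of (lie_bracket B) = L + R"
    by (rule endo_eqI) (simp add: L R endo_apply_endo_of linear_lie_bracket lie_bracket_def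
        mat_mult.minus_right)
  have "L * R = R * L"
    by (rule endo_eqI) (simp add: L R matrix_mul_assoc)
  then have exp: "exp (L + R) = exp L * exp R" by (rule exp_add_commuting)
  have powL: "endo_apply (L ^ n) X = ((**) B ^^ n) (mat 1) ** X" for n X
    by (induction n) (simp_all add: L matrix_mul_assoc)
  have powR: "endo_apply (R ^ n) X = X ** ((**) (- B) ^^ n) (mat 1)" for n X
  proof (induction n arbitrary: X)
    case (Suc n)
    have "endo_apply (R ^ Suc n) X = endo_apply (R ^ n) (endo_apply R X)"
      by (simp only: power_Suc2 endo_apply_simps)
    then show ?case by (simp add: Suc R matrix_mul_assoc)
  qed simp
  have expL: "endo_apply (exp L) X = mexp B ** X" for X
    using endo_exp_sums[of L X] bounded_linear.sums[OF mat_mult.bounded_linear_left mexp_sums[of B], of X]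
    by (simp add: powL mexp_eq mat_mult.scaleR_left divide_inverse sums_unique2)
  have expR: "endo_apply (exp R) X = X ** mexp (- B)" for X
    using endo_exp_sums[of R X] bounded_linear.sums[OF mat_mult.bounded_linear_right mexp_sums[of "-B"], of X]
    by (simp add: powR mexp_eq mat_mult.scaleR_right divide_inverse sums_unique2)
  show ?thesis by (simp add: ad exp expL expR matrix_mul_assoc)
qed

text \<open>The conjugate is \<open>exp (ad B)\<close> applied to \<open>X\<close>; its partial sums
  stay in \<open>N\<close>, and a subspace is closed in finite dimension.\<close>

lemma mexp_conj_subspace:
  assumes "subspace N" and "\<And>X. X \<in> N \<Longrightarrow> lie_bracket B X \<in> N" and "X \<in> N"
  shows "mexp B ** X ** mexp (- B) \<in> N"
proof -
  let ?T = "endo_of (lie_bracket B)"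
  have "endo_apply (?T ^ n) X \<in> N" for n
    by (induction n) (simp_all add: assms endo_apply_endo_of linear_lie_bracket)
  then have "(\<Sum>i<n. endo_apply (?T ^ i) X /\<^sub>R fact i) \<in> N" for n
    by (intro subspace_sum subspace_scale assms)
  then have "endo_apply (exp ?T) X \<in> N"
    using endo_exp_sums[of ?T X] closed_subspace[OF assms(1)]
    unfolding sums_def by (rule_tac closed_sequentially)
  then show ?thesis by (simp add: mexp_conj_eq)
qed

section \<open>Derivatives, integrals and invariants along one-parameter groups\<close>

text \<open>Difference quotients from the right lie in the closed subspace \<open>S\<close>. The
  hypothesis is one-sided because limiting one-parameter groups are controlled for
  \<open>t \<ge> 0\<close> only. With \<open>S = {0}\<close> the lemma differentiates
  identities.\<close>

lemma has_vector_derivative_in_subspace: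
  fixes f :: "real \<Rightarrow> 'a::euclidean_space"
  assumes "(f has_vector_derivative D) (at a)" and "subspace S" and "\<And>t. t \<ge> a \<Longrightarrow> f t \<in> S"
  shows "D \<in> S"
proof -
  have "((\<lambda>t. (f t - f a) /\<^sub>R (t - a)) \<longlongrightarrow> D) (at a)"
  proof (rule Lim_null[THEN iffD2], rule tendsto_norm_zero_cancel, rule Lim_transform_eventually)
    show "((\<lambda>t. norm (f t - f a - (t - a) *\<^sub>R D) / norm (t - a)) \<longlongrightarrow> 0) (at a)"
      using assms(1) unfolding has_vector_derivative_def has_derivative_iff_norm by simp
    have "norm (f t - f a - (t - a) *\<^sub>R D) / norm (t - a) = norm ((f t - f a) /\<^sub>R (t - a) - D)"
      if "t \<noteq> a" for t
    proof -
      have "(f t - f a) /\<^sub>R (t - a) - D = (f t - f a - (t - a) *\<^sub>R D) /\<^sub>R (t - a)"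
        using that by (simp add: scaleR_diff_right)
      then show ?thesis by (simp add: divide_inverse mult.commute)
    qed
    then show "\<forall>\<^sub>F t in at a. norm (f t - f a - (t - a) *\<^sub>R D) / norm (t - a)
        = norm ((f t - f a) /\<^sub>R (t - a) - D)"
      by (auto simp: eventually_at_filter)
  qed
  then have "((\<lambda>t. (f t - f a) /\<^sub>R (t - a)) \<longlongrightarrow> D) (at_right a)"
    by (rule tendsto_within_subset) simp
  moreover have "\<forall>\<^sub>F t in at_right a. (f t - f a) /\<^sub>R (t - a) \<in> S"
    by (rule eventually_mono[OF eventually_at_right_less])
      (auto intro!: subspace_scale subspace_diff assms)
  ultimately show ?thesis
    using Lim_in_closed_set[OF closed_subspace[OF assms(2)]] by fastforce
qed

lemma integral_in_subspace:
  fixes f :: "real \<Rightarrow> 'a::euclidean_space"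
  assumes "subspace S" and "\<And>t. f t \<in> S" and "f integrable_on T"
  shows "integral T f \<in> S"
proof (rule ccontr)
  assume nS: "integral T f \<notin> S"
  obtain x y where xy: "x \<in> S" "\<And>s. s \<in> S \<Longrightarrow> orthogonal y s" "integral T f = x + y"
    using orthogonal_subspace_decomp_exists[of S "integral T f"] assms(1) by (metis span_eq_iff)
  have "y \<bullet> integral T f = y \<bullet> y"
    using xy(2)[OF xy(1)] by (simp add: xy(3) inner_right_distrib orthogonal_def)
  moreover have "y \<noteq> 0" using nS xy by auto
  ultimately have y: "y \<bullet> integral T f \<noteq> 0" by simp
  have "integral T (\<lambda>t. y \<bullet> f t) = y \<bullet> integral T f"
    using integral_linear[OF assms(3) bounded_linear_inner_right[of y]] by (simp add: o_def)
  then show False using y xy(2)[OF assms(2)] by (simp add: orthogonal_def)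
qed

text \<open>Along \<open>exp (t A)\<close> the value of \<open>\<beta>\<close> has derivative zero:
  skewness cancels the two terms of the product rule.\<close>

lemma mexp_bilinear_invariant:
  fixes \<beta> :: "real^'k \<Rightarrow> real^'k \<Rightarrow> real"
  assumes "bounded_bilinear \<beta>" and "\<And>v w. \<beta> (A *v v) w + \<beta> v (A *v w) = 0"
  shows "\<beta> (mexp A *v v) (mexp A *v w) = \<beta> v w"
proof -
  have vec: "((\<lambda>t. mexp (t *\<^sub>R A) *v x) has_vector_derivative A *v (mexp (t *\<^sub>R A) *v x)) (at t)" for t x
  proof -
    from bounded_linear.has_vector_derivative[OF bounded_linear_matrix_vector mexp_has_vector_derivative]
    have "((\<lambda>t. mexp (t *\<^sub>R A) *v x) has_vector_derivative (mexp (t *\<^sub>R A) ** A) *v x) (at t)" .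
    moreover have "mexp (t *\<^sub>R A) ** A = A ** mexp (t *\<^sub>R A)"
      by (rule mexp_commute[symmetric]) (simp add: mat_mult.scaleR_left mat_mult.scaleR_right)
    ultimately show ?thesis by (simp add: matrix_vector_mul_assoc)
  qed
  have "((\<lambda>t. \<beta> (mexp (t *\<^sub>R A) *v v) (mexp (t *\<^sub>R A) *v w)) has_vector_derivative 0) (at t within UNIV)" for t
    using bounded_bilinear.has_vector_derivative[OF assms(1) vec[where x=v and t=t] vec[where x=w and t=t]] assms(2)
    by (simp add: add.commute)
  then obtain c where "\<And>t. t \<in> UNIV \<Longrightarrow> \<beta> (mexp (t *\<^sub>R A) *v v) (mexp (t *\<^sub>R A) *v w) = c"
    by (rule has_vector_derivative_zero_constant[OF convex_UNIV]) blast
  note c = this[OF UNIV_I]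
  show ?thesis using c[of 0] c[of 1] by simp
qed

text \<open>With \<open>\<omega> t = \<integral>\<^sub>0\<^sup>t Ad (exp (s B)) \<nu> ds\<close>, the curve
  \<open>exp (t (\<nu> + B)) exp (- t B) exp (- \<omega> t)\<close> has derivative \<open>0\<close>.\<close>

lemma mexp_semidirect:
  fixes N :: "(real^'k^'k) set"
  assumes N: "subspace N" and comm: "\<And>X Y. X \<in> N \<Longrightarrow> Y \<in> N \<Longrightarrow> X ** Y = Y ** X"
    and ad: "\<And>X. X \<in> N \<Longrightarrow> lie_bracket B X \<in> N" and "\<nu> \<in> N"
  shows "\<exists>\<omega>\<in>N. mexp (\<nu> + B) = mexp \<omega> ** mexp B"
proof -
  define a where "a s = mexp (s *\<^sub>R B) ** \<nu> ** mexp (- (s *\<^sub>R B))" for s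
  have aN: "a s \<in> N" for s
    unfolding a_def
  proof (rule mexp_conj_subspace[OF N _ \<open>\<nu> \<in> N\<close>])
    show "lie_bracket (s *\<^sub>R B) X \<in> N" if "X \<in> N" for X
      using subspace_scale[OF N ad[OF that], of s]
      by (simp add: lie_bracket_def mat_mult.scaleR_left mat_mult.scaleR_right scaleR_diff_right)
  qed
  have cont: "continuous_on T a" for T
    unfolding a_def by (intro continuous_intros mat_mult.continuous_on)
  define w where "w t = integral {0..t} a" for t
  have wN: "w t \<in> N" for t
    unfolding w_def by (intro integral_in_subspace N aN integrable_continuous_interval cont)
  have dw: "(w has_vector_derivative a t) (at t within {0..1})" if "t \<in> {0..1}" for t
    using that unfolding w_def by (intro integral_has_vector_derivative cont) 
  define k where "k t = mexp (t *\<^sub>R (\<nu> + B)) ** mexp (t *\<^sub>R - B) ** mexp (- w t)" for t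
  have dk: "(k has_vector_derivative 0) (at t within {0..1})" if t: "t \<in> {0..1}" for t
  proof -
    let ?F = "at t within {0..1}"
    let ?P = "mexp (t *\<^sub>R (\<nu> + B))" and ?Q = "mexp (t *\<^sub>R - B)" and ?W = "mexp (- w t)"
    \<comment> \<open>The derivative of \<open>mexp\<close> is known only at \<open>0\<close>. As
      \<open>N\<close> is commutative, the constant factor \<open>mexp (- w t)\<close> splits off,
      and the remaining exponent vanishes at \<open>s = t\<close>.\<close>
    have "(\<lambda>s. mexp (- w s)) = (\<lambda>s. mexp (- w t) ** mexp (- (w s - w t)))"
    proof
      fix s
      have "- w t ** - (w s - w t) = - (w s - w t) ** - w t"
        by (intro comm subspace_neg subspace_diff wN N)
      from mexp_add[OF this] show "mexp (- w s) = mexp (- w t) ** mexp (- (w s - w t))" by simp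
    qed
    moreover have "((\<lambda>s. ?W ** mexp (- (w s - w t))) has_vector_derivative ?W ** - a t) ?F"
    proof (rule bounded_linear.has_vector_derivative[OF mat_mult.bounded_linear_right])
      have "((\<lambda>s. - (w s - w t)) has_derivative (\<lambda>h. h *\<^sub>R - a t)) ?F"
        using dw[OF t] unfolding has_vector_derivative_def by (auto intro!: derivative_eq_intros)
      moreover have "(mexp has_derivative (\<lambda>x. x)) (at ((\<lambda>s. - (w s - w t)) t) within (\<lambda>s. - (w s - w t)) ` {0..1})"
        using mexp_has_derivative_0 by (auto intro: has_derivative_at_withinI)
      ultimately have "(mexp \<circ> (\<lambda>s. - (w s - w t)) has_derivative (\<lambda>x. x) \<circ> (\<lambda>h. h *\<^sub>R - a t)) ?F"
        by (rule diff_chain_within)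
      then show "((\<lambda>s. mexp (- (w s - w t))) has_vector_derivative - a t) ?F"
        by (simp add: has_vector_derivative_def o_def)
    qed
    ultimately have W: "((\<lambda>s. mexp (- w s)) has_vector_derivative ?W ** - a t) ?F" by (simp only:)
    have PQ: "((\<lambda>t. mexp (t *\<^sub>R (\<nu> + B)) ** mexp (t *\<^sub>R - B)) has_vector_derivative
        ?P ** (?Q ** - B) + (?P ** (\<nu> + B)) ** ?Q) ?F"
      by (rule mat_mult.has_vector_derivative[OF mexp_has_vector_derivative mexp_has_vector_derivative])
    have BQ: "?Q ** - B = - B ** ?Q"
      by (rule mexp_commute[symmetric]) (simp add: mat_mult.scaleR_left mat_mult.scaleR_right
          mat_mult.minus_left mat_mult.minus_right)
    have QQ: "?Q ** mexp (t *\<^sub>R B) = mat 1"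
      using mexp_minus(2)[of "t *\<^sub>R B"] by simp
    have alg1: "P ** (- B ** Q) + (P ** (\<nu> + B)) ** Q = P ** \<nu> ** Q"
      for P Q :: "real^'k^'k"
      by (simp add: mat_mult.add_left mat_mult.add_right mat_mult.minus_left
          mat_mult.minus_right matrix_mul_assoc)
    have alg2: "P ** Q ** (R ** \<nu> ** Q) = P ** \<nu> ** Q" if "Q ** R = mat 1" for P Q R :: "real^'k^'k"
      using that by (metis matrix_mul_assoc matrix_mul_lid)
    \<comment> \<open>The terms with \<open>B\<close> cancel, and inserting
      \<open>?Q ** mexp (t *\<^sub>R B) = mat 1\<close> turns \<open>\<nu>\<close> into its
      conjugate \<open>a t\<close>.\<close>
    have "?P ** (?Q ** - B) + (?P ** (\<nu> + B)) ** ?Q = ?P ** \<nu> ** ?Q"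
      unfolding BQ by (rule alg1)
    also have "\<dots> = ?P ** ?Q ** a t"
      using alg2[OF QQ, of ?P] by (simp add: a_def)
    finally have PQ': "((\<lambda>t. mexp (t *\<^sub>R (\<nu> + B)) ** mexp (t *\<^sub>R - B)) has_vector_derivative
        ?P ** ?Q ** a t) ?F" using PQ by (simp only:)
    have aW: "a t ** ?W = ?W ** a t"
      by (rule mexp_commute) (intro comm aN subspace_neg wN N)
    have "(k has_vector_derivative (?P ** ?Q) ** (?W ** - a t) + (?P ** ?Q ** a t) ** ?W) ?F"
      unfolding k_def by (rule mat_mult.has_vector_derivative[OF PQ' W])
    moreover have "(?P ** ?Q) ** (?W ** - a t) + (?P ** ?Q ** a t) ** ?W = 0"
      by (simp only: mat_mult.minus_right aW flip: matrix_mul_assoc) simp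
    ultimately show ?thesis by (simp only:)
  qed
  obtain c where "\<And>t. t \<in> {0..1} \<Longrightarrow> k t = c"
    using has_vector_derivative_zero_constant[of "{0..1}" k] dk by auto
  then have "k 1 = k 0" by simp
  then have "mexp (\<nu> + B) ** mexp (- B) ** mexp (- w 1) = mat 1"
    by (simp add: k_def w_def)
  then have "mexp (\<nu> + B) ** mexp (- B) ** mexp (- w 1) ** mexp (w 1) ** mexp B = mexp (w 1) ** mexp B"
    by simp
  moreover have "mexp (\<nu> + B) ** mexp (- B) ** mexp (- w 1) ** mexp (w 1) ** mexp B
      = mexp (\<nu> + B) ** (mexp (- B) ** (mexp (- w 1) ** mexp (w 1)) ** mexp B)"
    by (simp only: matrix_mul_assoc)
  ultimately show ?thesis
    using wN[of 1] by auto
qed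

lemma orthogonal_projection_exists:
  fixes S :: "'a::euclidean_space set"
  assumes "subspace S"
  obtains \<pi> where "linear \<pi>" "\<And>x. \<pi> x \<in> S" "\<And>x s. s \<in> S \<Longrightarrow> (x - \<pi> x) \<bullet> s = 0"
    "\<And>x. x \<in> S \<Longrightarrow> \<pi> x = x"
proof -
  have ex: "\<exists>y. y \<in> S \<and> (\<forall>s\<in>S. (x - y) \<bullet> s = 0)" for x
    using orthogonal_subspace_decomp_exists[of S x] assms span_eq_iff[of S]
    by (metis add_diff_cancel_left' orthogonal_def)
  define \<pi> where "\<pi> x = (SOME y. y \<in> S \<and> (\<forall>s\<in>S. (x - y) \<bullet> s = 0))" for x
  have pi: "\<pi> x \<in> S" "\<And>s. s \<in> S \<Longrightarrow> (x - \<pi> x) \<bullet> s = 0" for x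
    using someI_ex[OF ex[of x]] by (auto simp: \<pi>_def)
  have uniq: "y = \<pi> x" if "y \<in> S" "\<And>s. s \<in> S \<Longrightarrow> (x - y) \<bullet> s = 0" for x y
  proof -
    have S: "y - \<pi> x \<in> S" using that(1) pi(1) assms by (simp add: subspace_diff)
    have "(y - \<pi> x) \<bullet> (y - \<pi> x) = (x - \<pi> x) \<bullet> (y - \<pi> x) - (x - y) \<bullet> (y - \<pi> x)"
      by (simp add: inner_diff_left)
    also have "\<dots> = 0" using that(2)[OF S] pi(2)[OF S] by simp
    finally show ?thesis by simp
  qed
  have "linear \<pi>"
  proof (rule linearI)
    have i: "\<pi> x \<bullet> s = x \<bullet> s" if "s \<in> S" for x s
      using pi(2)[OF that, of x] by (simp add: inner_diff_left)
    show "\<pi> (x + y) = \<pi> x + \<pi> y" for x y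
      by (rule uniq[symmetric]) (simp_all add: i inner_diff_left inner_add_left pi(1) subspace_add[OF assms])
    show "\<pi> (c *\<^sub>R x) = c *\<^sub>R \<pi> x" for c x
      by (rule uniq[symmetric]) (simp_all add: i inner_diff_left pi(1) subspace_scale[OF assms])
  qed
  show ?thesis
  proof (rule that[OF \<open>linear \<pi>\<close> pi])
    show "\<pi> x = x" if "x \<in> S" for x using uniq[of x x] that by simp
  qed
qed

section \<open>The exponential near zero, limiting directions and countability\<close>

text \<open>Near \<open>0\<close> the error \<open>mexp X - mat 1 - X\<close> is at most half of
  \<open>X\<close> in norm; for \<open>mexp X = mat 1\<close> this reads
  \<open>norm X \<le> norm X / 2\<close>.\<close>

lemma mexp_kernel_isolated:
  "\<exists>\<epsilon>>0. \<forall>X::real^'k^'k. norm X < \<epsilon> \<longrightarrow> mexp X = mat 1 \<longrightarrow> X = 0"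
proof -
  from mexp_has_derivative_0 obtain \<epsilon> where \<epsilon>: "\<epsilon> > 0"
    and d: "\<And>X::real^'k^'k. norm X < \<epsilon> \<Longrightarrow> norm (mexp X - mat 1 - X) \<le> 1/2 * norm X"
    unfolding has_derivative_at_alt by (metis diff_zero half_gt_zero_iff mexp_zero zero_less_one)
  show ?thesis
  proof (intro exI conjI allI impI)
    show "X = 0" if "norm X < \<epsilon>" "mexp X = mat 1" for X :: "real^'k^'k"
      using d[OF that(1)] that(2) by simp
  qed (rule \<epsilon>)
qed

text \<open>The product map has derivative \<open>id\<close> at \<open>0\<close>, so the open
  mapping theorem for continuous maps differentiable at one point applies. With a projection
  \<open>\<pi>\<close> this gives coordinates adapted to a subspace and a complement.\<close>

lemma mexp_product_open:
  fixes \<pi> :: "real^'k^'k \<Rightarrow> real^'k^'k"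
  assumes "linear \<pi>" and "\<epsilon> > 0"
  shows "\<exists>\<delta>>0. \<forall>g. norm (g - mat 1) < \<delta> \<longrightarrow> (\<exists>W. norm W < \<epsilon> \<and> g = mexp (\<pi> W) ** mexp (W - \<pi> W))"
proof -
  let ?F = "\<lambda>W. mexp (\<pi> W) ** mexp (W - \<pi> W)"
  have \<pi>: "bounded_linear \<pi>" using assms(1) by (simp add: linear_conv_bounded_linear)
  then have \<pi>0: "\<pi> 0 = 0" using assms(1) linear_0 by blast
  have der: "(?F has_derivative (\<lambda>W. mexp (\<pi> 0) ** (W - \<pi> W) + \<pi> W ** mexp (0 - \<pi> 0))) (at 0)"
  proof (rule mat_mult.FDERIV)
    show "((\<lambda>W. mexp (\<pi> W)) has_derivative \<pi>) (at 0)"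
      by (rule has_derivative_compose[of \<pi> \<pi> 0 UNIV mexp "\<lambda>x. x"])
        (simp_all add: \<pi>0 mexp_has_derivative_0 bounded_linear_imp_has_derivative \<pi>)
    show "((\<lambda>W. mexp (W - \<pi> W)) has_derivative (\<lambda>W. W - \<pi> W)) (at 0)"
      by (rule has_derivative_compose[of "\<lambda>W. W - \<pi> W" "\<lambda>W. W - \<pi> W" 0 UNIV mexp "\<lambda>x. x"])
        (auto simp: \<pi>0 mexp_has_derivative_0 intro!: bounded_linear_imp_has_derivative bounded_linear_sub \<pi>)
  qed
  have eq: "(\<lambda>W. mexp (\<pi> 0) ** (W - \<pi> W) + \<pi> W ** mexp (0 - \<pi> 0)) = id"
    by (auto simp: \<pi>0)
  have "?F 0 \<in> interior (?F ` ball 0 \<epsilon>)"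
  proof (rule sussmann_open_mapping[OF open_UNIV _ UNIV_I, where g' = id])
    show "(?F has_derivative id) (at 0)" using der unfolding eq .
    show "continuous_on UNIV ?F"
      by (intro mat_mult.continuous_on continuous_intros linear_continuous_on \<pi>)
  qed (use assms in \<open>auto simp: id_def interior_open\<close>)
  then obtain \<delta> where "\<delta> > 0" and \<delta>: "ball (mat 1) \<delta> \<subseteq> ?F ` ball 0 \<epsilon>"
    by (auto simp: mem_interior \<pi>0)
  show ?thesis
  proof (intro exI[of _ \<delta>] conjI allI impI)
    fix g :: "real^'k^'k" assume "norm (g - mat 1) < \<delta>"
    then have "g \<in> ball (mat 1) \<delta>" by (simp add: dist_norm norm_minus_commute)
    then have "g \<in> ?F ` ball 0 \<epsilon>" using \<delta> by blast
    then show "\<exists>W. norm W < \<epsilon> \<and> g = ?F W" by auto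
  qed (rule \<open>\<delta> > 0\<close>)
qed

text \<open>The directions of the \<open>Y j\<close> accumulate at \<open>y\<close>. As
  \<open>Y j\<close> shrinks, its integer multiples subdivide the ray ever more finely and
  approximate each \<open>t *\<^sub>R y\<close>; this is the limiting step behind the closed
  subgroup theorem.\<close>

lemma one_parameter_limit:
  fixes Y :: "nat \<Rightarrow> real^'k^'k"
  assumes "subspace S" and "\<And>j. Y j \<in> S" and nz: "\<And>j. Y j \<noteq> 0" and lim: "Y \<longlonglongrightarrow> 0"
  obtains y where "y \<in> S" "norm y = 1"
    "\<And>\<Gamma> t. (\<And>j n. mexp (real n *\<^sub>R Y j) \<in> \<Gamma>) \<Longrightarrow> t \<ge> 0 \<Longrightarrow> mexp (t *\<^sub>R y) \<in> closure \<Gamma>"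
proof -
  have "seq_compact (sphere 0 1 :: (real^'k^'k) set)" by (simp add: compact_imp_seq_compact)
  moreover have "\<forall>j. Y j /\<^sub>R norm (Y j) \<in> sphere 0 1" using nz by simp
  ultimately obtain y r where y: "y \<in> sphere 0 1" and r: "strict_mono r"
    and ylim: "((\<lambda>j. Y j /\<^sub>R norm (Y j)) \<circ> r) \<longlonglongrightarrow> y"
    by (rule seq_compactE) auto
  have ny: "norm y = 1" using y by simp
  have "((\<lambda>j. Y j /\<^sub>R norm (Y j)) \<circ> r) j \<in> S" for j
    using assms by (simp add: subspace_scale)
  then have yS: "y \<in> S"
    using closed_sequentially[OF closed_subspace[OF assms(1)] _ ylim] by blast
  have nlim: "(\<lambda>j. norm (Y (r j))) \<longlonglongrightarrow> 0"
    using LIMSEQ_subseq_LIMSEQ[OF tendsto_norm_zero[OF lim] r] by (simp add: o_def)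
  show ?thesis
  proof (rule that[OF yS ny])
    fix \<Gamma> t assume \<Gamma>: "\<And>j n. mexp (real n *\<^sub>R Y j) \<in> \<Gamma>" and t: "(t::real) \<ge> 0"
    \<comment> \<open>The multiple of \<open>norm (Y (r j))\<close> just below \<open>t\<close>
      misses it by at most that norm, which tends to \<open>0\<close>.\<close>
    define n where "n j = nat \<lfloor>t / norm (Y (r j))\<rfloor>" for j
    have bound: "norm (real (n j) * norm (Y (r j)) - t) \<le> norm (Y (r j))" for j
    proof -
      let ?a = "norm (Y (r j))"
      have a: "?a > 0" using nz by simp
      have n: "real (n j) = of_int \<lfloor>t / ?a\<rfloor>" using t by (simp add: n_def)
      have "real (n j) \<le> t / ?a" "t / ?a < real (n j) + 1" unfolding n by linarith+
      then have "real (n j) * ?a \<le> t" "t < (real (n j) + 1) * ?a"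
        using a by (simp_all add: field_simps)
      then show ?thesis by (simp add: algebra_simps abs_le_iff)
    qed
    have "(\<lambda>j. real (n j) * norm (Y (r j)) - t) \<longlonglongrightarrow> 0"
      by (rule Lim_null_comparison[OF _ nlim]) (simp add: bound del: real_norm_def)
    then have "(\<lambda>j. real (n j) * norm (Y (r j))) \<longlonglongrightarrow> t"
      using LIM_zero_iff by blast
    from tendsto_scaleR[OF this ylim]
    have "(\<lambda>j. real (n j) *\<^sub>R Y (r j)) \<longlonglongrightarrow> t *\<^sub>R y"
      using nz by (simp add: mult.assoc)
    then have "(\<lambda>j. mexp (real (n j) *\<^sub>R Y (r j))) \<longlonglongrightarrow> mexp (t *\<^sub>R y)" by (rule tendsto_mexp)
    then show "mexp (t *\<^sub>R y) \<in> closure \<Gamma>"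
      using \<Gamma> unfolding closure_sequential by (metis (no_types, lifting))
  qed
qed

text \<open>\<open>\<Lambda>\<close> is uniformly discrete, hence countable, while \<open>t\<close>
  runs through an uncountable interval. Two parameters share the residue
  \<open>t *\<^sub>R X - Z\<close>, and their difference puts a nonzero multiple of \<open>X\<close>
  into \<open>K\<close>.\<close>

lemma pigeonhole_subspace:
  fixes \<Lambda> :: "'a::euclidean_space set"
  assumes "\<epsilon> > 0" and iso: "\<And>x y. x \<in> \<Lambda> \<Longrightarrow> y \<in> \<Lambda> \<Longrightarrow> norm (x - y) < \<epsilon> \<Longrightarrow> x = y"
    and "subspace K" and K: "\<And>t. t \<ge> 0 \<Longrightarrow> \<exists>Z\<in>K. t *\<^sub>R X - Z \<in> \<Lambda>"
  shows "X \<in> K"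
proof -
  have "uniform_discrete \<Lambda>"
    unfolding uniform_discrete_def using assms(1) iso by (auto simp: dist_norm)
  then have "countable \<Lambda>"
    using sparse_imp_countable[OF open_UNIV uniform_discrete_imp_sparse, of \<Lambda>] by simp
  define Z where "Z t = (SOME Z. Z \<in> K \<and> t *\<^sub>R X - Z \<in> \<Lambda>)" for t
  have Z: "Z t \<in> K" "t *\<^sub>R X - Z t \<in> \<Lambda>" if "t \<ge> 0" for t
    using someI_ex[of "\<lambda>Z. Z \<in> K \<and> t *\<^sub>R X - Z \<in> \<Lambda>"] K[OF that] by (auto simp: Z_def)
  have "\<not> inj_on (\<lambda>t. t *\<^sub>R X - Z t) {0..1}"
  proof
    assume inj: "inj_on (\<lambda>t. t *\<^sub>R X - Z t) {0..1}"
    have "countable ((\<lambda>t. t *\<^sub>R X - Z t) ` {0..1})"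
      by (rule countable_subset[OF _ \<open>countable \<Lambda>\<close>]) (auto intro: Z)
    then have "countable {0..1::real}" using inj by (rule countable_image_inj_on)
    then show False using uncountable_closed_interval[of 0 1] by simp
  qed
  then obtain s t where st: "s \<in> {0..1}" "t \<in> {0..1}" "s \<noteq> t" "s *\<^sub>R X - Z s = t *\<^sub>R X - Z t"
    by (auto simp: inj_on_def)
  then have "(s - t) *\<^sub>R X = Z s - Z t" by (simp add: algebra_simps)
  moreover have "Z s - Z t \<in> K" using st Z assms(3) by (intro subspace_diff) auto
  ultimately have "inverse (s - t) *\<^sub>R ((s - t) *\<^sub>R X) \<in> K" using assms(3) by (metis subspace_scale)
  then show ?thesis using st by simp
qed

subsection \<open>Groups generated by exponentials\<close>

text \<open>Words in exponentials without inverses: when \<open>g\<close> is a subspace,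
  \<open>mexp (- A)\<close> supplies them. Growth by one left factor keeps inductions
  simple.\<close>

inductive_set lie_group :: "(real^'k^'k) set \<Rightarrow> (real^'k^'k) set" for g where
  one: "mat 1 \<in> lie_group g"
| step: "A \<in> g \<Longrightarrow> x \<in> lie_group g \<Longrightarrow> mexp A ** x \<in> lie_group g"

lemma mexp_in_lie_group: "A \<in> g \<Longrightarrow> mexp A \<in> lie_group g"
  using lie_group.step[OF _ lie_group.one, of A g] by simp

lemma lie_group_mult: "x \<in> lie_group g \<Longrightarrow> y \<in> lie_group g \<Longrightarrow> x ** y \<in> lie_group g"
  by (induction x rule: lie_group.induct) (auto simp: lie_group.step simp flip: matrix_mul_assoc)

lemma lie_group_mono:
  assumes "x \<in> lie_group g" and "g \<subseteq> g'"
  shows "x \<in> lie_group g'"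
  using assms(1)
  by (induction x rule: lie_group.induct) (use assms(2) in \<open>auto intro: lie_group.intros\<close>)

lemma lie_group_inverse:
  assumes "subspace g" and "x \<in> lie_group g"
  shows "\<exists>y\<in>lie_group g. x ** y = mat 1 \<and> y ** x = mat 1"
  using assms(2)
proof (induction x rule: lie_group.induct)
  case one
  then show ?case by (auto intro: bexI[of _ "mat 1"] lie_group.one)
next
  case (step A x)
  then obtain y where y: "y \<in> lie_group g" "x ** y = mat 1" "y ** x = mat 1" by blast
  have "y ** mexp (- A) \<in> lie_group g"
    using step(1) y assms(1) by (intro lie_group_mult mexp_in_lie_group subspace_neg)
  moreover have "mexp A ** x ** (y ** mexp (- A)) = mat 1"
    by (metis y(2) mexp_minus(1) matrix_mul_assoc matrix_mul_rid)
  moreover have "y ** mexp (- A) ** (mexp A ** x) = mat 1"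
    by (metis y(3) mexp_minus(2) matrix_mul_assoc matrix_mul_rid)
  ultimately show ?case by blast
qed

lemma lie_group_commute:
  assumes "x \<in> lie_group g" and "\<And>A. A \<in> g \<Longrightarrow> A ** M = M ** A"
  shows "x ** M = M ** x"
  using assms(1)
proof (induction x rule: lie_group.induct)
  case (step A x)
  have "mexp A ** M = M ** mexp A" using mexp_commute[of M A] assms(2)[OF step(1)] by simp
  then show ?case using step(3) by (metis matrix_mul_assoc)
qed simp

lemma lie_group_fixes:
  assumes "x \<in> lie_group g" and "\<And>A. A \<in> g \<Longrightarrow> A *v v = 0"
  shows "x *v v = v"
  using assms(1)
  by (induction x rule: lie_group.induct) (simp_all add: assms(2) mexp_fixes flip: matrix_vector_mul_assoc)

lemma lie_group_bilinear:
  fixes \<beta> :: "real^'k \<Rightarrow> real^'k \<Rightarrow> real"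
  assumes "x \<in> lie_group g" and "bounded_bilinear \<beta>"
    and "\<And>A v w. A \<in> g \<Longrightarrow> \<beta> (A *v v) w + \<beta> v (A *v w) = 0"
  shows "\<beta> (x *v v) (x *v w) = \<beta> v w"
  using assms(1)
  by (induction x rule: lie_group.induct)
    (simp_all add: assms(3) mexp_bilinear_invariant[OF assms(2)] flip: matrix_vector_mul_assoc)

lemma lie_group_conj_subspace:
  assumes "x \<in> lie_group g" and "x ** y = mat 1" and "subspace N"
    and "\<And>A X. A \<in> g \<Longrightarrow> X \<in> N \<Longrightarrow> lie_bracket A X \<in> N" and "X \<in> N"
  shows "x ** X ** y \<in> N"
  using assms(1,2)
proof (induction x arbitrary: y rule: lie_group.induct)
  case one
  then show ?case using assms(5) by simp
next
  case (step A x)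
  \<comment> \<open>A right inverse \<open>y\<close> of \<open>mexp A ** x\<close> yields the right
    inverse \<open>y ** mexp A\<close> of \<open>x\<close>, to which the induction hypothesis
    applies; hence \<open>y\<close> is kept arbitrary.\<close>
  have x: "x ** (y ** mexp A) = mat 1"
  proof -
    have "mexp A ** (x ** y) = mat 1" using step(4) by (simp add: matrix_mul_assoc)
    then have "x ** y = mexp (- A)"
      by (metis matrix_mul_assoc matrix_mul_lid matrix_mul_rid mexp_minus(2))
    then show ?thesis by (simp add: matrix_mul_assoc)
  qed
  have "mexp A ** (x ** X ** (y ** mexp A)) ** mexp (- A) \<in> N"
    by (rule mexp_conj_subspace[OF assms(3) assms(4)[OF step(1)] step.IH[OF x]])
  moreover have "mexp A ** (x ** X ** (y ** mexp A)) ** mexp (- A)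
      = mexp A ** x ** X ** y ** (mexp A ** mexp (- A))"
    by (simp only: matrix_mul_assoc)
  ultimately show ?case by simp
qed

subsection \<open>The commutator subgroup is compact\<close>

text \<open>Jacobi's formula at the identity. A permutation other than \<open>id\<close> moves two
  indices, so after differentiating one factor an off-diagonal zero remains; only \<open>id\<close>
  contributes.\<close>

lemma det_has_vector_derivative:
  fixes g :: "real \<Rightarrow> complex^'k^'k"
  assumes "(g has_vector_derivative M) (at t)" and "g t = mat 1"
  shows "((\<lambda>s. det (g s)) has_vector_derivative trace M) (at t)"
proof -
  have comp: "((\<lambda>s. g s $ i $ j) has_derivative (\<lambda>h. h *\<^sub>R (M $ i $ j))) (at t)" for i j
  proof -
    have "bounded_linear (\<lambda>A::complex^'k^'k. A $ i $ j)"
      by (intro bounded_linear_compose[OF bounded_linear_vec_nth bounded_linear_vec_nth])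
    from bounded_linear.has_vector_derivative[OF this assms(1)] show ?thesis
      by (simp add: has_vector_derivative_def)
  qed
  let ?P = "{p. p permutes (UNIV::'k set)}"
  let ?D = "\<lambda>p. of_int (sign p) * (\<Sum>i\<in>UNIV. M $ i $ p i * (\<Prod>j\<in>UNIV - {i}. g t $ j $ p j)) :: complex"
  have "((\<lambda>s. det (g s)) has_derivative (\<lambda>h. \<Sum>p\<in>?P. of_int (sign p) *
      (\<Sum>i\<in>UNIV. h *\<^sub>R (M $ i $ p i) * (\<Prod>j\<in>UNIV - {i}. g t $ j $ p j)))) (at t)"
    unfolding det_def by (intro has_derivative_sum has_derivative_mult_right has_derivative_prod comp)
  moreover have "(\<lambda>h. \<Sum>p\<in>?P. of_int (sign p) *
      (\<Sum>i\<in>UNIV. h *\<^sub>R (M $ i $ p i) * (\<Prod>j\<in>UNIV - {i}. g t $ j $ p j))) = (\<lambda>h. h *\<^sub>R sum ?D ?P)"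
    by (intro ext) (simp add: scaleR_conv_of_real sum_distrib_left mult_ac)
  moreover have "sum ?D ?P = sum ?D {id}"
  proof (rule sum.mono_neutral_right)
    show "finite ?P" by (rule finite_permutations) simp
    show "{id} \<subseteq> ?P" by (simp add: permutes_id)
    have "(\<Sum>i\<in>UNIV. M $ i $ p i * (\<Prod>j\<in>UNIV - {i}. g t $ j $ p j)) = 0" if p: "p \<in> ?P - {id}" for p
    proof (intro sum.neutral ballI)
      fix i :: 'k
      from p obtain a where a: "p a \<noteq> a" by (auto simp: fun_eq_iff)
      have "p (p a) \<noteq> p a" using p a by (metis Diff_iff mem_Collect_eq permutes_inj injD)
      then obtain j where "j \<noteq> i" "p j \<noteq> j" using a by metis
      then have "(\<Prod>j\<in>UNIV - {i}. g t $ j $ p j) = 0"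
        by (intro prod_zero bexI[of _ j]) (auto simp: assms(2) mat_def)
      then show "M $ i $ p i * (\<Prod>j\<in>UNIV - {i}. g t $ j $ p j) = 0" by simp
    qed
    then show "\<forall>p\<in>?P - {id}. ?D p = 0" by simp
  qed
  moreover have "sum ?D {id} = trace M" by (simp add: assms(2) mat_def trace_def)
  ultimately show ?thesis by (simp add: has_vector_derivative_def)
qed

section \<open>Trace form, centre and commutant\<close>

lemma inner_matrix_trace: "(A::real^'k^'k) \<bullet> B = trace (transpose A ** B)"
  unfolding trace_def matrix_matrix_mult_def inner_vec_def transpose_def
  by (subst sum.swap) simp

text \<open>Cyclicity of the trace makes \<open>ad A\<close> skew for the standard inner product,
  which takes over the role of the Killing form.\<close>

lemma inner_lie_bracket_skew:
  fixes A Y B :: "real^'k^'k"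
  assumes "transpose A = - A"
  shows "lie_bracket A Y \<bullet> B = - (Y \<bullet> lie_bracket A B)"
proof -
  have 1: "(A ** Y) \<bullet> B = Y \<bullet> (transpose A ** B)"
    by (simp add: inner_matrix_trace matrix_transpose_mul matrix_mul_assoc)
  have "(Y ** A) \<bullet> B = trace (transpose A ** (transpose Y ** B))"
    by (simp add: inner_matrix_trace matrix_transpose_mul matrix_mul_assoc)
  also have "\<dots> = trace (transpose Y ** (B ** transpose A))"
    by (subst trace_mul_sym) (simp add: matrix_mul_assoc)
  finally have 2: "(Y ** A) \<bullet> B = Y \<bullet> (B ** transpose A)"
    by (simp add: inner_matrix_trace)
  show ?thesis
    by (simp add: lie_bracket_def inner_diff_left inner_diff_right 1 2 assms mat_mult.minus_left
        mat_mult.minus_right)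
qed

lemma subspace_commutant: "subspace (commutant h)"
  by (simp add: commutant_def)

lemma lie_bracket_in_commutant: "A \<in> h \<Longrightarrow> B \<in> h \<Longrightarrow> lie_bracket A B \<in> commutant h"
  unfolding commutant_def by (rule span_base) blast

lemma lie_bracket_eq_0_commute: "lie_bracket A B = 0 \<longleftrightarrow> lie_bracket B A = 0"
  by (auto simp: lie_bracket_def)

lemma subspace_lie_center:
  assumes "subspace h"
  shows "subspace (lie_center h)"
proof -
  have "lie_center h = h \<inter> (\<Inter>B\<in>h. {A. lie_bracket B A = 0})"
    by (auto simp: lie_center_def lie_bracket_eq_0_commute)
  moreover have "subspace {A. lie_bracket B A = 0}" for B :: "real^'k^'k"
    using linear_subspace_kernel[OF linear_lie_bracket] .
  ultimately show ?thesis using assms by (auto intro!: subspace_inter subspace_Inter)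
qed

lemma lie_center_commute: "Z \<in> lie_center h \<Longrightarrow> A \<in> h \<Longrightarrow> Z ** A = A ** Z"
  by (simp add: lie_center_def lie_bracket_def)

locale matrix_lie_algebra =
  fixes h :: "(real^'k^'k) set"
  assumes sub: "subspace h" and br: "\<And>A B. A \<in> h \<Longrightarrow> B \<in> h \<Longrightarrow> lie_bracket A B \<in> h"
begin

lemma commutant_subset: "commutant h \<subseteq> h"
  unfolding commutant_def using br sub by (intro span_minimal) auto

lemma center_subset: "lie_center h \<subseteq> h"
  by (auto simp: lie_center_def)

lemma subspace_center: "subspace (lie_center h)"
  using subspace_lie_center[OF sub] .

lemma center_comm: "X \<in> lie_center h \<Longrightarrow> Y \<in> lie_center h \<Longrightarrow> X ** Y = Y ** X"
  using lie_center_commute center_subset by blast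

end

locale skew_lie_algebra = matrix_lie_algebra h for h :: "(real^'k^'k) set" +
  assumes skew: "\<And>A. A \<in> h \<Longrightarrow> transpose A = - A"
begin

text \<open>The orthogonal complement of the commutant in \<open>h\<close> is central: for
  \<open>Z\<close> there, the squared norm of \<open>[B, Z]\<close> is minus the pairing of
  \<open>Z\<close> with the bracket \<open>[B, [B, Z]]\<close>, which is zero.\<close>

lemma decomposition:
  assumes "A \<in> h"
  shows "\<exists>Z\<in>lie_center h. A - Z \<in> commutant h"
proof -
  obtain \<pi> where \<pi>: "linear \<pi>" "\<And>x. \<pi> x \<in> commutant h"
    "\<And>x s. s \<in> commutant h \<Longrightarrow> (x - \<pi> x) \<bullet> s = 0"
    using orthogonal_projection_exists[OF subspace_commutant[of h]] by metis
  let ?Z = "A - \<pi> A"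
  have Zh: "?Z \<in> h" using assms \<pi>(2) commutant_subset sub by (blast intro: subspace_diff)
  have "lie_bracket B ?Z = 0" if B: "B \<in> h" for B
  proof -
    have "lie_bracket B ?Z \<bullet> lie_bracket B ?Z = - (?Z \<bullet> lie_bracket B (lie_bracket B ?Z))"
      by (rule inner_lie_bracket_skew[OF skew[OF B]])
    also have "\<dots> = 0"
      using \<pi>(3)[OF lie_bracket_in_commutant[OF B br[OF B Zh]]] by simp
    finally show ?thesis by simp
  qed
  then have "?Z \<in> lie_center h"
    using Zh by (simp add: lie_center_def lie_bracket_neg[of ?Z])
  then show ?thesis using \<pi>(2)[of A] by (intro bexI[of _ ?Z]) auto
qed

lemma center_Int_commutant:
  assumes "Z \<in> lie_center h" and "Z \<in> commutant h"
  shows "Z = 0"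
proof -
  have "orthogonal Z X" if "X \<in> {lie_bracket A B | A B. A \<in> h \<and> B \<in> h}" for X
  proof -
    from that obtain A B where X: "X = lie_bracket A B" "A \<in> h" "B \<in> h" by blast
    have "lie_bracket A Z = 0" using assms(1) X(2) by (simp add: lie_center_def lie_bracket_neg[of A])
    then have "Z \<bullet> X = 0" using inner_lie_bracket_skew[OF skew[OF X(2)], of Z B] X(1) by simp
    then show ?thesis by (simp add: orthogonal_def)
  qed
  then have "orthogonal Z Z"
    using orthogonal_to_span[OF assms(2)[unfolded commutant_def]] by blast
  then show ?thesis by (simp add: orthogonal_self)
qed

end

text \<open>\<open>x\<close> maximizes \<open>norm (Y *v x)\<close> on the unit sphere and
  \<open>c\<close> is the squared maximum. The form
  \<open>c * (y \<bullet> y) - norm (Y *v y) ^ 2\<close> is nonnegative and vanishes at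
  \<open>x\<close>, so its first variation there vanishes.\<close>

lemma gram_eigenvector:
  fixes Y :: "real^'k^'k"
  assumes "Y \<noteq> 0"
  obtains c x where "c > 0" "x \<noteq> 0" "transpose Y *v (Y *v x) = c *\<^sub>R x"
proof -
  have "continuous_on (sphere 0 1) (\<lambda>x. norm (Y *v x))"
    by (intro continuous_intros linear_continuous_on matrix_vector_mul_bounded_linear)
  moreover have ne: "sphere 0 1 \<noteq> ({} :: (real^'k) set)" by simp
  ultimately obtain x where x: "x \<in> sphere 0 1" and max: "\<And>y. y \<in> sphere 0 1 \<Longrightarrow> norm (Y *v y) \<le> norm (Y *v x)"
    using continuous_attains_sup[of "sphere 0 1 :: (real^'k) set" "\<lambda>x. norm (Y *v x)"] by auto
  define c where "c = norm (Y *v x) ^ 2"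
  have nx: "x \<bullet> x = 1" using x by (simp add: norm_eq_1)
  have le: "norm (Y *v y) ^ 2 \<le> c * (y \<bullet> y)" for y
  proof (cases "y = 0")
    case False
    have "norm (Y *v (y /\<^sub>R norm y)) \<le> norm (Y *v x)" using False by (intro max) simp
    then have "norm (Y *v y) / norm y \<le> norm (Y *v x)"
      by (simp add: matrix_vector_mult_scaleR divide_inverse mult.commute)
    then have "norm (Y *v y) \<le> norm (Y *v x) * norm y" using False by (simp add: divide_le_eq)
    then have "norm (Y *v y) ^ 2 \<le> (norm (Y *v x) * norm y) ^ 2" by (rule power_mono) simp
    then show ?thesis by (simp add: c_def power_mult_distrib power2_norm_eq_inner)
  qed simp
  have "c > 0"
  proof (rule ccontr)
    assume "\<not> c > 0"
    then have "c = 0" by (simp add: c_def)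
    then have "Y *v y = 0" for y using le[of y] by simp
    then show False using assms by (metis matrix_eq matrix_vector_mult_0)
  qed
  have "transpose Y *v (Y *v x) - c *\<^sub>R x = 0"
  proof -
    let ?w = "c *\<^sub>R x - transpose Y *v (Y *v x)"
    have ip: "(Y *v a) \<bullet> (Y *v b) = (transpose Y *v (Y *v a)) \<bullet> b" for a b
      by (simp add: dot_lmul_matrix matrix_vector_mul_assoc flip: vector_transpose_matrix)
    have quad: "0 \<le> 2 * t * (?w \<bullet> y) + t\<^sup>2 * (c * (y \<bullet> y))" for t y
    proof -
      have "norm (Y *v (x + t *\<^sub>R y)) ^ 2 = c + 2 * t * ((Y *v x) \<bullet> (Y *v y)) + t\<^sup>2 * norm (Y *v y) ^ 2"
        unfolding c_def power2_norm_eq_inner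
        by (simp add: matrix_vector_right_distrib matrix_vector_mult_scaleR
            inner_add_left inner_add_right inner_commute power2_eq_square algebra_simps)
      moreover have "c * ((x + t *\<^sub>R y) \<bullet> (x + t *\<^sub>R y)) = c + c * 2 * t * (x \<bullet> y) + t\<^sup>2 * (c * (y \<bullet> y))"
        by (simp add: nx inner_add_left inner_add_right inner_commute power2_eq_square algebra_simps)
      moreover have "t\<^sup>2 * norm (Y *v y) ^ 2 \<ge> 0" by simp
      ultimately have "0 \<le> c * 2 * t * (x \<bullet> y) - 2 * t * ((Y *v x) \<bullet> (Y *v y)) + t\<^sup>2 * (c * (y \<bullet> y))"
        using le[of "x + t *\<^sub>R y"] by linarith
      also have "\<dots> = 2 * t * (?w \<bullet> y) + t\<^sup>2 * (c * (y \<bullet> y))"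
        by (simp add: ip inner_diff_left algebra_simps)
      finally show ?thesis .
    qed
    have "?w \<bullet> ?w = 0"
    proof (rule ccontr)
      assume "?w \<bullet> ?w \<noteq> 0"
      then have pos: "?w \<bullet> ?w > 0" by (metis inner_ge_zero less_eq_real_def)
      \<comment> \<open>\<open>t = - 1 / c\<close> minimizes the quadratic in the direction
        \<open>?w\<close> and makes it negative.\<close>
      have "0 \<le> 2 * (- 1 / c) * (?w \<bullet> ?w) + (- 1 / c)\<^sup>2 * (c * (?w \<bullet> ?w))" by (rule quad)
      also have "\<dots> = - (?w \<bullet> ?w) / c"
        using \<open>c > 0\<close> by (simp add: power2_eq_square field_simps)
      also have "\<dots> < 0" using pos \<open>c > 0\<close> by (intro divide_neg_pos) auto
      finally show False by simp
    qed
    then show ?thesis by (simp only: inner_eq_zero_iff) simp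
  qed
  then show ?thesis using \<open>c > 0\<close> x by (intro that[of c x]) auto
qed

section \<open>Complex determinants on the range of a projection\<close>

definition cmat :: "real^'k^'k \<Rightarrow> complex^'k^'k" where
  "cmat A = (\<chi> i j. complex_of_real (A $ i $ j))"

lemma cmat_simps:
  "cmat (A ** B) = cmat A ** cmat B" "cmat (A + B) = cmat A + cmat B"
  "cmat (A - B) = cmat A - cmat B" "cmat (- A) = - cmat A" "cmat (mat 1) = mat 1"
  "cmat (c *\<^sub>R A) = c *\<^sub>R cmat A"
  by (simp_all add: cmat_def matrix_matrix_mult_def vec_eq_iff mat_def scaleR_conv_of_real[where 'a = complex])

lemma bounded_linear_cmat_mult: "bounded_linear (\<lambda>A. cmat A ** (P :: complex^'k^'k))"
  unfolding linear_conv_bounded_linear[symmetric]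
  by (intro linearI) (simp_all add: cmat_simps matrix_matrix_mult_def vec_eq_iff sum.distrib
      algebra_simps scaleR_sum_right)

lemma continuous_on_det:
  fixes F :: "'a::topological_space \<Rightarrow> complex^'k^'k"
  assumes "continuous_on S F"
  shows "continuous_on S (\<lambda>x. det (F x))"
proof -
  have "continuous_on S (\<lambda>x. F x $ i $ j)" for i j
    using assms by (intro continuous_on_component)
  then show ?thesis
    unfolding det_def
    by (intro continuous_on_sum continuous_on_mult continuous_on_const continuous_on_prod)
qed

lemma mat_mult_nth: "(mat (c :: complex) ** (A :: complex^'k^'k)) $ i $ j = c * A $ i $ j"
  by (simp add: matrix_matrix_mult_def mat_def if_distrib if_distribR cong: if_cong)

lemma mult_mat_nth: "((A :: complex^'k^'k) ** mat (c :: complex)) $ i $ j = c * A $ i $ j"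
  by (simp add: matrix_matrix_mult_def mat_def if_distrib if_distribR mult.commute cong: if_cong)

text \<open>For \<open>g\<close> commuting with the projection \<open>P\<close>, the determinant of \<open>g\<close> on the range of \<open>P\<close>.\<close>

definition range_det :: "complex^'k^'k \<Rightarrow> real^'k^'k \<Rightarrow> complex" where
  "range_det P g = det (cmat g ** P + (mat 1 - P))"

lemma matrix_add_rdistrib: "((B :: 'a::ring_1^'k^'k) + C) ** A = B ** A + C ** A"
  by (simp add: matrix_matrix_mult_def vec_eq_iff sum.distrib algebra_simps)

lemma matrix_diff_ldistrib: "(A :: 'a::ring_1^'k^'k) ** (B - C) = A ** B - A ** C"
  by (simp add: matrix_matrix_mult_def vec_eq_iff sum_subtractf algebra_simps)

lemma matrix_diff_rdistrib: "((B :: 'a::ring_1^'k^'k) - C) ** A = B ** A - C ** A"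
  by (simp add: matrix_matrix_mult_def vec_eq_iff sum_subtractf algebra_simps)

text \<open>\<open>cmat g ** P + (mat 1 - P)\<close> acts as \<open>g\<close> on the range of
  \<open>P\<close> and as the identity on its kernel. The right factor has to preserve the range for
  these operators to multiply.\<close>

lemma range_det_mult:
  assumes P: "P ** P = P" and g': "cmat g' ** P = P ** cmat g'"
  shows "range_det P (g ** g') = range_det P g * range_det P g'"
proof -
  have 1: "cmat g ** P ** (cmat g' ** P) = cmat g ** cmat g' ** P"
    by (metis P g' matrix_mul_assoc)
  have 2: "P ** (cmat g' ** P) = cmat g' ** P" by (metis P g' matrix_mul_assoc)
  have 3: "cmat g ** P ** P = cmat g ** P" by (metis P matrix_mul_assoc)
  have "(cmat g ** P + (mat 1 - P)) ** (cmat g' ** P + (mat 1 - P)) = cmat (g ** g') ** P + (mat 1 - P)"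
    by (simp add: matrix_add_ldistrib matrix_add_rdistrib matrix_diff_ldistrib matrix_diff_rdistrib
        1 2 3 P cmat_simps)
  then show ?thesis unfolding range_det_def by (metis det_mul)
qed

lemma range_det_one: "range_det P (mat 1) = 1"
  by (simp add: range_det_def cmat_simps)

lemma range_det_has_vector_derivative:
  "((\<lambda>t. range_det P (mexp (t *\<^sub>R A))) has_vector_derivative trace (cmat A ** P)) (at 0)"
  unfolding range_det_def
proof (rule det_has_vector_derivative)
  have "((\<lambda>t. mexp (t *\<^sub>R A)) has_vector_derivative A) (at 0)"
    using mexp_has_vector_derivative[of A 0 UNIV] by simp
  from bounded_linear.has_vector_derivative[OF bounded_linear_cmat_mult this, of P]
  show "((\<lambda>t. cmat (mexp (t *\<^sub>R A)) ** P + (mat 1 - P)) has_vector_derivative cmat A ** P) (at 0)"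
    by (simp add: has_vector_derivative_add_const)
qed (simp add: cmat_simps)

lemma cmat_mexp_commute:
  assumes "cmat A ** P = P ** cmat A"
  shows "cmat (mexp A) ** P = P ** cmat (mexp A)"
proof -
  have pow: "cmat (((**) A ^^ n) (mat 1)) ** P = P ** cmat (((**) A ^^ n) (mat 1))" for n
    by (induction n) (simp_all add: cmat_simps, metis assms matrix_mul_assoc)
  have bl: "bounded_linear (\<lambda>A. P ** cmat A)"
    unfolding linear_conv_bounded_linear[symmetric]
    by (intro linearI) (simp_all add: cmat_simps matrix_matrix_mult_def vec_eq_iff sum.distrib
      algebra_simps scaleR_sum_right)
  have "(\<lambda>n. cmat ((1 / fact n) *\<^sub>R ((**) A ^^ n) (mat 1)) ** P) sums (cmat (mexp A) ** P)"
    unfolding mexp_eq by (rule bounded_linear.sums[OF bounded_linear_cmat_mult mexp_sums])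
  moreover have "(\<lambda>n. P ** cmat ((1 / fact n) *\<^sub>R ((**) A ^^ n) (mat 1))) sums (P ** cmat (mexp A))"
    unfolding mexp_eq by (rule bounded_linear.sums[OF bl mexp_sums])
  moreover have "cmat ((1 / fact n) *\<^sub>R ((**) A ^^ n) (mat 1)) ** P
      = P ** cmat ((1 / fact n) *\<^sub>R ((**) A ^^ n) (mat 1))" for n
    unfolding linear_scale[OF bounded_linear.linear[OF bounded_linear_cmat_mult]]
      linear_scale[OF bounded_linear.linear[OF bl]] pow ..
  ultimately show ?thesis by (simp add: sums_unique2)
qed

text \<open>Multiplicativity spreads the zero derivative from \<open>0\<close> to every
  \<open>t\<close>, so the determinant is constant along \<open>exp (t A)\<close>.\<close>

lemma range_det_mexp:
  assumes P: "P ** P = P" and A: "cmat A ** P = P ** cmat A" and tr: "trace (cmat A ** P) = 0"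
  shows "range_det P (mexp A) = 1"
proof -
  let ?f = "\<lambda>t. range_det P (mexp (t *\<^sub>R A))"
  have add: "?f (s + t) = ?f s * ?f t" for s t
    unfolding mexp_scaleR_add
  proof (intro range_det_mult[OF P] cmat_mexp_commute)
    show "cmat (t *\<^sub>R A) ** P = P ** cmat (t *\<^sub>R A)"
      using A by (simp add: cmat_simps matrix_matrix_mult_def vec_eq_iff scaleR_sum_right[symmetric])
  qed
  have "(?f has_vector_derivative 0) (at t within UNIV)" for t
  proof -
    have "((\<lambda>s. ?f t * ?f (s - t)) has_vector_derivative ?f t * 0) (at t)"
    proof (rule has_vector_derivative_mult_right)
      have "(?f has_vector_derivative 0) (at (t - t))"
        using range_det_has_vector_derivative[of P A] tr by simp
      then show "((\<lambda>s. ?f (s - t)) has_vector_derivative 0) (at t)"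
        using vector_diff_chain_at[of "\<lambda>s. s - t" 1 t ?f 0]
        by (simp add: o_def has_vector_derivative_diff_const)
    qed
    then show ?thesis by (simp add: add[symmetric])
  qed
  then obtain c where "\<And>t. t \<in> UNIV \<Longrightarrow> ?f t = c"
    by (rule has_vector_derivative_zero_constant[OF convex_UNIV]) blast
  from this[of 1] this[of 0] show ?thesis by (simp add: range_det_one)
qed

lemma bounded_linear_transpose: "bounded_linear (transpose :: real^'k^'k \<Rightarrow> _)"
  unfolding linear_conv_bounded_linear[symmetric]
  by (intro linearI) (simp_all add: transpose_def vec_eq_iff)

lemma skew_inner:
  fixes A :: "real^'k^'k"
  assumes "transpose A = - A"
  shows "(A *v x) \<bullet> y = - (x \<bullet> (A *v y))"
proof -
  have "(A *v x) \<bullet> y = x \<bullet> (transpose A *v y)"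
    by (metis dot_lmul_matrix transpose_matrix_vector transpose_transpose)
  also have "transpose A *v y = - (A *v y)"
    unfolding assms by (simp add: matrix_vector_mult_def vec_eq_iff sum_negf)
  finally show ?thesis by simp
qed

lemma orthogonalI:
  fixes g :: "real^'k^'k"
  assumes "\<And>v w. (g *v v) \<bullet> (g *v w) = v \<bullet> w"
  shows "transpose g ** g = mat 1"
proof -
  have "v \<bullet> ((transpose g ** g) *v w) = v \<bullet> w" for v w
    using assms[of v w] by (metis dot_lmul_matrix transpose_matrix_vector transpose_transpose matrix_vector_mul_assoc)
  then have "(transpose g ** g) *v w = w" for w by (metis vector_eq_ldot)
  then show ?thesis by (simp add: matrix_eq)
qed

lemma closed_orthogonal_matrices: "closed {g::real^'k^'k. transpose g ** g = mat 1}"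
  by (intro closed_Collect_eq continuous_on_const mat_mult.continuous_on
      linear_continuous_on[OF bounded_linear_transpose] continuous_on_id)

lemma norm_orthogonal_matrix:
  fixes g :: "real^'k^'k"
  assumes "transpose g ** g = mat 1"
  shows "norm g = sqrt (real CARD('k))"
  by (simp add: norm_eq_sqrt_inner inner_matrix_trace assms trace_I)

context skew_lie_algebra
begin

text \<open>On an eigenspace \<open>W\<close> of \<open>Y\<^sup>T Y = - Y\<^sup>2\<close>, the matrix \<open>Y\<close> is a multiple of a complex
  structure \<open>J\<close> commuting with \<open>h\<close>; \<open>P = (Q - i J) / 2\<close> projects onto the \<open>i\<close>-eigenspace of \<open>J\<close>,
  and \<open>range_det P\<close> is the complex determinant on \<open>(W, J)\<close>.  Its derivative
  \<open>A \<mapsto> trace (A P)\<close> kills brackets but not \<open>Y\<close>.\<close>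

lemma separating_determinant:
  assumes Y: "transpose Y = - Y" "Y \<noteq> 0" and comm: "\<And>A. A \<in> h \<Longrightarrow> A ** Y = Y ** A"
  obtains P t where "\<And>x. x \<in> lie_group (commutant h) \<Longrightarrow> range_det P x = 1"
    "t \<ge> 0" "range_det P (mexp (t *\<^sub>R Y)) \<noteq> 1"
proof -
  obtain c x0 where c: "c > 0" and x0: "x0 \<noteq> 0" "transpose Y *v (Y *v x0) = c *\<^sub>R x0"
    using gram_eigenvector[OF Y(2)] .
  have tY: "transpose Y *v y = - (Y *v y)" for y
    unfolding Y(1) by (simp add: matrix_vector_mult_def vec_eq_iff sum_negf)
  define W where "W = {x. Y *v (Y *v x) = - (c *\<^sub>R x)}"
  have W: "subspace W"
    by (auto simp: W_def subspace_def matrix_vector_right_distrib matrix_vector_mult_scaleR scaleR_add_right)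
  have x0W: "x0 \<in> W" using x0(2)[unfolded tY, symmetric] by (simp add: W_def)
  obtain \<pi> where \<pi>: "linear \<pi>" "\<And>x. \<pi> x \<in> W" "\<And>x s. s \<in> W \<Longrightarrow> (x - \<pi> x) \<bullet> s = 0"
    "\<And>x. x \<in> W \<Longrightarrow> \<pi> x = x"
    using orthogonal_projection_exists[OF W] by metis
  define Q where "Q = matrix \<pi>"
  have Q: "Q *v x = \<pi> x" for x unfolding Q_def using \<pi>(1) by (simp add: matrix_works)
  have QQ: "Q ** Q = Q"
    by (simp add: matrix_eq Q \<pi> flip: matrix_vector_mul_assoc)
  have YYQ: "Y ** (Y ** Q) = - (c *\<^sub>R Q)"
    using \<pi>(2) by (simp add: matrix_eq Q W_def matrix_vector_mul_assoc[symmetric] scaleR_matrix_vector_assoc[symmetric]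
        flip: scaleR_minus_left)
  \<comment> \<open>A skew \<open>A\<close> commuting with \<open>Y\<close> preserves
    \<open>W\<close>, and by skewness also its orthogonal complement; so it commutes with the
    orthogonal projection \<open>Q\<close>.\<close>
  have commQ: "A ** Q = Q ** A" if A: "transpose A = - A" "A ** Y = Y ** A" for A
  proof -
    have AW: "A *v s \<in> W" if "s \<in> W" for s
    proof -
      have "Y *v (Y *v (A *v s)) = A *v (Y *v (Y *v s))"
        using A(2) by (metis matrix_vector_mul_assoc)
      then show ?thesis using that by (simp add: W_def matrix_vector_mult_scaleR vector_matrix_mul_rid
            flip: scaleR_minus_left)
    qed
    have "\<pi> (A *v x) = A *v \<pi> x" for x
    proof -
      let ?w = "A *v (x - \<pi> x)"
      have "?w \<bullet> s = 0" if "s \<in> W" for s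
        using skew_inner[OF A(1), of "x - \<pi> x" s] \<pi>(3)[OF AW[OF that], of x] by simp
      then have "?w \<bullet> \<pi> ?w = 0" using \<pi>(2) by blast
      moreover have "(?w - \<pi> ?w) \<bullet> \<pi> ?w = 0" using \<pi>(2,3) by blast
      ultimately have w: "\<pi> ?w = 0" by (simp add: inner_diff_left)
      have "\<pi> (A *v x) = \<pi> (A *v \<pi> x + ?w)"
        by (simp add: matrix_vector_right_distrib[symmetric])
      also have "\<dots> = A *v \<pi> x" using w \<pi>(4)[OF AW[OF \<pi>(2)]] by (simp add: linear_add[OF \<pi>(1)])
      finally show ?thesis .
    qed
    then show ?thesis by (simp add: matrix_eq Q flip: matrix_vector_mul_assoc)
  qed
  \<comment> \<open>On \<open>W\<close> the square of \<open>Y\<close> is \<open>- c\<close>;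
    dividing by \<open>sqrt c\<close> normalizes it to \<open>J ** J = - Q\<close>.\<close>
  define \<mu> where "\<mu> = sqrt c"
  have \<mu>: "\<mu> > 0" "\<mu> * \<mu> = c" using c by (simp_all add: \<mu>_def)
  define J where "J = inverse \<mu> *\<^sub>R (Y ** Q)"
  have YQ: "Y ** Q = Q ** Y" using commQ[OF Y(1)] by simp
  have YQ\<mu>: "Y ** Q = \<mu> *\<^sub>R J" using \<mu> by (simp add: J_def)
  have YJ: "Y ** J = - (\<mu> *\<^sub>R Q)"
    using \<mu> by (simp add: J_def mat_mult.scaleR_right YYQ flip: \<mu>(2))
  have QJ: "Q ** J = J" by (simp add: J_def mat_mult.scaleR_right YQ matrix_mul_assoc QQ)
  have JQ: "J ** Q = J" by (simp add: J_def mat_mult.scaleR_left QQ flip: matrix_mul_assoc)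
  have JJ: "J ** J = - Q"
  proof -
    have "J ** J = inverse \<mu> *\<^sub>R (Q ** (Y ** J))"
      by (simp add: J_def[of] YQ mat_mult.scaleR_left matrix_mul_assoc)
    then show ?thesis using \<mu> by (simp add: YJ mat_mult.minus_right mat_mult.scaleR_right QQ)
  qed
  define I where "I = (mat \<i> :: complex^'k^'k)"
  have II: "I ** I = - mat 1"
    by (simp add: I_def vec_eq_iff mat_mult_nth) (simp add: mat_def)
  have Ic: "I ** A = A ** I" for A
    by (simp add: I_def vec_eq_iff mat_mult_nth mult_mat_nth)
  define P where "P = cmat ((1/2) *\<^sub>R Q) - I ** cmat ((1/2) *\<^sub>R J)"
  let ?q = "cmat ((1/2) *\<^sub>R Q)" and ?j = "cmat ((1/2) *\<^sub>R J)"
  have cm: "cmat A ** cmat B = r *\<^sub>R cmat C" if "A ** B = r *\<^sub>R C" for A B C :: "real^'k^'k" and r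
    using that by (metis cmat_simps(1,6))
  have qq: "?q ** ?q = (1/2) *\<^sub>R ?q" "?q ** ?j = (1/2) *\<^sub>R ?j" "?j ** ?q = (1/2) *\<^sub>R ?j"
    "?j ** ?j = (- (1/2)) *\<^sub>R ?q"
    by (rule cm, simp add: mat_mult.scaleR_left mat_mult.scaleR_right QQ QJ JQ JJ)+
  have PP: "P ** P = P"
  proof -
    have "P ** P = ?q ** ?q - I ** (?j ** ?q) - (I ** (?q ** ?j) - (I ** I) ** (?j ** ?j))"
    proof -
      have 1: "?q ** (I ** ?j) = I ** (?q ** ?j)" by (metis Ic matrix_mul_assoc)
      have 2: "I ** ?j ** (I ** ?j) = (I ** I) ** (?j ** ?j)" by (metis Ic matrix_mul_assoc)
      show ?thesis
        unfolding P_def matrix_diff_ldistrib matrix_diff_rdistrib 1 2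
        by (simp only: matrix_mul_assoc)
    qed
    moreover have "- mat 1 ** ((- (1/2)) *\<^sub>R ?q) = (1/2) *\<^sub>R ?q"
      by (simp add: matrix_matrix_mult_def mat_def vec_eq_iff if_distrib if_distribR sum_negf cong: if_cong)
    ultimately have "P ** P = (1/2) *\<^sub>R ?q - I ** ((1/2) *\<^sub>R ?j) - (I ** ((1/2) *\<^sub>R ?j) - (1/2) *\<^sub>R ?q)"
      by (simp only: qq II)
    also have "\<dots> = ((1/2) *\<^sub>R ?q + (1/2) *\<^sub>R ?q) - I ** ((1/2) *\<^sub>R ?j + (1/2) *\<^sub>R ?j)"
      unfolding matrix_add_ldistrib by (simp only: algebra_simps)
    also have "\<dots> = P"
      unfolding scaleR_left_distrib[symmetric] P_def by simp
    finally show ?thesis .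
  qed
  have commP: "cmat A ** P = P ** cmat A" if A: "transpose A = - A" "A ** Y = Y ** A" for A
  proof -
    have AJ: "A ** J = J ** A"
      using commQ[OF A] A(2) unfolding J_def mat_mult.scaleR_left mat_mult.scaleR_right
      by (metis matrix_mul_assoc)
    have 1: "cmat A ** ?q = ?q ** cmat A" "cmat A ** ?j = ?j ** cmat A"
      unfolding cmat_simps(1)[symmetric]
      using commQ[OF A] AJ by (simp_all add: mat_mult.scaleR_left mat_mult.scaleR_right)
    have "cmat A ** (I ** ?j) = I ** ?j ** cmat A" using 1 Ic by (metis matrix_mul_assoc)
    then show ?thesis by (simp add: P_def matrix_diff_ldistrib matrix_diff_rdistrib 1)
  qed
  have commh: "cmat A ** P = P ** cmat A" if "A \<in> h" for A
    using that by (intro commP skew comm)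
  have "linear (\<lambda>A. trace (cmat A ** P))"
    by (intro linearI) (simp_all add: cmat_simps matrix_add_rdistrib trace_add,
        simp add: trace_def matrix_matrix_mult_def scaleR_sum_right)
  then have "subspace {A. trace (cmat A ** P) = 0}" by (rule linear_subspace_kernel)
  \<comment> \<open>As \<open>P\<close> commutes with \<open>h\<close>, cyclicity gives both orders
    of \<open>B\<close> and \<open>C\<close> the same trace.\<close>
  moreover have "trace (cmat (lie_bracket B C) ** P) = 0" if "B \<in> h" "C \<in> h" for B C
  proof -
    have "trace (cmat C ** cmat B ** P) = trace (cmat C ** P ** cmat B)"
      using commh[OF that(1)] by (metis matrix_mul_assoc)
    also have "\<dots> = trace (cmat B ** cmat C ** P)"
      by (subst trace_mul_sym) (simp add: matrix_mul_assoc)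
    finally show ?thesis
      by (simp add: lie_bracket_def cmat_simps matrix_diff_rdistrib trace_sub)
  qed
  ultimately have tr: "trace (cmat A ** P) = 0" if "A \<in> commutant h" for A
    using that span_minimal[of "{lie_bracket A B | A B. A \<in> h \<and> B \<in> h}" "{A. trace (cmat A ** P) = 0}"]
    unfolding commutant_def by blast
  have one: "range_det P x = 1 \<and> cmat x ** P = P ** cmat x" if "x \<in> lie_group (commutant h)" for x
    using that
  proof (induction x rule: lie_group.induct)
    case one
    then show ?case by (simp add: range_det_one cmat_simps)
  next
    case (step A x)
    have A: "cmat A ** P = P ** cmat A" using step(1) commutant_subset commh by blast
    have "range_det P (mexp A ** x) = 1"
      using range_det_mult[OF PP, of x "mexp A"] range_det_mexp[OF PP A tr[OF step(1)]] step(3) by simp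
    moreover have "cmat (mexp A ** x) ** P = P ** cmat (mexp A ** x)"
      using step(3) cmat_mexp_commute[OF A] by (metis cmat_simps(1) matrix_mul_assoc)
    ultimately show ?case by simp
  qed
  have "\<exists>t\<ge>0. range_det P (mexp (t *\<^sub>R Y)) \<noteq> 1"
  proof (rule ccontr)
    assume no: "\<not> ?thesis"
    have "trace (cmat Y ** P) \<in> {0}"
    proof (rule has_vector_derivative_in_subspace)
      show "((\<lambda>t. range_det P (mexp (t *\<^sub>R Y)) - 1) has_vector_derivative trace (cmat Y ** P)) (at 0)"
        unfolding has_vector_derivative_diff_const by (rule range_det_has_vector_derivative)
    qed (use no in auto)
    \<comment> \<open>The right-hand side equals \<open>\<i> * \<mu>\<close> times \<open>P\<close>.
      Its \<open>J\<close>-term has real trace, so the imaginary part of the trace is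
      \<open>\<mu>/2 * trace Q\<close>.\<close>
    moreover have "cmat Y ** P = cmat ((\<mu>/2) *\<^sub>R J) + I ** cmat ((\<mu>/2) *\<^sub>R Q)"
    proof -
      have "cmat Y ** P = cmat Y ** ?q - I ** (cmat Y ** ?j)"
        unfolding P_def matrix_diff_ldistrib by (metis Ic matrix_mul_assoc)
      moreover have "cmat Y ** ?q = cmat ((\<mu>/2) *\<^sub>R J)" "cmat Y ** ?j = cmat (- ((\<mu>/2) *\<^sub>R Q))"
        unfolding cmat_simps(1)[symmetric] by (simp_all add: mat_mult.scaleR_right YQ\<mu> YJ)
      moreover have "I ** cmat (- B) = - (I ** cmat B)" for B
        by (simp add: cmat_simps(4) I_def vec_eq_iff mat_mult_nth)
      ultimately show ?thesis by simp
    qed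
    ultimately have "Im (trace (cmat ((\<mu>/2) *\<^sub>R J) + I ** cmat ((\<mu>/2) *\<^sub>R Q))) = 0" by simp
    moreover have "Im (trace (cmat ((\<mu>/2) *\<^sub>R J) + I ** cmat ((\<mu>/2) *\<^sub>R Q))) = \<mu>/2 * trace Q"
      by (simp add: trace_def cmat_def I_def mat_mult_nth sum_distrib_left)
    ultimately have "trace Q = 0" using \<mu> by simp
    \<comment> \<open>A sum of squared lengths of projected basis vectors: if it vanished,
      \<open>Q\<close> would be zero, contradicting the nonzero \<open>x0\<close> in
      \<open>W\<close>.\<close>
    moreover have "trace Q = (\<Sum>i\<in>UNIV. (norm (\<pi> (axis i 1)))\<^sup>2)"
    proof -
      have "Q $ i $ i = (norm (\<pi> (axis i 1)))\<^sup>2" for i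
      proof -
        have "Q $ i $ i = \<pi> (axis i 1) \<bullet> axis i 1"
          by (simp add: Q_def matrix_def inner_axis)
        also have "\<dots> = \<pi> (axis i 1) \<bullet> \<pi> (axis i 1)"
          using \<pi>(3)[OF \<pi>(2), of "axis i 1" "axis i 1"] unfolding inner_diff_left
          by (metis inner_commute right_minus_eq)
        finally show ?thesis by (simp add: power2_norm_eq_inner)
      qed
      then show ?thesis by (simp add: trace_def)
    qed
    ultimately have "\<pi> (axis i 1) = 0" for i
      by (simp add: sum_nonneg_eq_0_iff)
    then have "Q = 0" by (simp add: Q_def matrix_def vec_eq_iff)
    then have "\<pi> x0 = 0" using Q[of x0] by simp
    then show False using \<pi>(4)[OF x0W] x0(1) by simp
  qed
  then show ?thesis using one that by blast
qed

lemma lie_group_orthogonal: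
  assumes "x \<in> lie_group h"
  shows "transpose x ** x = mat 1" and "x ** transpose x = mat 1"
proof -
  have "(A *v v) \<bullet> w + v \<bullet> (A *v w) = 0" if "A \<in> h" for A v w
    using skew_inner[OF skew[OF that], of v w] by simp
  then have "(x *v v) \<bullet> (x *v w) = v \<bullet> w" for v w
    by (intro lie_group_bilinear[OF assms bounded_bilinear_inner]) auto
  then show "transpose x ** x = mat 1" by (rule orthogonalI)
  then show "x ** transpose x = mat 1" by (simp add: matrix_left_right_inverse)
qed

text \<open>An element of \<open>lie_group (commutant h)\<close> close to \<open>1\<close> is \<open>exp X exp Y\<close> with \<open>X\<close> in
  \<open>commutant h\<close> and \<open>Y\<close> orthogonal to it.  If \<open>Y\<close> could be small and nonzero, a limiting direction of
  such \<open>Y\<close> would generate a one-parameter group in the closure of \<open>lie_group (commutant h)\<close>,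
  commuting with \<open>h\<close>.\<close>

lemma commutant_group_near_identity:
  assumes "\<epsilon> > 0"
  shows "\<exists>\<delta>>0. \<forall>g\<in>lie_group (commutant h). norm (g - mat 1) < \<delta> \<longrightarrow>
    (\<exists>X\<in>commutant h. norm X < \<epsilon> \<and> g = mexp X)"
proof (rule ccontr)
  let ?d = "commutant h" and ?H = "lie_group (commutant h)"
  assume no: "\<not> ?thesis"
  obtain \<pi> where \<pi>: "linear \<pi>" "\<And>x. \<pi> x \<in> ?d" "\<And>x s. s \<in> ?d \<Longrightarrow> (x - \<pi> x) \<bullet> s = 0"
    using orthogonal_projection_exists[OF subspace_commutant[of h]] by metis
  have bl\<pi>: "bounded_linear \<pi>" using \<pi>(1) by (simp add: linear_conv_bounded_linear)
  obtain C where C: "C > 0" "\<And>W. norm (\<pi> W) \<le> norm W * C" using bounded_linear.pos_bounded[OF bl\<pi>] by blast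
  \<comment> \<open>The bound \<open>\<epsilon> / C\<close> makes \<open>\<pi> W\<close> shorter
    than \<open>\<epsilon>\<close>, so a counterexample cannot have zero component
    \<open>W - \<pi> W\<close>; the other bound forces \<open>W\<close> to tend to
    \<open>0\<close>.\<close>
  have ex: "\<exists>W. norm W < min (\<epsilon> / C) (inverse (real (Suc j))) \<and> mexp (\<pi> W) ** mexp (W - \<pi> W) \<in> ?H
      \<and> (\<forall>X\<in>?d. norm X < \<epsilon> \<longrightarrow> mexp (\<pi> W) ** mexp (W - \<pi> W) \<noteq> mexp X)" for j
  proof -
    have "min (\<epsilon> / C) (inverse (real (Suc j))) > 0" using assms C by simp
    from mexp_product_open[OF \<pi>(1) this] obtain \<delta> where \<delta>: "\<delta> > 0"
      "\<And>g. norm (g - mat 1) < \<delta> \<Longrightarrow> \<exists>W. norm W < min (\<epsilon> / C) (inverse (real (Suc j))) \<and> g = mexp (\<pi> W) ** mexp (W - \<pi> W)"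
      by blast
    obtain g where "g \<in> ?H" "norm (g - mat 1) < \<delta>" "\<forall>X\<in>?d. norm X < \<epsilon> \<longrightarrow> g \<noteq> mexp X"
      using no \<delta>(1) by blast
    then show ?thesis using \<delta>(2) by blast
  qed
  obtain W where W: "\<And>j. norm (W j) < min (\<epsilon> / C) (inverse (real (Suc j)))"
    "\<And>j. mexp (\<pi> (W j)) ** mexp (W j - \<pi> (W j)) \<in> ?H"
    "\<And>j X. X \<in> ?d \<Longrightarrow> norm X < \<epsilon> \<Longrightarrow> mexp (\<pi> (W j)) ** mexp (W j - \<pi> (W j)) \<noteq> mexp X"
    using choice[of "\<lambda>j W. norm W < min (\<epsilon> / C) (inverse (real (Suc j))) \<and> mexp (\<pi> W) ** mexp (W - \<pi> W) \<in> ?H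
      \<and> (\<forall>X\<in>?d. norm X < \<epsilon> \<longrightarrow> mexp (\<pi> W) ** mexp (W - \<pi> W) \<noteq> mexp X)"] ex by blast
  define Y where "Y j = W j - \<pi> (W j)" for j
  define D where "D = {Y. \<forall>s\<in>?d. orthogonal s Y}"
  have D: "subspace D" unfolding D_def by (rule subspace_orthogonal_to_vectors)
  have YD: "Y j \<in> D" for j using \<pi>(3) by (simp add: D_def Y_def orthogonal_def inner_commute)
  have Ynz: "Y j \<noteq> 0" for j
  proof
    assume "Y j = 0"
    moreover have "norm (\<pi> (W j)) < \<epsilon>"
      using C(2)[of "W j"] W(1)[of j] C(1) by (simp add: less_divide_eq) 
    ultimately show False using W(3)[OF \<pi>(2)[of "W j"], of j] by (simp add: Y_def)
  qed
  have "norm (W j) \<le> inverse (real (Suc j))" for j using W(1)[of j] by simp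
  then have "W \<longlonglongrightarrow> 0"
    by (intro Lim_null_comparison[OF _ LIMSEQ_inverse_real_of_nat] always_eventually) blast
  then have Ylim: "Y \<longlonglongrightarrow> 0"
    using tendsto_diff[OF _ bounded_linear.tendsto[OF bl\<pi>], of W 0 sequentially W 0] linear_0[OF \<pi>(1)]
    by (simp add: Y_def[abs_def])
  have YH: "mexp (real n *\<^sub>R Y j) \<in> ?H" for j n
  proof (induction n)
    case (Suc n)
    have "mexp (- \<pi> (W j)) ** (mexp (\<pi> (W j)) ** mexp (Y j)) \<in> ?H"
      unfolding Y_def
      by (rule lie_group_mult[OF mexp_in_lie_group[OF subspace_neg[OF subspace_commutant \<pi>(2)]] W(2)])
    then have "mexp (Y j) \<in> ?H" by (simp add: matrix_mul_assoc)
    moreover have "mexp (real (Suc n) *\<^sub>R Y j) = mexp (Y j) ** mexp (real n *\<^sub>R Y j)"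
      using mexp_scaleR_add[of 1 "real n" "Y j"] by simp
    ultimately show ?case using Suc lie_group_mult by metis
  qed (simp add: lie_group.one)
  obtain y where y: "y \<in> D" "norm y = 1"
    and cl: "\<And>\<Gamma> t. (\<And>j n. mexp (real n *\<^sub>R Y j) \<in> \<Gamma>) \<Longrightarrow> t \<ge> 0 \<Longrightarrow> mexp (t *\<^sub>R y) \<in> closure \<Gamma>"
    using one_parameter_limit[OF D YD Ynz Ylim] by blast
  \<comment> \<open>Closed conditions valid on the group pass to
    \<open>mexp (t *\<^sub>R y)\<close>. Differentiating orthogonality and stability of
    \<open>h\<close> under conjugation makes \<open>y\<close> skew and a normalizer of
    \<open>h\<close>.\<close>
  have closure: "mexp (t *\<^sub>R y) \<in> S" if "t \<ge> 0" "closed S" "?H \<subseteq> S" for t S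
    using cl[OF YH that(1)] closure_minimal[OF that(3,2)] by blast
  have Hh: "x \<in> lie_group h" if "x \<in> ?H" for x using lie_group_mono[OF that commutant_subset] .
  have contT: "continuous_on UNIV (transpose :: real^'k^'k \<Rightarrow> _)"
    by (rule linear_continuous_on[OF bounded_linear_transpose])
  have dy: "((\<lambda>t. mexp (t *\<^sub>R y)) has_vector_derivative y) (at 0)"
    using mexp_has_vector_derivative[of y 0 UNIV] by simp
  note dyT = bounded_linear.has_vector_derivative[OF bounded_linear_transpose dy]
  have skewy: "transpose y = - y"
  proof -
    have orth: "transpose (mexp (t *\<^sub>R y)) ** mexp (t *\<^sub>R y) = mat 1" if "t \<ge> 0" for t
      using closure[OF that closed_orthogonal_matrices] lie_group_orthogonal(1)[OF Hh] by blast
    have der: "((\<lambda>t. transpose (mexp (t *\<^sub>R y)) ** mexp (t *\<^sub>R y) - mat 1) has_vector_derivative y + transpose y) (at 0)"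
      using mat_mult.has_vector_derivative[OF dyT dy] by (simp add: has_vector_derivative_diff_const)
    have "y + transpose y \<in> {0}"
      using orth by (intro has_vector_derivative_in_subspace[OF der]) auto
    then show ?thesis by (simp add: eq_neg_iff_add_eq_0 add.commute)
  qed
  have yh: "lie_bracket y A \<in> h" if A: "A \<in> h" for A
  proof (rule has_vector_derivative_in_subspace[OF _ sub])
    let ?f = "\<lambda>g::real^'k^'k. g ** A ** transpose g"
    show "?f (mexp (t *\<^sub>R y)) \<in> h" if "t \<ge> 0" for t
    proof -
      have "closed (?f -` h)"
        by (intro closed_vimage closed_subspace sub mat_mult.continuous_on contT continuous_on_id continuous_on_const)
      moreover have "?H \<subseteq> ?f -` h"
        using lie_group_conj_subspace[OF Hh lie_group_orthogonal(2)[OF Hh] sub br A] by auto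
      ultimately show ?thesis using closure[OF that] by blast
    qed
    show "((\<lambda>t. ?f (mexp (t *\<^sub>R y))) has_vector_derivative lie_bracket y A) (at 0)"
      using mat_mult.has_vector_derivative[OF bounded_linear.has_vector_derivative[OF mat_mult.bounded_linear_left dy, of A] dyT]
      by (simp add: skewy lie_bracket_def mat_mult.minus_right)
  qed
  \<comment> \<open>\<open>[A, y]\<close> lies in \<open>h\<close>, and its squared norm is minus
    the pairing of \<open>y\<close> with the bracket \<open>[A, [A, y]]\<close>; this is zero
    because \<open>y\<close> is orthogonal to the commutant.\<close>
  have comm: "A ** y = y ** A" if A: "A \<in> h" for A
  proof -
    let ?B = "lie_bracket A y"
    have B: "?B \<in> h" using yh[OF A] subspace_neg[OF sub] lie_bracket_neg[of A y] by metis
    have "?B \<bullet> ?B = - (y \<bullet> lie_bracket A ?B)" by (rule inner_lie_bracket_skew[OF skew[OF A]])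
    also have "\<dots> = 0"
      using y(1) lie_bracket_in_commutant[OF A B] by (auto simp: D_def orthogonal_def inner_commute[of y])
    finally have "?B = 0" by simp
    then show ?thesis by (simp add: lie_bracket_def)
  qed
  obtain P t where P: "\<And>x. x \<in> ?H \<Longrightarrow> range_det P x = 1" and t: "t \<ge> 0" "range_det P (mexp (t *\<^sub>R y)) \<noteq> 1"
  proof (rule separating_determinant[OF skewy _ comm])
    show "y \<noteq> 0" using y(2) by auto
  qed (assumption | blast)+
  have "continuous_on UNIV (\<lambda>g. range_det P g)"
    unfolding range_det_def
    by (intro continuous_on_det continuous_on_add continuous_on_const linear_continuous_on bounded_linear_cmat_mult)
  then have "closed {g. range_det P g = 1}" by (intro closed_Collect_eq continuous_on_const)
  from closure[OF t(1) this] t(2) P show False by blast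
qed

text \<open>Orthogonality gives boundedness. For closedness, translate a convergent sequence by the
  inverse of a late term: the tail lands near \<open>mat 1\<close>, where group elements are
  exponentials from a compact part of the commutant.\<close>

lemma compact_commutant_group: "compact (lie_group (commutant h))"
  unfolding compact_eq_bounded_closed
proof
  let ?d = "commutant h" and ?H = "lie_group (commutant h)"
  have Hh: "x \<in> lie_group h" if "x \<in> ?H" for x using lie_group_mono[OF that commutant_subset] .
  show "bounded ?H"
    using norm_orthogonal_matrix[OF lie_group_orthogonal(1)[OF Hh]] by (intro boundedI) (rule eq_refl)
  show "closed ?H"
    unfolding closed_sequential_limits
  proof (intro allI impI, elim conjE)
    fix g l assume g: "\<forall>n. g n \<in> ?H" and lim: "g \<longlonglongrightarrow> l"
    obtain \<delta> where \<delta>: "\<delta> > 0"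
      "\<And>g. g \<in> ?H \<Longrightarrow> norm (g - mat 1) < \<delta> \<Longrightarrow> \<exists>X\<in>?d. norm X < 1 \<and> g = mexp X"
      using commutant_group_near_identity[of 1] by auto
    have "((\<lambda>n. transpose (g n) ** l) \<longlongrightarrow> transpose l ** l) sequentially"
      by (intro mat_mult.tendsto bounded_linear.tendsto[OF bounded_linear_transpose] lim tendsto_const)
    moreover have "transpose l ** l = mat 1"
    proof -
      have "l \<in> {g::real^'k^'k. transpose g ** g = mat 1}"
        by (rule closed_sequentially[OF closed_orthogonal_matrices]) (use g lim lie_group_orthogonal(1)[OF Hh] in auto)
      then show ?thesis by simp
    qed
    ultimately have "\<forall>\<^sub>F n in sequentially. dist (transpose (g n) ** l) (mat 1) < \<delta>"
      using \<delta>(1) by (simp add: tendsto_iff)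
    then obtain N where N: "norm (transpose (g N) ** l - mat 1) < \<delta>"
      by (auto simp: eventually_sequentially dist_norm)
    have inv: "transpose (g N) \<in> ?H"
    proof -
      obtain y where y: "y \<in> ?H" "g N ** y = mat 1" "y ** g N = mat 1"
        using lie_group_inverse[OF subspace_commutant] g by blast
      have "y = transpose (g N)"
        using y lie_group_orthogonal(2)[OF Hh, of "g N"] g by (metis matrix_mul_assoc matrix_mul_lid matrix_mul_rid)
      then show ?thesis using y by simp
    qed
    have "(\<lambda>n. transpose (g N) ** g n - mat 1) \<longlonglongrightarrow> transpose (g N) ** l - mat 1"
      by (intro tendsto_intros mat_mult.tendsto lim)
    then have "\<forall>\<^sub>F n in sequentially. norm (transpose (g N) ** g n - mat 1) < \<delta>"
      using N by (intro order_tendstoD(2)[OF tendsto_norm])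
    then obtain M where M: "\<And>n. n \<ge> M \<Longrightarrow> norm (transpose (g N) ** g n - mat 1) < \<delta>"
      by (auto simp: eventually_sequentially)
    have "\<exists>X. X \<in> ?d \<and> norm X \<le> 1 \<and> transpose (g N) ** g (n + M) = mexp X" for n
      using \<delta>(2)[OF lie_group_mult[OF inv] M, of "n + M"] g by (meson le_add2 less_imp_le)
    then obtain X where X: "\<And>n. X n \<in> ?d \<inter> cball 0 1" "\<And>n. transpose (g N) ** g (n + M) = mexp (X n)"
      by (simp add: dist_norm) metis
    have "seq_compact (?d \<inter> cball 0 1)"
      by (intro compact_imp_seq_compact closed_Int_compact closed_subspace subspace_commutant compact_cball)
    moreover have "\<forall>n. X n \<in> ?d \<inter> cball 0 1" using X(1) by blast
    ultimately obtain r x where r: "strict_mono r" and x: "x \<in> ?d \<inter> cball 0 1" "(X \<circ> r) \<longlonglongrightarrow> x"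
      by (rule seq_compactE)
    have "(\<lambda>n. mexp (X (r n))) \<longlonglongrightarrow> mexp x"
      using tendsto_mexp[OF x(2)] by (simp add: o_def)
    moreover have "(\<lambda>n. transpose (g N) ** g (r n + M)) \<longlonglongrightarrow> transpose (g N) ** l"
      using LIMSEQ_subseq_LIMSEQ[OF LIMSEQ_ignore_initial_segment[OF lim, of M] r]
      by (intro mat_mult.tendsto tendsto_const) (simp add: o_def)
    ultimately have "transpose (g N) ** l = mexp x"
      using X(2) LIMSEQ_unique by simp
    then have "l = g N ** mexp x"
      using lie_group_orthogonal(2)[OF Hh, of "g N"] g by (metis matrix_mul_assoc matrix_mul_lid)
    then show "l \<in> ?H" using g x(1) by (auto intro: lie_group_mult mexp_in_lie_group)
  qed
qed

end

section \<open>Transport to algebras conjugate to skew ones\<close>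

text \<open>The facts proved for skew matrices, stated without transposes or orthogonality so that
  they survive conjugation by a non-orthogonal matrix.\<close>

locale compact_lie_algebra = matrix_lie_algebra h for h :: "(real^'k^'k) set" +
  assumes decomposition: "\<And>A. A \<in> h \<Longrightarrow> \<exists>Z\<in>lie_center h. A - Z \<in> commutant h"
    and center_Int_commutant: "\<And>Z. Z \<in> lie_center h \<Longrightarrow> Z \<in> commutant h \<Longrightarrow> Z = 0"
    and compact_commutant_group: "compact (lie_group (commutant h))"
    and near_identity: "\<And>\<epsilon>. \<epsilon> > 0 \<Longrightarrow> \<exists>\<delta>>0. \<forall>g\<in>lie_group (commutant h). norm (g - mat 1) < \<delta> \<longrightarrow>
      (\<exists>X\<in>commutant h. norm X < \<epsilon> \<and> g = mexp X)"

text \<open>Conjugation is an algebra automorphism and carries brackets, centre, commutant and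
  exponentials along. Only norms change, by bounded factors.\<close>

lemma compact_lie_algebra_conjugate:
  fixes M M' :: "real^'k^'k"
  assumes inv: "M ** M' = mat 1" "M' ** M = mat 1" and h: "subspace h"
    and br: "\<And>A B. A \<in> h \<Longrightarrow> B \<in> h \<Longrightarrow> lie_bracket A B \<in> h"
    and skew: "\<And>A. A \<in> h \<Longrightarrow> transpose (M' ** A ** M) = - (M' ** A ** M)"
  shows "compact_lie_algebra h"
proof -
  define c where "c A = M' ** A ** M" for A
  define c' where "c' A = M ** A ** M'" for A
  have cc: "c (c' A) = A" "c' (c A) = A" for A
    unfolding c_def c'_def using inv by (metis matrix_mul_assoc matrix_mul_lid matrix_mul_rid)+
  have c_mult: "c (A ** B) = c A ** c B" for A B
    unfolding c_def using inv(1) by (metis matrix_mul_assoc matrix_mul_rid)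
  have bl: "bounded_linear c" "bounded_linear c'"
    unfolding c_def c'_def
    by (rule bounded_linear_compose[OF mat_mult.bounded_linear_left mat_mult.bounded_linear_right])+
  then have lin: "linear c" "linear c'" by (simp_all add: bounded_linear.linear)
  have c1: "c (mat 1) = mat 1" by (simp add: c_def inv)
  have c_br: "lie_bracket (c A) (c B) = c (lie_bracket A B)" for A B
    by (simp add: lie_bracket_def c_mult linear_diff[OF lin(1)])
  have injc: "inj c" using cc(2) by (metis injI)
  interpret s: skew_lie_algebra "c ` h"
  proof
    show "subspace (c ` h)" using linear_subspace_image[OF lin(1) h] .
  qed (use br skew in \<open>auto simp: c_br\<close>, auto simp: c_def)
  have comm: "commutant (c ` h) = c ` commutant h"
  proof -
    have "{lie_bracket A B | A B. A \<in> c ` h \<and> B \<in> c ` h} = c ` {lie_bracket A B | A B. A \<in> h \<and> B \<in> h}"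
      by (auto simp: c_br image_iff) (metis c_br)+
    then show ?thesis unfolding commutant_def using linear_span_image[OF lin(1)] by simp
  qed
  have center: "lie_center (c ` h) = c ` lie_center h"
  proof -
    have "c X = 0 \<longleftrightarrow> X = 0" for X using injc linear_0[OF lin(1)] by (metis injD)
    then show ?thesis by (auto simp: lie_center_def c_br image_iff)
  qed
  have group: "x \<in> lie_group g \<Longrightarrow> c x \<in> lie_group (c ` g)" for x g
    by (induction x rule: lie_group.induct)
      (auto simp: c1 c_mult mexp_algebra_hom[OF lin(1) c_mult c1, symmetric] intro: lie_group.intros)
  have group': "x \<in> lie_group (c ` g) \<Longrightarrow> x \<in> c ` lie_group g" for x g
  proof (induction x rule: lie_group.induct)
    case one
    then show ?case using c1 lie_group.one by (metis image_eqI)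
  next
    case (step A x)
    then obtain B y where "B \<in> g" "A = c B" "y \<in> lie_group g" "x = c y" by auto
    then show ?case
      using mexp_algebra_hom[OF lin(1) c_mult c1, of B] c_mult lie_group.step by (metis image_eqI)
  qed
  have H: "lie_group (commutant (c ` h)) = c ` lie_group (commutant h)"
    unfolding comm using group group' by blast
  show ?thesis
  proof
    fix A assume A: "A \<in> h"
    then obtain Z where Z: "Z \<in> lie_center h" "c A - c Z \<in> c ` commutant h"
      using s.decomposition[of "c A"] unfolding center comm by auto
    then have "c (A - Z) \<in> c ` commutant h" by (simp add: linear_diff[OF lin(1)])
    then show "\<exists>Z\<in>lie_center h. A - Z \<in> commutant h"
      using Z(1) injc by (auto simp: inj_image_mem_iff)
  next
    fix Z assume "Z \<in> lie_center h" "Z \<in> commutant h"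
    then have "c Z = 0" using s.center_Int_commutant[of "c Z"] unfolding center comm by blast
    then show "Z = 0" using injc linear_0[OF lin(1)] by (metis injD)
  next
    have "lie_group (commutant h) = c' ` lie_group (commutant (c ` h))"
      unfolding H by (simp add: image_image cc)
    then show "compact (lie_group (commutant h))"
      using compact_continuous_image[OF linear_continuous_on[OF bl(2)] s.compact_commutant_group] by simp
  next
    fix \<epsilon> :: real assume "\<epsilon> > 0"
    obtain B where B: "B > 0" "\<And>X. norm (c X) \<le> norm X * B"
      using bounded_linear.pos_bounded[OF bl(1)] by blast
    obtain B' where B': "B' > 0" "\<And>X. norm (c' X) \<le> norm X * B'"
      using bounded_linear.pos_bounded[OF bl(2)] by blast
    \<comment> \<open>\<open>\<epsilon> / B'\<close> here and \<open>\<delta> / B\<close> below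
      compensate for the distortion of norms by \<open>c'\<close> and \<open>c\<close>.\<close>
    obtain \<delta> where \<delta>: "\<delta> > 0" "\<And>g. g \<in> lie_group (commutant (c ` h)) \<Longrightarrow> norm (g - mat 1) < \<delta> \<Longrightarrow>
      \<exists>X\<in>commutant (c ` h). norm X < \<epsilon> / B' \<and> g = mexp X"
      using s.commutant_group_near_identity[of "\<epsilon> / B'"] \<open>\<epsilon> > 0\<close> B' by auto
    have "\<exists>X\<in>commutant h. norm X < \<epsilon> \<and> g = mexp X"
      if g: "g \<in> lie_group (commutant h)" "norm (g - mat 1) < \<delta> / B" for g
    proof -
      have "norm (c g - mat 1) = norm (c (g - mat 1))" by (simp add: linear_diff[OF lin(1)] c1)
      also have "\<dots> \<le> norm (g - mat 1) * B" by (rule B)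
      also have "\<dots> < \<delta>" using g(2) B(1) by (simp add: less_divide_eq)
      finally obtain X where X: "X \<in> commutant h" "norm (c X) < \<epsilon> / B'" "c g = mexp (c X)"
        using \<delta>(2)[of "c g", unfolded H, unfolded comm] g(1) by blast
      have "norm X < \<epsilon>"
        using B'(2)[of "c X"] X(2) B'(1) by (simp add: cc less_divide_eq)
      moreover have "g = mexp X"
        using X(3) injc unfolding mexp_algebra_hom[OF lin(1) c_mult c1] by (simp add: inj_eq)
      ultimately show ?thesis using X(1) by blast
    qed
    then show "\<exists>\<delta>>0. \<forall>g\<in>lie_group (commutant h). norm (g - mat 1) < \<delta> \<longrightarrow>
      (\<exists>X\<in>commutant h. norm X < \<epsilon> \<and> g = mexp X)"
      using \<delta>(1) B(1) by (intro exI[of _ "\<delta> / B"]) auto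
  qed (use h br in auto)
qed

context compact_lie_algebra
begin

text \<open>For small central \<open>Z\<close>, the element \<open>mexp Z\<close> of the commutant
  group is also \<open>mexp X\<close> with small \<open>X\<close> in the commutant. The two commute,
  so \<open>mexp (Z - X) = mat 1\<close>, and \<open>Z = X\<close> lies in both summands.\<close>

lemma center_group_discrete:
  "\<exists>\<epsilon>>0. \<forall>Z\<in>lie_center h. mexp Z \<in> lie_group (commutant h) \<longrightarrow> norm Z < \<epsilon> \<longrightarrow> Z = 0"
proof -
  obtain e where e: "e > 0" "\<And>X::real^'k^'k. norm X < e \<Longrightarrow> mexp X = mat 1 \<Longrightarrow> X = 0"
    using mexp_kernel_isolated by blast
  obtain \<delta> where \<delta>: "\<delta> > 0" "\<And>g. g \<in> lie_group (commutant h) \<Longrightarrow> norm (g - mat 1) < \<delta> \<Longrightarrow>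
      \<exists>X\<in>commutant h. norm X < e/2 \<and> g = mexp X"
    using near_identity[of "e/2"] e(1) by auto
  have "continuous_on UNIV (mexp :: real^'k^'k \<Rightarrow> _)" by (intro continuous_on_mexp continuous_on_id)
  then have "isCont (mexp :: real^'k^'k \<Rightarrow> _) 0" by (simp add: continuous_on_eq_continuous_at)
  then obtain d where d: "d > 0" "\<And>X::real^'k^'k. norm X < d \<Longrightarrow> norm (mexp X - mat 1) < \<delta>"
    using \<delta>(1) unfolding continuous_at_eps_delta by (auto simp: dist_norm)
  show ?thesis
  proof (intro exI[of _ "min d (e/2)"] conjI ballI impI)
    fix Z assume Z: "Z \<in> lie_center h" "mexp Z \<in> lie_group (commutant h)" "norm Z < min d (e/2)"
    then obtain X where X: "X \<in> commutant h" "norm X < e/2" "mexp Z = mexp X"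
      using \<delta>(2)[OF Z(2)] d(2)[of Z] by auto
    have "Z ** X = X ** Z" using lie_center_commute[OF Z(1)] X(1) commutant_subset by blast
    then have "mexp (Z - X) = mexp Z ** mexp (- X)"
      using mexp_add[of Z "- X"] by (simp add: mat_mult.minus_left mat_mult.minus_right)
    then have "mexp (Z - X) = mat 1" using X(3) by simp
    moreover have "norm (Z - X) < e" using Z(3) X(2) norm_triangle_ineq4[of Z X] by simp
    ultimately have "Z = X" using e(2) by fastforce
    then show "Z = 0" using X(1) Z(1) center_Int_commutant by blast
  qed (use d e in auto)
qed

end

subsection \<open>Central subspaces with closed exponential image\<close>

text \<open>What the closedness argument draws from the torus. Each \<open>u j\<close> has unit
  speed on its circle, hence the period \<open>2 * pi\<close>.\<close>

locale torus_lattice = compact_lie_algebra h for h :: "(real^'k^'k) set" +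
  fixes m :: nat and u :: "nat \<Rightarrow> real^'k^'k"
  assumes u_center: "\<And>j. j \<in> {1..m} \<Longrightarrow> u j \<in> lie_center h"
    and u_span: "\<And>X. X \<in> lie_center h \<Longrightarrow> \<exists>t. X = (\<Sum>j = 1..m. t j *\<^sub>R u j)"
    and mexp_lattice: "\<And>c::nat \<Rightarrow> int. mexp ((2 * pi) *\<^sub>R (\<Sum>j = 1..m. of_int (c j) *\<^sub>R u j)) = mat 1"
begin

definition lattice :: "(real^'k^'k) set" where
  "lattice = {X. \<exists>c :: nat \<Rightarrow> int. X = (\<Sum>j = 1..m. of_int (c j) *\<^sub>R u j)}"

lemma latticeI: "(\<Sum>j = 1..m. of_int (c j) *\<^sub>R u j) \<in> lattice"
  unfolding lattice_def by auto

lemma lattice_center: "X \<in> lattice \<Longrightarrow> X \<in> lie_center h"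
  unfolding lattice_def using subspace_center u_center
  by (auto intro!: subspace_sum subspace_scale)

lemma mexp_center_add:
  "X \<in> lie_center h \<Longrightarrow> Y \<in> lie_center h \<Longrightarrow> mexp (X + Y) = mexp X ** mexp Y"
  using mexp_add center_comm by blast

lemma mexp_center_diff:
  "X \<in> lie_center h \<Longrightarrow> Y \<in> lie_center h \<Longrightarrow> mexp (X - Y) = mexp X ** mexp (- Y)"
  using mexp_center_add[of X "- Y"] subspace_neg[OF subspace_center] by simp

text \<open>Reducing the coordinates in an integral basis of \<open>K\<close> modulo
  \<open>2 * pi\<close> changes an element by \<open>2 * pi\<close> times a lattice vector, which
  \<open>mexp\<close> does not see.\<close>

lemma bounded_representatives:
  assumes "has_integer_basis m u K" and K: "K \<subseteq> lie_center h"
  obtains R where "\<And>X. X \<in> K \<Longrightarrow> \<exists>X'\<in>K. norm X' \<le> R \<and> mexp X' = mexp X"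
proof -
  let ?l = "dim K"
  obtain v where inj: "inj_on v {1..?l}" and sp: "span (v ` {1..?l}) = K"
    and int: "\<And>i. i \<in> {1..?l} \<Longrightarrow> v i \<in> lattice"
    using assms(1) unfolding has_integer_basis_def lattice_def by blast
  have subK: "subspace K" using sp subspace_span by metis
  have vK: "v i \<in> K" if "i \<in> {1..?l}" for i
    using span_base[OF imageI[OF that, of v]] by (simp only: sp)
  have "\<exists>X'\<in>K. norm X' \<le> (\<Sum>i = 1..?l. 2 * pi * norm (v i)) \<and> mexp X' = mexp X" if "X \<in> K" for X
  proof -
    have "X \<in> range (\<lambda>w. \<Sum>x\<in>v ` {1..?l}. w x *\<^sub>R x)"
      using that span_finite[OF finite_imageI[OF finite_atLeastAtMost], of v 1 ?l] by (simp only: sp)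
    then obtain w where "X = (\<Sum>x\<in>v ` {1..?l}. w x *\<^sub>R x)" by (rule rangeE)
    then have X: "X = (\<Sum>i = 1..?l. w (v i) *\<^sub>R v i)" using inj by (simp add: sum.reindex)
    define c where "c i = \<lfloor>w (v i) / (2 * pi)\<rfloor>" for i
    define s where "s i = w (v i) - 2 * pi * of_int (c i)" for i
    have s: "0 \<le> s i" "s i \<le> 2 * pi" for i
    proof -
      have "of_int (c i) \<le> w (v i) / (2 * pi)" "w (v i) / (2 * pi) < of_int (c i) + 1"
        unfolding c_def by linarith+
      then show "0 \<le> s i" "s i \<le> 2 * pi" unfolding s_def by (simp_all add: field_simps)
    qed
    define X' where "X' = (\<Sum>i = 1..?l. s i *\<^sub>R v i)"
    define L where "L = (\<Sum>i = 1..?l. of_int (c i) *\<^sub>R v i)"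
    have XL: "X = X' + (2 * pi) *\<^sub>R L"
      unfolding X X'_def L_def s_def by (simp add: scaleR_sum_right algebra_simps sum.distrib[symmetric])
    have "L \<in> lattice"
    proof -
      have zero: "0 \<in> lattice" unfolding lattice_def by (auto intro!: exI[of _ "\<lambda>_. 0"])
      have add: "x + y \<in> lattice" if "x \<in> lattice" "y \<in> lattice" for x y
      proof -
        from that obtain a b where "x = (\<Sum>j = 1..m. of_int (a j) *\<^sub>R u j)" "y = (\<Sum>j = 1..m. of_int (b j) *\<^sub>R u j)"
          unfolding lattice_def by blast
        then have "x + y = (\<Sum>j = 1..m. of_int (a j + b j) *\<^sub>R u j)"
          by (simp add: scaleR_left_distrib sum.distrib)
        then show ?thesis using latticeI by (simp only:)
      qed
      have scale: "of_int k *\<^sub>R x \<in> lattice" if "x \<in> lattice" for k :: int and x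
      proof -
        from that obtain a where "x = (\<Sum>j = 1..m. of_int (a j) *\<^sub>R u j)" unfolding lattice_def by blast
        then have "of_int k *\<^sub>R x = (\<Sum>j = 1..m. of_int (k * a j) *\<^sub>R u j)"
          by (simp add: scaleR_sum_right)
        then show ?thesis using latticeI by (simp only:)
      qed
      have "(\<Sum>i\<in>I. of_int (c i) *\<^sub>R v i) \<in> lattice" if "finite I" "I \<subseteq> {1..?l}" for I
        using that by (induction I rule: finite_induct) (auto simp: zero intro!: add scale int)
      then show ?thesis unfolding L_def by blast
    qed
    then have "mexp ((2 * pi) *\<^sub>R L) = mat 1" using mexp_lattice by (auto simp: lattice_def)
    moreover have X'K: "X' \<in> K" unfolding X'_def using vK subK by (intro subspace_sum subspace_scale)
    ultimately have "mexp X = mexp X'"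
      unfolding XL using \<open>L \<in> lattice\<close> lattice_center subspace_scale[OF subspace_center] K
      by (subst mexp_center_add) auto
    moreover have "norm X' \<le> (\<Sum>i = 1..?l. 2 * pi * norm (v i))"
      unfolding X'_def using s by (intro sum_norm_le) (simp add: mult_right_mono)
    ultimately show ?thesis using X'K by metis
  qed
  then show ?thesis by (rule that)
qed

text \<open>By compactness, two distinct multiples of \<open>X\<close> are close modulo the lattice.\<close>

lemma dirichlet_approximation:
  assumes "X \<in> lie_center h" and "\<epsilon> > 0"
  obtains q l r where "q \<ge> (1::nat)" "l \<in> lattice" "real q *\<^sub>R X = (2 * pi) *\<^sub>R l + r" "norm r < \<epsilon>"
proof -
  obtain t where X: "X = (\<Sum>j = 1..m. t j *\<^sub>R u j)" using u_span[OF assms(1)] by blast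
  define c where "c n j = \<lfloor>real n * t j / (2 * pi)\<rfloor>" for n j
  define r where "r n = real n *\<^sub>R X - (2 * pi) *\<^sub>R (\<Sum>j = 1..m. of_int (c n j) *\<^sub>R u j)" for n
  have r: "r n = (\<Sum>j = 1..m. (real n * t j - 2 * pi * of_int (c n j)) *\<^sub>R u j)" for n
    unfolding r_def X by (simp add: scaleR_sum_right scaleR_left_diff_distrib sum_subtractf)
  have "norm (r n) \<le> (\<Sum>j = 1..m. 2 * pi * norm (u j))" for n
    unfolding r
  proof (rule sum_norm_le)
    fix j
    have "of_int (c n j) \<le> real n * t j / (2 * pi)" "real n * t j / (2 * pi) < of_int (c n j) + 1"
      unfolding c_def by linarith+
    then have "\<bar>real n * t j - 2 * pi * of_int (c n j)\<bar> \<le> 2 * pi" by (simp add: field_simps abs_le_iff)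
    then show "norm ((real n * t j - 2 * pi * of_int (c n j)) *\<^sub>R u j) \<le> 2 * pi * norm (u j)"
      by (simp add: mult_right_mono)
  qed
  then have "bounded (range r)" by (intro boundedI[where B = "\<Sum>j = 1..m. 2 * pi * norm (u j)"]) auto
  then obtain l s where s: "strict_mono s" "(r \<circ> s) \<longlonglongrightarrow> l"
    using bounded_imp_convergent_subsequence by blast
  then have "Cauchy (r \<circ> s)" by (rule_tac LIMSEQ_imp_Cauchy)
  then obtain M where "\<And>i j. i \<ge> M \<Longrightarrow> j \<ge> M \<Longrightarrow> norm ((r \<circ> s) i - (r \<circ> s) j) < \<epsilon>"
    using assms(2) unfolding Cauchy_iff by blast
  then have small: "norm (r (s (Suc M)) - r (s M)) < \<epsilon>" by (simp add: o_def)
  have less: "s M < s (Suc M)" using s(1) by (simp add: strict_mono_def)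
  show ?thesis
  proof (rule that[of "s (Suc M) - s M" "\<Sum>j = 1..m. of_int (c (s (Suc M)) j - c (s M) j) *\<^sub>R u j"
        "r (s (Suc M)) - r (s M)"])
    show "(\<Sum>j = 1..m. of_int (c (s (Suc M)) j - c (s M) j) *\<^sub>R u j) \<in> lattice"
      by (rule latticeI)
    show "real (s (Suc M) - s M) *\<^sub>R X = (2 * pi) *\<^sub>R (\<Sum>j = 1..m. of_int (c (s (Suc M)) j - c (s M) j) *\<^sub>R u j)
        + (r (s (Suc M)) - r (s M))"
      using less by (simp add: r_def of_nat_diff less_imp_le scaleR_left_diff_distrib sum_subtractf scaleR_diff_right)
  qed (use less small in auto)
qed

text \<open>If arbitrarily small \<open>r\<close> outside \<open>K\<close> had \<open>exp r\<close> in \<open>exp K\<close>, their components orthogonal to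
  \<open>K\<close> would accumulate at a direction \<open>y\<close> orthogonal to \<open>K\<close> with \<open>exp (t y)\<close> in the closure of
  \<open>exp K\<close>.  So the errors of Dirichlet approximations of \<open>X\<close> in \<open>K\<close> lie in \<open>K\<close>, and hence so do
  the approximating lattice vectors.\<close>

lemma integer_basis_of_closed:
  assumes K: "subspace K" "K \<subseteq> lie_center h"
    and closed: "\<And>X. X \<in> lie_center h \<Longrightarrow> (\<And>t. t \<ge> 0 \<Longrightarrow> mexp (t *\<^sub>R X) \<in> closure (mexp ` K)) \<Longrightarrow> X \<in> K"
  shows "has_integer_basis m u K"
proof -
  obtain \<pi> where \<pi>: "linear \<pi>" "\<And>x. \<pi> x \<in> K" "\<And>x s. s \<in> K \<Longrightarrow> (x - \<pi> x) \<bullet> s = 0"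
    "\<And>x. x \<in> K \<Longrightarrow> \<pi> x = x"
    using orthogonal_projection_exists[OF K(1)] by metis
  have bl\<pi>: "bounded_linear \<pi>" using \<pi>(1) by (simp add: linear_conv_bounded_linear)
  have near: "\<exists>\<epsilon>>0. \<forall>r\<in>lie_center h. mexp r \<in> mexp ` K \<longrightarrow> norm r < \<epsilon> \<longrightarrow> r \<in> K"
  proof (rule ccontr)
    assume no: "\<not> ?thesis"
    have "\<exists>r. r \<in> lie_center h \<and> mexp r \<in> mexp ` K \<and> norm r < inverse (real (Suc j)) \<and> r \<notin> K" for j
      using no by (metis inverse_positive_iff_positive of_nat_0_less_iff zero_less_Suc)
    then obtain r where r: "\<And>j. r j \<in> lie_center h" "\<And>j. mexp (r j) \<in> mexp ` K"
      "\<And>j. norm (r j) < inverse (real (Suc j))" "\<And>j. r j \<notin> K" by metis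
    define Y where "Y j = r j - \<pi> (r j)" for j
    define S where "S = lie_center h \<inter> {x. \<forall>s\<in>K. orthogonal s x}"
    have S: "subspace S"
      unfolding S_def by (intro subspace_inter subspace_center subspace_orthogonal_to_vectors)
    have YS: "Y j \<in> S" for j
      using \<pi> r(1) K(2) by (auto simp: S_def Y_def orthogonal_def inner_commute intro!: subspace_diff[OF subspace_center])
    have Ynz: "Y j \<noteq> 0" for j
      using r(4)[of j] \<pi>(2)[of "r j"] by (auto simp: Y_def)
    have "r \<longlonglongrightarrow> 0"
      by (intro Lim_null_comparison[OF _ LIMSEQ_inverse_real_of_nat] always_eventually allI less_imp_le r(3))
    then have Ylim: "Y \<longlonglongrightarrow> 0"
      using tendsto_diff[OF _ bounded_linear.tendsto[OF bl\<pi>], of r 0 sequentially r 0] linear_0[OF \<pi>(1)]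
      by (simp add: Y_def[abs_def])
    have YK: "mexp (real n *\<^sub>R Y j) \<in> mexp ` K" for j n
    proof -
      obtain X where X: "X \<in> K" "mexp (r j) = mexp X" using r(2) by blast
      have "mexp (real n *\<^sub>R r j) = mexp (real n *\<^sub>R X)"
      proof (induction n)
        case (Suc n)
        then show ?case
          using mexp_scaleR_add[of 1 "real n" "r j"] mexp_scaleR_add[of 1 "real n" X] X(2) by simp
      qed simp
      moreover have "real n *\<^sub>R Y j = real n *\<^sub>R r j - real n *\<^sub>R \<pi> (r j)"
        by (simp add: Y_def scaleR_diff_right)
      moreover have "real n *\<^sub>R r j \<in> lie_center h" "real n *\<^sub>R X \<in> lie_center h" "real n *\<^sub>R \<pi> (r j) \<in> lie_center h"
        using r(1) X(1) \<pi>(2) K(2) by (auto intro!: subspace_scale[OF subspace_center])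
      ultimately have "mexp (real n *\<^sub>R Y j) = mexp (real n *\<^sub>R X - real n *\<^sub>R \<pi> (r j))"
        by (simp add: mexp_center_diff)
      moreover have "real n *\<^sub>R X - real n *\<^sub>R \<pi> (r j) \<in> K"
        using X(1) \<pi>(2) by (intro subspace_diff subspace_scale K(1))
      ultimately show ?thesis by blast
    qed
    obtain y where y: "y \<in> S" "norm y = 1"
      and cl: "\<And>\<Gamma> t. (\<And>j n. mexp (real n *\<^sub>R Y j) \<in> \<Gamma>) \<Longrightarrow> t \<ge> 0 \<Longrightarrow> mexp (t *\<^sub>R y) \<in> closure \<Gamma>"
      using one_parameter_limit[OF S YS Ynz Ylim] by blast
    have "y \<in> K" using closed[of y] cl[OF YK] y(1) by (simp add: S_def)
    then have "orthogonal y y" using y(1) by (simp add: S_def)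
    then show False using y(2) by (auto simp: orthogonal_self)
  qed
  then obtain \<epsilon> where \<epsilon>: "\<epsilon> > 0" "\<And>r. r \<in> lie_center h \<Longrightarrow> mexp r \<in> mexp ` K \<Longrightarrow> norm r < \<epsilon> \<Longrightarrow> r \<in> K"
    by blast
  let ?S = "span (K \<inter> lattice)"
  have "X \<in> ?S" if X: "X \<in> K" for X
  proof -
    \<comment> \<open>Dividing a Dirichlet approximation by \<open>q\<close> puts a multiple of a
      lattice vector of \<open>K\<close> within \<open>norm r / q\<close> of \<open>X\<close>; a
      span is closed, so these approximations suffice.\<close>
    have "\<exists>s\<in>?S. dist s X < e" if e: "e > 0" for e
    proof -
      have "min e \<epsilon> > 0" using e \<epsilon> by simp
      then obtain q l r where q: "q \<ge> 1" and l: "l \<in> lattice" and eq: "real q *\<^sub>R X = (2 * pi) *\<^sub>R l + r"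
        and r: "norm r < min e \<epsilon>"
        using dirichlet_approximation[of X "min e \<epsilon>"] X K(2) by blast
      have lz: "(2 * pi) *\<^sub>R l \<in> lie_center h" using lattice_center[OF l] subspace_scale[OF subspace_center] by blast
      have qX: "real q *\<^sub>R X \<in> K" using X K(1) by (simp add: subspace_scale)
      have r_eq: "r = real q *\<^sub>R X - (2 * pi) *\<^sub>R l" using eq by simp
      have rz: "r \<in> lie_center h" unfolding r_eq using qX K(2) lz by (intro subspace_diff[OF subspace_center]) auto
      have "mexp (real q *\<^sub>R X) = mexp ((2 * pi) *\<^sub>R l) ** mexp r"
        unfolding eq by (rule mexp_center_add[OF lz rz])
      also have "mexp ((2 * pi) *\<^sub>R l) = mat 1" using l mexp_lattice by (auto simp: lattice_def)
      finally have "mexp r = mexp (real q *\<^sub>R X)" by simp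
      then have "mexp r \<in> mexp ` K" using qX by (rule image_eqI)
      then have rK: "r \<in> K" using \<epsilon>(2)[OF rz] r by simp
      have "(2 * pi) *\<^sub>R l = real q *\<^sub>R X - r" using eq by simp
      then have "(2 * pi) *\<^sub>R l \<in> K" using qX rK K(1) by (simp add: subspace_diff)
      then have "inverse (2 * pi) *\<^sub>R ((2 * pi) *\<^sub>R l) \<in> K" using K(1) by (rule_tac subspace_scale)
      then have "l \<in> K" by simp
      then have "inverse (real q) *\<^sub>R ((2 * pi) *\<^sub>R l) \<in> ?S"
        using l by (intro span_scale span_base) auto
      moreover have "X - inverse (real q) *\<^sub>R ((2 * pi) *\<^sub>R l) = inverse (real q) *\<^sub>R r"
      proof -
        have "X = inverse (real q) *\<^sub>R (real q *\<^sub>R X)" using q by simp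
        then show ?thesis unfolding eq scaleR_add_right by (metis add_diff_cancel_left')
      qed
      moreover have "norm (inverse (real q) *\<^sub>R r) \<le> norm r"
        using q by (simp add: inverse_le_1_iff mult_left_le_one_le)
      ultimately show ?thesis using r by (intro bexI) (auto simp: dist_norm norm_minus_commute)
    qed
    then show ?thesis
      using closed_approachable[OF closed_subspace[OF subspace_span]] by blast
  qed
  then have spanK: "?S = K" using span_minimal[OF _ K(1), of "K \<inter> lattice"] by blast
  obtain B where B: "B \<subseteq> K \<inter> lattice" "independent B" "K \<inter> lattice \<subseteq> span B"
    using basis_exists[of "K \<inter> lattice"] by metis
  have spB: "span B = K"
    using B spanK span_mono[OF B(1)] span_minimal[OF B(3) subspace_span] by blast
  have fin: "finite B" using B(2) independent_imp_finite by blast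
  have card: "card B = dim K" using dim_eq_card[OF _ B(2), of K] spB by (metis dim_span dim_span_eq_card_independent B(2))
  obtain v where v: "bij_betw v {1..card B} B" using ex_bij_betw_nat_finite_1[OF fin] by blast
  show ?thesis
    unfolding has_integer_basis_def card[symmetric]
  proof (intro exI[of _ v] conjI ballI)
    show "inj_on v {1..card B}" using v by (simp add: bij_betw_def)
    show "independent (v ` {1..card B})" "span (v ` {1..card B}) = K"
      using v B(2) spB by (simp_all add: bij_betw_def)
    fix i assume "i \<in> {1..card B}"
    then have "v i \<in> lattice" using v B(1) by (auto simp: bij_betw_def)
    then show "\<exists>c::nat \<Rightarrow> int. v i = (\<Sum>j = 1..m. of_int (c j) *\<^sub>R u j)" by (simp add: lattice_def)
  qed
qed

end

subsection \<open>Groups of types 3 and 4 in a common frame\<close>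

lemma mexp_conj_mexp:
  fixes B X :: "real^'k^'k"
  shows "mexp B ** mexp X ** mexp (- B) = mexp (mexp B ** X ** mexp (- B))"
proof -
  have "linear (\<lambda>X::real^'k^'k. mexp B ** X ** mexp (- B))"
    by (intro bounded_linear.linear bounded_linear_compose[OF mat_mult.bounded_linear_left mat_mult.bounded_linear_right])
  moreover have "mexp B ** (A ** C) ** mexp (- B) = mexp B ** A ** mexp (- B) ** (mexp B ** C ** mexp (- B))"
    for A C :: "real^'k^'k"
    by (metis matrix_mul_assoc matrix_mul_rid mexp_minus(2))
  ultimately show ?thesis using mexp_algebra_hom[of "\<lambda>X. mexp B ** X ** mexp (- B)" X] by simp
qed

text \<open>Common frame for types 3 and 4: \<open>N\<close> is \<open>p \<and> E\<close> resp. \<open>p \<and> E\<^sub>1\<close>, and \<open>a\<close> is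
  \<open>\<real> p \<and> q\<close> resp. \<open>p \<and> E\<^sub>0\<close>.\<close>

locale lie_extension = torus_lattice h m u
  for h :: "(real^'k^'k) set" and m :: nat and u :: "nat \<Rightarrow> real^'k^'k" +
  fixes N a :: "(real^'k^'k) set" and f :: "real^'k^'k \<Rightarrow> real^'k^'k"
  assumes N: "subspace N" and N_comm: "\<And>X Y. X \<in> N \<Longrightarrow> Y \<in> N \<Longrightarrow> X ** Y = Y ** X"
    and N_h: "\<And>A X. A \<in> h \<Longrightarrow> X \<in> N \<Longrightarrow> lie_bracket A X \<in> N"
    and N_a: "\<And>b X. b \<in> a \<Longrightarrow> X \<in> N \<Longrightarrow> lie_bracket b X \<in> N"
    and a: "subspace a" and a_comm: "\<And>b c. b \<in> a \<Longrightarrow> c \<in> a \<Longrightarrow> b ** c = c ** b"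
    and a_h: "\<And>b A. b \<in> a \<Longrightarrow> A \<in> h \<Longrightarrow> b ** A = A ** b"
    and f_linear: "linear f" and f_a: "\<And>A. A \<in> h \<Longrightarrow> f A \<in> a"
    and f_commutant: "\<And>A. A \<in> commutant h \<Longrightarrow> f A = 0"
    and proper: "\<And>R. \<exists>R'. \<forall>\<nu>\<in>N. \<forall>g\<in>lie_group h. \<forall>b\<in>a. norm (mexp \<nu> ** g ** mexp b) \<le> R \<longrightarrow>
      norm \<nu> \<le> R' \<and> norm b \<le> R'"
    and unique: "\<And>\<nu> g g' b. \<nu> \<in> N \<Longrightarrow> g \<in> lie_group h \<Longrightarrow> g' \<in> lie_group h \<Longrightarrow> b \<in> a \<Longrightarrow>
      mexp \<nu> ** g ** mexp b = g' \<Longrightarrow> \<nu> = 0 \<and> b = 0"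
begin

section \<open>Normal form of the group elements\<close>

definition extension :: "(real^'k^'k) set" where
  "extension = {\<nu> + (A + f A) | \<nu> A. \<nu> \<in> N \<and> A \<in> h}"

definition twist :: "real^'k^'k \<Rightarrow> real^'k^'k" where
  "twist Z = mexp (Z + f Z)"

lemma center_h: "Z \<in> lie_center h \<Longrightarrow> Z \<in> h"
  using center_subset by blast

lemma f_center: "Z \<in> lie_center h \<Longrightarrow> f Z \<in> a"
  by (rule f_a[OF center_h])

lemma twist_eq: "Z \<in> lie_center h \<Longrightarrow> twist Z = mexp Z ** mexp (f Z)"
  unfolding twist_def by (rule mexp_add) (simp add: a_h f_center center_h)

lemma twist_add:
  assumes "Z \<in> lie_center h" "Z' \<in> lie_center h"
  shows "twist (Z + Z') = twist Z ** twist Z'"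
proof -
  have "(Z + f Z) ** (Z' + f Z') = (Z' + f Z') ** (Z + f Z)"
    using center_comm[OF assms] a_comm[OF assms[THEN f_center]] a_h[OF f_center[OF assms(1)] center_h[OF assms(2)]]
      a_h[OF f_center[OF assms(2)] center_h[OF assms(1)]]
    by (simp add: mat_mult.add_left mat_mult.add_right algebra_simps)
  from mexp_add[OF this] show ?thesis
    unfolding twist_def by (simp add: linear_add[OF f_linear] algebra_simps)
qed

lemma commute_twist:
  assumes "k \<in> lie_group (commutant h)" and "Z \<in> lie_center h"
  shows "k ** twist Z = twist Z ** k"
  unfolding twist_def
proof (rule lie_group_commute[OF assms(1) mexp_commute])
  fix A assume "A \<in> commutant h"
  then have A: "A \<in> h" using commutant_subset by blast
  show "A ** (Z + f Z) = (Z + f Z) ** A"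
    using lie_center_commute[OF assms(2) A] a_h[OF f_center[OF assms(2)] A]
    by (simp add: mat_mult.add_left mat_mult.add_right)
qed

lemma bracket_N:
  assumes "A \<in> h" and "X \<in> N"
  shows "lie_bracket (A + f A) X \<in> N"
proof -
  have "lie_bracket (A + f A) X = lie_bracket A X + lie_bracket (f A) X"
    by (simp add: lie_bracket_def mat_mult.add_left mat_mult.add_right)
  then show ?thesis
    using N_h[OF assms] N_a[OF f_a[OF assms(1)] assms(2)] subspace_add[OF N] by simp
qed

lemma mexp_conj_N:
  assumes "A \<in> h" and "X \<in> N"
  shows "mexp (A + f A) ** X ** mexp (- (A + f A)) \<in> N"
  using mexp_conj_subspace[OF N bracket_N[OF assms(1)] assms(2)] .

text \<open>The semidirect formula splits off \<open>N\<close> on the left. The remaining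
  \<open>A\<close> is split into commutant and centre; \<open>f\<close> sees only the central part,
  and the two exponents commute.\<close>

lemma mexp_extension:
  assumes "\<nu> \<in> N" and "A \<in> h"
  obtains \<omega> A' Z where "\<omega> \<in> N" "A' \<in> commutant h" "Z \<in> lie_center h"
    "mexp (\<nu> + (A + f A)) = mexp \<omega> ** mexp (A + f A)" "mexp (A + f A) = mexp A' ** twist Z"
proof -
  have "\<exists>\<omega>\<in>N. mexp (\<nu> + (A + f A)) = mexp \<omega> ** mexp (A + f A)"
    by (rule mexp_semidirect[OF N N_comm bracket_N[OF assms(2)] assms(1)])
  then obtain \<omega> where \<omega>: "\<omega> \<in> N" "mexp (\<nu> + (A + f A)) = mexp \<omega> ** mexp (A + f A)" by blast
  obtain Z where Z: "Z \<in> lie_center h" "A - Z \<in> commutant h" using decomposition[OF assms(2)] by blast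
  let ?A' = "A - Z"
  have A'h: "?A' \<in> h" using Z(2) commutant_subset by blast
  have "f A = f Z" using f_commutant[OF Z(2)] by (simp add: linear_diff[OF f_linear])
  then have eq: "A + f A = ?A' + (Z + f Z)" by simp
  have "?A' ** (Z + f Z) = (Z + f Z) ** ?A'"
    using lie_center_commute[OF Z(1) A'h] a_h[OF f_center[OF Z(1)] A'h]
    by (simp only: mat_mult.add_left mat_mult.add_right)
  then have "mexp (A + f A) = mexp ?A' ** twist Z"
    unfolding twist_def eq by (rule mexp_add)
  then show ?thesis using that \<omega> Z by blast
qed

text \<open>The form is stable under left multiplication by an exponential:
  \<open>mexp (A + f A)\<close> passes \<open>mexp \<mu>\<close> by conjugation within
  \<open>N\<close>, and twists are multiplicative and commute with the commutant group.\<close>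

lemma lie_group_extension_form:
  assumes "x \<in> lie_group extension"
  obtains \<nu> k Z where "\<nu> \<in> N" "k \<in> lie_group (commutant h)" "Z \<in> lie_center h" "x = mexp \<nu> ** k ** twist Z"
proof -
  have "\<exists>\<nu>\<in>N. \<exists>k\<in>lie_group (commutant h). \<exists>Z\<in>lie_center h. x = mexp \<nu> ** k ** twist Z"
    using assms
  proof (induction x rule: lie_group.induct)
    case one
    have "mat 1 = mexp 0 ** mat 1 ** twist 0" by (simp add: twist_def linear_0[OF f_linear])
    then show ?case using subspace_0[OF N] subspace_0[OF subspace_center] lie_group.one by blast
  next
    case (step B x)
    then obtain \<nu> A where A: "\<nu> \<in> N" "A \<in> h" "B = \<nu> + (A + f A)" by (auto simp: extension_def)
    obtain \<mu> k Z where x: "\<mu> \<in> N" "k \<in> lie_group (commutant h)" "Z \<in> lie_center h" "x = mexp \<mu> ** k ** twist Z"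
      using step.IH by blast
    obtain \<omega> A' Z' where w: "\<omega> \<in> N" "A' \<in> commutant h" "Z' \<in> lie_center h"
      "mexp B = mexp \<omega> ** mexp (A + f A)" "mexp (A + f A) = mexp A' ** twist Z'"
      using mexp_extension[OF A(1,2)] unfolding A(3) by metis
    let ?b = "A + f A"
    define \<mu>' where "\<mu>' = mexp ?b ** \<mu> ** mexp (- ?b)"
    have \<mu>': "\<mu>' \<in> N" unfolding \<mu>'_def by (rule mexp_conj_N[OF A(2) x(1)])
    have sw: "mexp ?b ** mexp \<mu> = mexp \<mu>' ** mexp ?b"
    proof -
      have "mexp \<mu>' ** mexp ?b = mexp ?b ** mexp \<mu> ** (mexp (- ?b) ** mexp ?b)"
        unfolding \<mu>'_def mexp_conj_mexp[symmetric] by (simp only: matrix_mul_assoc)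
      then show ?thesis unfolding mexp_minus(2) by simp
    qed
    have "mexp B ** x = mexp \<omega> ** (mexp ?b ** mexp \<mu>) ** k ** twist Z"
      unfolding w(4) x(4) by (simp only: matrix_mul_assoc)
    also have "\<dots> = mexp \<omega> ** mexp \<mu>' ** mexp A' ** twist Z' ** k ** twist Z"
      unfolding sw unfolding w(5) by (simp only: matrix_mul_assoc)
    also have "mexp \<omega> ** mexp \<mu>' = mexp (\<omega> + \<mu>')"
      by (rule mexp_add[symmetric]) (rule N_comm[OF w(1) \<mu>'])
    also have "mexp (\<omega> + \<mu>') ** mexp A' ** twist Z' ** k ** twist Z
        = mexp (\<omega> + \<mu>') ** (mexp A' ** k) ** twist (Z' + Z)"
    proof -
      have "mexp (\<omega> + \<mu>') ** mexp A' ** twist Z' ** k ** twist Z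
          = mexp (\<omega> + \<mu>') ** mexp A' ** (twist Z' ** k) ** twist Z"
        by (simp only: matrix_mul_assoc)
      also have "\<dots> = mexp (\<omega> + \<mu>') ** (mexp A' ** k) ** (twist Z' ** twist Z)"
        unfolding commute_twist[OF x(2) w(3), symmetric] by (simp only: matrix_mul_assoc)
      finally show ?thesis unfolding twist_add[OF w(3) x(3)] .
    qed
    finally have "mexp B ** x = mexp (\<omega> + \<mu>') ** (mexp A' ** k) ** twist (Z' + Z)" .
    moreover have "\<omega> + \<mu>' \<in> N" using w(1) \<mu>' by (intro subspace_add[OF N])
    moreover have "mexp A' ** k \<in> lie_group (commutant h)" using w(2) x(2) by (rule lie_group.step)
    moreover have "Z' + Z \<in> lie_center h" using w(3) x(3) by (intro subspace_add[OF subspace_center])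
    ultimately show ?case by blast
  qed
  then show ?thesis using that by blast
qed

lemma in_lie_group_extension:
  assumes "\<nu> \<in> N" "k \<in> lie_group (commutant h)" "Z \<in> lie_center h"
  shows "mexp \<nu> ** k ** twist Z \<in> lie_group extension"
proof (intro lie_group_mult)
  have "\<nu> = \<nu> + (0 + f 0)" by (simp add: linear_0[OF f_linear])
  then have "\<nu> \<in> extension" unfolding extension_def using assms(1) subspace_0[OF sub] by blast
  then show "mexp \<nu> \<in> lie_group extension" by (rule mexp_in_lie_group)
  have "A \<in> extension" if "A \<in> commutant h" for A
  proof -
    have "A = 0 + (A + f A)" using f_commutant[OF that] by simp
    then show ?thesis unfolding extension_def using subspace_0[OF N] that commutant_subset by blast
  qed
  then show "k \<in> lie_group extension" using lie_group_mono[OF assms(2)] by blast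
  have "Z + f Z = 0 + (Z + f Z)" by simp
  then have "Z + f Z \<in> extension" unfolding extension_def using subspace_0[OF N] center_h[OF assms(3)] by blast
  then show "twist Z \<in> lie_group extension" unfolding twist_def by (rule mexp_in_lie_group)
qed

definition kernel :: "(real^'k^'k) set" where
  "kernel = {Z \<in> lie_center h. f Z = 0}"

lemma subspace_kernel: "subspace kernel"
proof -
  have "kernel = lie_center h \<inter> {Z. f Z = 0}" by (auto simp: kernel_def)
  then show ?thesis
    using subspace_inter[OF subspace_center linear_subspace_kernel[OF f_linear]] by simp
qed

lemma kernel_center: "kernel \<subseteq> lie_center h"
  by (auto simp: kernel_def)

lemma center_in_lie_group: "Z \<in> lie_center h \<Longrightarrow> mexp Z \<in> lie_group h"
  by (rule mexp_in_lie_group[OF center_h])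

lemma commutant_in_lie_group: "k \<in> lie_group (commutant h) \<Longrightarrow> k \<in> lie_group h"
  by (rule lie_group_mono[OF _ commutant_subset])

section \<open>Closedness versus integrality\<close>

text \<open>Along a convergent sequence \<open>proper\<close> bounds \<open>\<nu>\<close> and
  \<open>f Z\<close>. As \<open>f\<close> is injective on the complement \<open>M\<close> of the
  kernel, that part of \<open>Z\<close> is bounded; the kernel part has a bounded replacement with
  the same exponential. So the sequence lies in the continuous image of a compact set.\<close>

lemma closed_extension:
  assumes "has_integer_basis m u kernel"
  shows "closed (lie_group extension)"
proof -
  obtain R1 where R1: "\<And>X. X \<in> kernel \<Longrightarrow> \<exists>X'\<in>kernel. norm X' \<le> R1 \<and> mexp X' = mexp X"
    using bounded_representatives[OF assms kernel_center] by blast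
  obtain \<pi> where \<pi>: "linear \<pi>" "\<And>x. \<pi> x \<in> kernel" "\<And>x s. s \<in> kernel \<Longrightarrow> (x - \<pi> x) \<bullet> s = 0"
    "\<And>x. x \<in> kernel \<Longrightarrow> \<pi> x = x"
    using orthogonal_projection_exists[OF subspace_kernel] by metis
  define M where "M = lie_center h \<inter> {x. \<forall>s\<in>kernel. orthogonal s x}"
  have M: "subspace M"
    unfolding M_def by (intro subspace_inter subspace_center subspace_orthogonal_to_vectors)
  have "\<exists>e>0. \<forall>x\<in>M. norm (f x) \<ge> e * norm x"
  proof (rule injective_imp_isometric[OF closed_subspace[OF M] M])
    show "bounded_linear f" using f_linear by (simp add: linear_conv_bounded_linear)
    show "\<forall>x\<in>M. f x = 0 \<longrightarrow> x = 0"
    proof (intro ballI impI)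
      fix x assume x: "x \<in> M" "f x = 0"
      then have "x \<in> kernel" by (simp add: M_def kernel_def)
      then have "orthogonal x x" using x(1) by (simp add: M_def)
      then show "x = 0" by (simp add: orthogonal_self)
    qed
  qed
  then obtain e where e: "e > 0" "\<And>x. x \<in> M \<Longrightarrow> e * norm x \<le> norm (f x)" by blast
  \<comment> \<open>Only the kernel component of \<open>Z\<close> is replaced; there
    \<open>twist\<close> agrees with \<open>mexp\<close>.\<close>
  have rep: "\<exists>X Y. X \<in> kernel \<and> norm X \<le> R1 \<and> Y \<in> M \<and> twist Z = twist (X + Y) \<and> f (X + Y) = f Y"
    if Z: "Z \<in> lie_center h" for Z
  proof -
    obtain X where X: "X \<in> kernel" "norm X \<le> R1" "mexp X = mexp (\<pi> Z)" using R1[OF \<pi>(2)] by blast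
    let ?Y = "Z - \<pi> Z"
    have piZ: "\<pi> Z \<in> lie_center h" "X \<in> lie_center h" using \<pi>(2) X(1) kernel_center by blast+
    have Y: "?Y \<in> M" "?Y \<in> lie_center h"
      using \<pi>(3) Z subspace_diff[OF subspace_center Z piZ(1)] by (auto simp: M_def orthogonal_def inner_commute)
    have tw: "twist W = mexp W" if "W \<in> kernel" for W using that by (simp add: twist_def kernel_def)
    have "twist Z = twist (\<pi> Z) ** twist ?Y" using twist_add[OF piZ(1) Y(2)] by simp
    also have "\<dots> = twist (X + ?Y)"
      using twist_add[OF piZ(2) Y(2)] tw[OF \<pi>(2)] tw[OF X(1)] X(3) by simp
    finally have "twist Z = twist (X + ?Y)" .
    moreover have "f (X + ?Y) = f ?Y" using X(1) by (simp add: linear_add[OF f_linear] kernel_def)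
    ultimately show ?thesis using X(1,2) Y(1) by blast
  qed
  show ?thesis
    unfolding closed_sequential_limits
  proof (intro allI impI, elim conjE)
    fix x l assume x: "\<forall>n. x n \<in> lie_group extension" and lim: "x \<longlonglongrightarrow> l"
    obtain R where R: "\<And>n. norm (x n) \<le> R"
      using convergent_imp_bounded[OF lim] unfolding bounded_iff by auto
    obtain R' where R': "\<And>\<nu> g b. \<nu> \<in> N \<Longrightarrow> g \<in> lie_group h \<Longrightarrow> b \<in> a \<Longrightarrow> norm (mexp \<nu> ** g ** mexp b) \<le> R
        \<Longrightarrow> norm \<nu> \<le> R' \<and> norm b \<le> R'" using proper by blast
    \<comment> \<open>\<open>R1\<close> bounds the kernel part and \<open>R' / e\<close> the part in
      \<open>M\<close>, since \<open>e * norm Y \<le> norm (f Y) \<le> R'\<close>.\<close>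
    define C where "C = (N \<inter> cball 0 R') \<times> lie_group (commutant h) \<times> (lie_center h \<inter> cball 0 (R1 + R' / e))"
    define F where "F = (\<lambda>(\<nu> :: real^'k^'k, k :: real^'k^'k, Z). mexp \<nu> ** k ** mexp (Z + f Z))"
    have "compact C"
      unfolding C_def by (intro compact_Times closed_Int_compact closed_subspace N subspace_center
          compact_cball compact_commutant_group)
    moreover have "continuous_on C F"
      unfolding F_def case_prod_unfold
      by (intro mat_mult.continuous_on continuous_on_mexp continuous_intros
          continuous_on_compose2[OF linear_continuous_on[OF f_linear[unfolded linear_conv_bounded_linear], of UNIV]]) auto
    ultimately have "closed (F ` C)" by (intro compact_imp_closed compact_continuous_image)
    moreover have "x n \<in> F ` C" for n
    proof -
      obtain \<nu> k Z where xn: "\<nu> \<in> N" "k \<in> lie_group (commutant h)" "Z \<in> lie_center h" "x n = mexp \<nu> ** k ** twist Z"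
        using lie_group_extension_form x by metis
      obtain X Y where XY: "X \<in> kernel" "norm X \<le> R1" "Y \<in> M" "twist Z = twist (X + Y)" "f (X + Y) = f Y"
        using rep[OF xn(3)] by blast
      have Yz: "Y \<in> lie_center h" using XY(3) by (simp add: M_def)
      have XYz: "X + Y \<in> lie_center h"
        using XY(1) Yz kernel_center by (intro subspace_add[OF subspace_center]) auto
      have "x n = mexp \<nu> ** (k ** mexp (X + Y)) ** mexp (f Y)"
        unfolding xn(4) XY(4) twist_eq[OF XYz] XY(5) by (simp only: matrix_mul_assoc)
      then have "norm \<nu> \<le> R' \<and> norm (f Y) \<le> R'"
        using R[of n] by (intro R'[OF xn(1) _ f_center[OF Yz], of "k ** mexp (X + Y)"] lie_group_mult
            commutant_in_lie_group xn(2) center_in_lie_group XYz) simp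
      moreover from this have "norm Y \<le> R' / e" using e(2)[OF XY(3)] e(1) by (simp add: le_divide_eq mult.commute)
      ultimately have "(\<nu>, k, X + Y) \<in> C"
        unfolding C_def using xn(1,2) XYz norm_triangle_ineq[of X Y] XY(2) by auto
      moreover have "x n = F (\<nu>, k, X + Y)" unfolding xn(4) XY(4) F_def by (simp add: twist_def)
      ultimately show ?thesis by blast
    qed
    ultimately have "l \<in> F ` C" using closed_sequentially lim by blast
    then obtain \<nu> k Z where "\<nu> \<in> N" "k \<in> lie_group (commutant h)" "Z \<in> lie_center h" "l = mexp \<nu> ** k ** twist Z"
      unfolding C_def F_def twist_def by auto
    then show "l \<in> lie_group extension" using in_lie_group_extension by simp
  qed
qed

text \<open>Relative closedness puts \<open>mexp (t *\<^sub>R X)\<close> into the group, and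
  \<open>unique\<close> reduces its normal form to \<open>k ** mexp Z\<close> with \<open>Z\<close>
  in the kernel. So \<open>t *\<^sub>R X\<close> lies in the kernel up to the discrete set
  \<open>\<Lambda>\<close> of central logarithms of the commutant group, for all
  \<open>t \<ge> 0\<close>. \<open>U\<close> stands for the ambient group.\<close>

lemma integer_basis_kernel:
  assumes closedin: "closedin (top_of_set U) (lie_group extension)"
    and U: "\<And>Z. Z \<in> lie_center h \<Longrightarrow> mexp Z \<in> U"
  shows "has_integer_basis m u kernel"
proof (rule integer_basis_of_closed[OF subspace_kernel kernel_center])
  fix X assume X: "X \<in> lie_center h" and cl: "\<And>t. t \<ge> 0 \<Longrightarrow> mexp (t *\<^sub>R X) \<in> closure (mexp ` kernel)"
  obtain C where C: "closed C" "lie_group extension = U \<inter> C"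
    using closedin by (auto simp: closedin_closed)
  have "mexp Z \<in> lie_group extension" if "Z \<in> kernel" for Z
    using in_lie_group_extension[OF subspace_0[OF N] lie_group.one, of Z] that by (simp add: twist_def kernel_def)
  then have "closure (mexp ` kernel) \<subseteq> C" using C by (intro closure_minimal) auto
  then have in_ext: "mexp (t *\<^sub>R X) \<in> lie_group extension" if "t \<ge> 0" for t
    using cl[OF that] U[OF subspace_scale[OF subspace_center X, of t]] C(2) by blast
  obtain \<epsilon> where \<epsilon>: "\<epsilon> > 0" "\<And>Z. Z \<in> lie_center h \<Longrightarrow> mexp Z \<in> lie_group (commutant h) \<Longrightarrow> norm Z < \<epsilon> \<Longrightarrow> Z = 0"
    using center_group_discrete by blast
  define \<Lambda> where "\<Lambda> = {Z \<in> lie_center h. mexp Z \<in> lie_group (commutant h)}"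
  show "X \<in> kernel"
  proof (rule pigeonhole_subspace[OF \<epsilon>(1) _ subspace_kernel, of \<Lambda>])
    fix x y assume xy: "x \<in> \<Lambda>" "y \<in> \<Lambda>" "norm (x - y) < \<epsilon>"
    obtain z where z: "z \<in> lie_group (commutant h)" "mexp y ** z = mat 1"
      using lie_group_inverse[OF subspace_commutant, of "mexp y" h] xy(2) by (auto simp: \<Lambda>_def)
    have "z = mexp (- y)" using z(2) by (metis matrix_mul_assoc matrix_mul_lid matrix_mul_rid mexp_minus(2))
    then have "mexp (x - y) \<in> lie_group (commutant h)"
      using xy(1,2) z(1) lie_group_mult by (auto simp: \<Lambda>_def mexp_center_diff)
    moreover have "x - y \<in> lie_center h" using xy by (auto simp: \<Lambda>_def intro: subspace_diff[OF subspace_center])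
    ultimately have "x - y = 0" using \<epsilon>(2) xy(3) by blast
    then show "x = y" by simp
  next
    fix t :: real assume t: "t \<ge> 0"
    have tX: "t *\<^sub>R X \<in> lie_center h" using X by (rule subspace_scale[OF subspace_center])
    obtain \<nu> k Z where Z: "\<nu> \<in> N" "k \<in> lie_group (commutant h)" "Z \<in> lie_center h"
      "mexp (t *\<^sub>R X) = mexp \<nu> ** k ** twist Z"
      using lie_group_extension_form[OF in_ext[OF t]] by blast
    have eq: "mexp \<nu> ** (k ** mexp Z) ** mexp (f Z) = mexp (t *\<^sub>R X)"
      unfolding Z(4) twist_eq[OF Z(3)] by (simp only: matrix_mul_assoc)
    have "\<nu> = 0 \<and> f Z = 0"
      by (rule unique[OF Z(1) _ _ f_center[OF Z(3)] eq])
        (intro lie_group_mult commutant_in_lie_group Z(2) center_in_lie_group Z(3) tX)+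
    then have k: "k ** mexp Z = mexp (t *\<^sub>R X)" and ZK: "Z \<in> kernel"
      using eq Z(3) by (simp_all add: kernel_def)
    have "mexp (t *\<^sub>R X - Z) = k ** (mexp Z ** mexp (- Z))"
      unfolding mexp_center_diff[OF tX Z(3)] k[symmetric] by (simp only: matrix_mul_assoc)
    then have "mexp (t *\<^sub>R X - Z) \<in> lie_group (commutant h)" using Z(2) by simp
    then have "t *\<^sub>R X - Z \<in> \<Lambda>"
      unfolding \<Lambda>_def using subspace_diff[OF subspace_center tX Z(3)] by simp
    then show "\<exists>Z\<in>kernel. t *\<^sub>R X - Z \<in> \<Lambda>" using ZK by blast
  qed
qed

end

subsection \<open>Torus bases\<close>

lemma mat_group_simps:
  "carrier (mat_group H) = H" "x \<otimes>\<^bsub>mat_group H\<^esub> y = x ** y" "\<one>\<^bsub>mat_group H\<^esub> = mat 1"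
  by (simp_all add: mat_group_def)

text \<open>\<open>generate\<close> uses \<open>inv\<close>, a definite description; once it is
  identified as \<open>mexp (- A)\<close>, inverse generators are again exponentials of
  \<open>g\<close>.\<close>

lemma connected_lie_subgroup_eq:
  assumes g: "subspace g" and SO: "\<And>A. A \<in> g \<Longrightarrow> mexp A \<in> SO \<eta>"
  shows "connected_lie_subgroup \<eta> g = lie_group g"
proof -
  let ?G = "mat_group (SO \<eta>)"
  have inv: "inv\<^bsub>?G\<^esub> (mexp A) = mexp (- A)" if A: "A \<in> g" for A
    unfolding m_inv_def
  proof (rule the_equality)
    show "mexp (- A) \<in> carrier ?G \<and> mexp A \<otimes>\<^bsub>?G\<^esub> mexp (- A) = \<one>\<^bsub>?G\<^esub> \<and> mexp (- A) \<otimes>\<^bsub>?G\<^esub> mexp A = \<one>\<^bsub>?G\<^esub>"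
      using SO[OF subspace_neg[OF g A]] by (simp add: mat_group_simps)
    fix y assume "y \<in> carrier ?G \<and> mexp A \<otimes>\<^bsub>?G\<^esub> y = \<one>\<^bsub>?G\<^esub> \<and> y \<otimes>\<^bsub>?G\<^esub> mexp A = \<one>\<^bsub>?G\<^esub>"
    then have "y ** mexp A = mat 1" by (simp add: mat_group_simps)
    then have "y ** (mexp A ** mexp (- A)) = mexp (- A)" by (simp only: matrix_mul_assoc) simp
    then show "y = mexp (- A)" by simp
  qed
  have "x \<in> lie_group g" if "x \<in> generate ?G (mexp ` g)" for x
    using that
  proof (induction x rule: generate.induct)
    case one
    then show ?case using lie_group.one by (simp add: mat_group_simps)
  next
    case (incl x)
    then show ?case using mexp_in_lie_group by blast
  next
    case (inv x)
    then obtain A where A: "A \<in> g" "x = mexp A" by blast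
    then show ?case using mexp_in_lie_group[OF subspace_neg[OF g A(1)]] \<open>\<And>A. A \<in> g \<Longrightarrow> inv\<^bsub>?G\<^esub> (mexp A) = mexp (- A)\<close>
      by simp
  next
    case (eng x y)
    then show ?case using lie_group_mult[OF eng.IH] by (simp add: mat_group_simps)
  qed
  moreover have "x \<in> generate ?G (mexp ` g)" if "x \<in> lie_group g" for x
    using that
  proof (induction x rule: lie_group.induct)
    case one
    then show ?case using generate.one[of ?G "mexp ` g"] by (simp add: mat_group_simps)
  next
    case (step A x)
    then show ?case using generate.eng[OF generate.incl[OF imageI[OF step(1), of mexp], of ?G] step(3)]
      by (simp add: mat_group_simps)
  qed
  ultimately show ?thesis unfolding connected_lie_subgroup_def by blast
qed

context compact_lie_algebra
begin

lemma lie_group_center: "lie_group (lie_center h) = mexp ` lie_center h"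
proof -
  have z: "subspace (lie_center h)" using subspace_lie_center[OF sub] .
  have "x \<in> mexp ` lie_center h" if "x \<in> lie_group (lie_center h)" for x
    using that
  proof (induction x rule: lie_group.induct)
    case one
    show ?case using subspace_0[OF z] mexp_zero by (metis image_eqI)
  next
    case (step A x)
    then obtain B where B: "B \<in> lie_center h" "x = mexp B" by blast
    have "A ** B = B ** A" using lie_center_commute[OF step(1)] B(1) center_subset by blast
    then have "mexp A ** x = mexp (A + B)" using mexp_add B(2) by metis
    then show ?case using subspace_add[OF z step(1) B(1)] by blast
  qed
  then show ?thesis using mexp_in_lie_group by blast
qed

end

lemma commute_of_mexp_commute:
  fixes A B :: "real^'k^'k"
  assumes "\<And>t. mexp (t *\<^sub>R A) ** B = B ** mexp (t *\<^sub>R A)"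
  shows "A ** B = B ** A"
proof -
  have d: "((\<lambda>t. mexp (t *\<^sub>R A)) has_vector_derivative A) (at 0)"
    using mexp_has_vector_derivative[of A 0 UNIV] by simp
  have "((\<lambda>t. mexp (t *\<^sub>R A) ** B - B ** mexp (t *\<^sub>R A)) has_vector_derivative A ** B - B ** A) (at 0)"
    by (intro has_vector_derivative_diff bounded_linear.has_vector_derivative[OF mat_mult.bounded_linear_left d]
        bounded_linear.has_vector_derivative[OF mat_mult.bounded_linear_right d])
  then have "A ** B - B ** A \<in> {0}"
    by (rule has_vector_derivative_in_subspace) (simp_all add: assms)
  then show ?thesis by simp
qed

text \<open>The homomorphism law spreads differentiability from \<open>0\<close> to all
  \<open>t\<close>; then \<open>\<gamma> t ** mexp (t *\<^sub>R - u)\<close> has derivative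
  zero.\<close>

lemma one_parameter_group_eq_mexp:
  fixes \<gamma> :: "real \<Rightarrow> real^'k^'k"
  assumes add: "\<And>s t. \<gamma> (s + t) = \<gamma> s ** \<gamma> t" and zero: "\<gamma> 0 = mat 1"
    and der: "(\<gamma> has_vector_derivative u) (at 0)"
  shows "\<gamma> t = mexp (t *\<^sub>R u)"
proof -
  have d\<gamma>: "(\<gamma> has_vector_derivative \<gamma> t ** u) (at t)" for t
  proof -
    have "((\<lambda>s. \<gamma> (s - t)) has_vector_derivative u) (at t)"
      using vector_diff_chain_at[of "\<lambda>s. s - t" 1 t \<gamma> u] der
      by (simp add: o_def has_vector_derivative_diff_const)
    from bounded_linear.has_vector_derivative[OF mat_mult.bounded_linear_right this, of "\<gamma> t"]
    show ?thesis by (simp add: add[symmetric])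
  qed
  have "((\<lambda>t. \<gamma> t ** mexp (t *\<^sub>R - u)) has_vector_derivative 0) (at t within UNIV)" for t
  proof -
    have "((\<lambda>t. \<gamma> t ** mexp (t *\<^sub>R - u)) has_vector_derivative
        \<gamma> t ** (mexp (t *\<^sub>R - u) ** - u) + \<gamma> t ** u ** mexp (t *\<^sub>R - u)) (at t)"
      by (rule mat_mult.has_vector_derivative[OF d\<gamma> mexp_has_vector_derivative])
    moreover have "mexp (t *\<^sub>R - u) ** - u = - u ** mexp (t *\<^sub>R - u)"
      by (rule mexp_commute[symmetric]) (simp add: mat_mult.scaleR_left mat_mult.scaleR_right
          mat_mult.minus_left mat_mult.minus_right)
    moreover have "\<gamma> t ** (- u ** mexp (t *\<^sub>R - u)) + \<gamma> t ** u ** mexp (t *\<^sub>R - u) = 0"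
      by (simp only: mat_mult.minus_left mat_mult.minus_right matrix_mul_assoc) simp
    ultimately show ?thesis by (simp only:)
  qed
  then obtain c where "\<And>t. t \<in> UNIV \<Longrightarrow> \<gamma> t ** mexp (t *\<^sub>R - u) = c"
    by (rule has_vector_derivative_zero_constant[OF convex_UNIV]) blast
  from this[of t] this[of 0] have "\<gamma> t ** mexp (- (t *\<^sub>R u)) = mat 1" by (simp add: zero)
  then have "\<gamma> t ** (mexp (- (t *\<^sub>R u)) ** mexp (t *\<^sub>R u)) = mexp (t *\<^sub>R u)"
    by (simp only: matrix_mul_assoc) simp
  then show ?thesis by simp
qed

text \<open>The curve \<open>\<theta> (cis (s * t))\<close> is a one-parameter group with velocity
  \<open>u\<close>. That it starts at \<open>mat 1\<close> follows since \<open>\<theta> 1\<close>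
  is idempotent and has a right inverse.\<close>

lemma circle_tangent_mexp:
  assumes "circle_tangent S u" and inv: "\<And>x. x \<in> S \<Longrightarrow> \<exists>y. x ** y = mat 1"
  obtains s \<theta> where "\<bar>s\<bar> = 1" "\<And>t. mexp (t *\<^sub>R u) = \<theta> (cis (s * t))" "\<And>t. mexp (t *\<^sub>R u) \<in> S"
    "inj_on \<theta> (sphere 0 1)"
proof -
  obtain \<theta> s where \<theta>: "\<theta> \<in> iso circle_group (mat_group S)" and s: "\<bar>s\<bar> = 1"
    and der: "((\<lambda>t. \<theta> (cis (s * t))) has_vector_derivative u) (at 0)"
    using assms(1) unfolding circle_tangent_def by blast
  have hom: "\<theta> (x * y) = \<theta> x ** \<theta> y" if "x \<in> sphere 0 1" "y \<in> sphere 0 1" for x y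
    using \<theta> that unfolding iso_def hom_def by (simp add: circle_group_def mat_group_simps)
  have mem: "\<theta> x \<in> S" if "x \<in> sphere 0 1" for x
    using \<theta> that unfolding iso_def hom_def by (auto simp: circle_group_def mat_group_simps)
  have inj: "inj_on \<theta> (sphere 0 1)"
    using \<theta> unfolding iso_def bij_betw_def by (simp add: circle_group_def)
  have cis: "cis t \<in> sphere 0 1" for t by simp
  have one: "\<theta> 1 = mat 1"
  proof -
    obtain y where y: "\<theta> 1 ** y = mat 1" using inv mem[of 1] by auto
    have "\<theta> 1 ** \<theta> 1 = \<theta> 1" using hom[of 1 1] by simp
    then have "\<theta> 1 ** (\<theta> 1 ** y) = \<theta> 1 ** y" by (simp only: matrix_mul_assoc)
    then show ?thesis using y by simp
  qed
  have eq: "\<theta> (cis (s * t)) = mexp (t *\<^sub>R u)" for t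
  proof (rule one_parameter_group_eq_mexp[OF _ _ der])
    show "\<theta> (cis (s * (x + y))) = \<theta> (cis (s * x)) ** \<theta> (cis (s * y))" for x y
      using hom[OF cis cis] by (simp add: cis_mult distrib_left)
    show "\<theta> (cis (s * 0)) = mat 1" using one by simp
  qed
  show ?thesis
    using that[OF s eq[symmetric] _ inj] mem[OF cis] eq by metis
qed

text \<open>Injectivity of the product map gives linear independence of the \<open>u i\<close>, and
  counting against \<open>m\<close> gives spanning. That \<open>u i\<close> lies in the centre needs
  an argument of its own, as \<open>T\<close> is known only as an image of
  \<open>mexp\<close>.\<close>

lemma torus_lattice_of_torus_basis:
  fixes h :: "(real^'k^'k) set"
  assumes "compact_lie_algebra h" and m: "m = dim (lie_center h)"
    and torus: "torus_basis (lie_group (lie_center h)) m u"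
  shows "torus_lattice h m u"
proof -
  interpret compact_lie_algebra h by fact
  let ?z = "lie_center h"
  let ?T = "lie_group ?z"
  have z: "subspace ?z" using subspace_lie_center[OF sub] .
  have zcomm: "X ** Y = Y ** X" if "X \<in> ?z" "Y \<in> ?z" for X Y
    using lie_center_commute that center_subset by blast
  obtain S where S: "\<And>i. i \<in> {1..m} \<Longrightarrow> subgroup (S i) (mat_group ?T)"
    "\<And>i. i \<in> {1..m} \<Longrightarrow> circle_tangent (S i) (u i)"
    and iso: "(\<lambda>s. finprod (mat_group ?T) s {1..m}) \<in> iso (product_group {1..m} (\<lambda>i. mat_group (S i))) (mat_group ?T)"
    using torus unfolding torus_basis_def by blast
  have ST: "S i \<subseteq> ?T" if "i \<in> {1..m}" for i
    using subgroup.subset[OF S(1)[OF that]] by (simp add: mat_group_simps)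
  have inv: "\<exists>y. x ** y = mat 1" if "x \<in> ?T" for x
    using lie_group_inverse[OF z that] by blast
  have Tcomm: "x ** y = y ** x" if xy: "x \<in> ?T" "y \<in> ?T" for x y
  proof -
    obtain X Y where "X \<in> ?z" "Y \<in> ?z" "x = mexp X" "y = mexp Y" using xy unfolding lie_group_center by blast
    then show ?thesis
      using mexp_add[OF zcomm, of X Y] mexp_add[OF zcomm, of Y X] by (simp add: add.commute)
  qed
  have circ: "\<exists>s \<theta>. \<bar>s\<bar> = 1 \<and> (\<forall>t. mexp (t *\<^sub>R u i) = \<theta> (cis (s * t))) \<and> (\<forall>t. mexp (t *\<^sub>R u i) \<in> S i) \<and> inj_on \<theta> (sphere 0 1)"
    if i: "i \<in> {1..m}" for i
  proof -
    have "\<exists>y. x ** y = mat 1" if "x \<in> S i" for x using inv ST[OF i] that by blast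
    from circle_tangent_mexp[OF S(2)[OF i] this] show ?thesis by metis
  qed
  have mexpS: "mexp (t *\<^sub>R u i) \<in> S i" if "i \<in> {1..m}" for i t
    using circ[OF that] by blast
  have mexpT: "mexp (t *\<^sub>R u i) \<in> ?T" if "i \<in> {1..m}" for i t
    using mexpS[OF that] ST[OF that] by blast
  have period: "mexp ((2 * pi * of_int c) *\<^sub>R u i) = mat 1" if i: "i \<in> {1..m}" for i and c :: int
  proof -
    obtain s \<theta> where s: "\<bar>s\<bar> = 1" "\<And>t. mexp (t *\<^sub>R u i) = \<theta> (cis (s * t))" using circ[OF i] by blast
    have "s * (2 * pi * of_int c) = 2 * pi * of_int (if s = 1 then c else - c)" using s(1) by (auto simp: abs_if split: if_splits)
    then have "cis (s * (2 * pi * of_int c)) = 1" using cis_multiple_2pi[of "of_int (if s = 1 then c else - c)"] by (simp only:) simp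
    then have "mexp ((2 * pi * of_int c) *\<^sub>R u i) = \<theta> (cis (s * 0))" unfolding s(2) by simp
    also have "\<dots> = mexp (0 *\<^sub>R u i)" by (rule s(2)[symmetric])
    finally show ?thesis by simp
  qed
  have nontriv: "c = 0" if i: "i \<in> {1..m}" and triv: "\<And>r. mexp ((r * c) *\<^sub>R u i) = mat 1" for i c
  proof (rule ccontr)
    assume "c \<noteq> 0"
    obtain s \<theta> where s: "\<bar>s\<bar> = 1" "\<And>t. mexp (t *\<^sub>R u i) = \<theta> (cis (s * t))" "inj_on \<theta> (sphere 0 1)" using circ[OF i] by blast
    have s0: "s * s = 1" using s(1) by (auto simp: abs_if split: if_splits)
    \<comment> \<open>The rate \<open>c\<close> being nonzero, the circle point \<open>- 1\<close>
      is reached at this time; triviality would give it the same image as \<open>1\<close>.\<close>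
    have "\<theta> (cis (s * ((s * pi / c) * c))) = \<theta> (cis (s * 0))"
      unfolding s(2)[symmetric] triv by simp
    then have "cis (s * ((s * pi / c) * c)) = cis (s * 0)"
      using s(3) by (rule_tac inj_onD[OF s(3)]) auto
    moreover have "s * ((s * pi / c) * c) = pi" using \<open>c \<noteq> 0\<close> s0 by (simp add: mult.assoc[symmetric])
    ultimately show False by simp
  qed
  have uz: "u i \<in> ?z" if i: "i \<in> {1..m}" for i
  proof -
    have comm: "u i ** Z = Z ** u i" if Z: "Z \<in> ?z" for Z
    proof -
      have c: "mexp (t *\<^sub>R u i) ** mexp (r *\<^sub>R Z) = mexp (r *\<^sub>R Z) ** mexp (t *\<^sub>R u i)" for t r
        using Tcomm[OF mexpT[OF i] mexp_in_lie_group[OF subspace_scale[OF z Z]]] .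
      have "Z ** mexp (t *\<^sub>R u i) = mexp (t *\<^sub>R u i) ** Z" for t
        by (rule commute_of_mexp_commute[OF c[symmetric]])
      then show ?thesis by (rule commute_of_mexp_commute[OF sym])
    qed
    \<comment> \<open>\<open>u i\<close> commutes with the centre, so
      \<open>mexp (t *\<^sub>R u i) = mexp Z\<close> makes \<open>t *\<^sub>R u i - Z\<close> a
      logarithm of \<open>mat 1\<close>. Such logarithms commute pairwise, hence are
      \<open>\<epsilon>\<close>-separated.\<close>
    define \<Lambda> where "\<Lambda> = {X. mexp X = mat 1 \<and> (\<exists>t. \<exists>Z\<in>?z. X = t *\<^sub>R u i - Z)}"
    obtain \<epsilon> where \<epsilon>: "\<epsilon> > 0" "\<And>X::real^'k^'k. norm X < \<epsilon> \<Longrightarrow> mexp X = mat 1 \<Longrightarrow> X = 0"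
      using mexp_kernel_isolated by blast
    show ?thesis
    proof (rule pigeonhole_subspace[OF \<epsilon>(1) _ z, of \<Lambda>])
      fix x y assume xy: "x \<in> \<Lambda>" "y \<in> \<Lambda>" "norm (x - y) < \<epsilon>"
      obtain t Z t' Z' where Z: "Z \<in> ?z" "Z' \<in> ?z" "x = t *\<^sub>R u i - Z" "y = t' *\<^sub>R u i - Z'"
        using xy(1,2) unfolding \<Lambda>_def by blast
      have "x ** - y = - y ** x"
        unfolding Z(3,4) using comm[OF Z(1)] comm[OF Z(2)] zcomm[OF Z(1,2)]
        by (simp add: mat_mult.diff_left mat_mult.diff_right mat_mult.scaleR_left mat_mult.scaleR_right algebra_simps)
      from mexp_add[OF this] have "mexp (x - y) = mexp x ** mexp (- y)" by simp
      moreover have "mexp (- y) = mat 1"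
      proof -
        have "mexp y = mat 1" using xy(2) by (simp add: \<Lambda>_def)
        then show ?thesis using mexp_minus(1)[of y, unfolded \<open>mexp y = mat 1\<close>] by simp
      qed
      ultimately have "mexp (x - y) = mat 1" using xy(1) by (simp add: \<Lambda>_def)
      then have "x - y = 0" using \<epsilon>(2) xy(3) by blast
      then show "x = y" by simp
    next
      fix t :: real
      obtain Z where Z: "Z \<in> ?z" "mexp (t *\<^sub>R u i) = mexp Z"
        using mexpT[OF i, of t] unfolding lie_group_center by blast
      have "t *\<^sub>R u i ** - Z = - Z ** (t *\<^sub>R u i)"
        using comm[OF Z(1)] by (simp add: mat_mult.scaleR_left mat_mult.scaleR_right mat_mult.minus_left mat_mult.minus_right)
      from mexp_add[OF this] have "mexp (t *\<^sub>R u i - Z) = mat 1" using Z(2) by simp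
      then show "\<exists>Z\<in>?z. t *\<^sub>R u i - Z \<in> \<Lambda>" using Z(1) unfolding \<Lambda>_def by blast
    qed
  qed
  have sumz: "(\<Sum>j\<in>I. t j *\<^sub>R u j) \<in> ?z" if "I \<subseteq> {1..m}" for I t
    using that uz by (intro subspace_sum[OF z] subspace_scale[OF z]) blast
  have mexp_insert: "mexp (\<Sum>j\<in>insert i I. t j *\<^sub>R u j) = mexp (t i *\<^sub>R u i) ** mexp (\<Sum>j\<in>I. t j *\<^sub>R u j)"
    if "finite I" "i \<notin> I" "insert i I \<subseteq> {1..m}" for i I t
    unfolding sum.insert[OF that(1,2)]
    by (rule mexp_add[OF zcomm]) (use that uz in \<open>auto intro!: sumz subspace_scale[OF z]\<close>)
  interpret T: comm_monoid "mat_group ?T"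
    by (rule comm_monoidI) (auto simp: mat_group_simps lie_group_mult lie_group.one matrix_mul_assoc intro: Tcomm)
  have fin: "finprod (mat_group ?T) (\<lambda>j. mexp (t j *\<^sub>R u j)) I = mexp (\<Sum>j\<in>I. t j *\<^sub>R u j)"
    if "finite I" "I \<subseteq> {1..m}" for I t
    using that
  proof (induction I rule: finite_induct)
    case empty
    then show ?case by (simp add: mat_group_simps)
  next
    case (insert i I)
    have "finprod (mat_group ?T) (\<lambda>j. mexp (t j *\<^sub>R u j)) (insert i I)
        = mexp (t i *\<^sub>R u i) \<otimes>\<^bsub>mat_group ?T\<^esub> finprod (mat_group ?T) (\<lambda>j. mexp (t j *\<^sub>R u j)) I"
      using insert mexpT by (intro T.finprod_insert) (auto simp: mat_group_simps)
    then show ?case using insert mexp_insert[of I i t] by (simp add: mat_group_simps)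
  qed
  \<comment> \<open>A linear relation scaled by any \<open>r\<close> gives two families with the
    same product, the factors \<open>mexp ((r * t j) *\<^sub>R u j)\<close> and the constant
    \<open>mat 1\<close>; injectivity makes every factor trivial.\<close>
  have indep: "t i = 0" if sum0: "(\<Sum>j = 1..m. t j *\<^sub>R u j) = 0" and i: "i \<in> {1..m}" for t i
  proof (rule nontriv[OF i])
    fix r
    let ?f = "\<lambda>s. finprod (mat_group ?T) s {1..m}" and ?P = "product_group {1..m} (\<lambda>i. mat_group (S i))"
    define a where "a = (\<lambda>j\<in>{1..m}. mexp ((r * t j) *\<^sub>R u j))"
    define b where "b = (\<lambda>j\<in>{1..m}. mexp ((0::real) *\<^sub>R u j))"
    have inj: "inj_on ?f (carrier ?P)" using iso unfolding iso_def bij_betw_def by blast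
    have ab: "a \<in> carrier ?P" "b \<in> carrier ?P"
      unfolding a_def b_def using mexpS by (auto simp: mat_group_simps simp del: scaleR_zero_left)
    have "?f a = finprod (mat_group ?T) (\<lambda>j. mexp ((r * t j) *\<^sub>R u j)) {1..m}"
      by (rule T.finprod_cong') (use mexpT in \<open>auto simp: a_def mat_group_simps\<close>)
    also have "\<dots> = mexp (r *\<^sub>R (\<Sum>j = 1..m. t j *\<^sub>R u j))"
      unfolding fin[OF finite_atLeastAtMost order_refl] by (simp add: scaleR_sum_right)
    also have "\<dots> = mexp (\<Sum>j = 1..m. (0::real) *\<^sub>R u j)" unfolding sum0 by simp
    also have "\<dots> = finprod (mat_group ?T) (\<lambda>j. mexp ((0::real) *\<^sub>R u j)) {1..m}"
      unfolding fin[OF finite_atLeastAtMost order_refl] ..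
    also have "\<dots> = ?f b"
      by (rule T.finprod_cong'[symmetric]) (use mexpT in \<open>auto simp: b_def mat_group_simps simp del: scaleR_zero_left\<close>)
    finally have "a = b" using inj_onD[OF inj _ ab] by blast
    then have "a i = b i" by simp
    then show "mexp ((r * t i) *\<^sub>R u i) = mat 1" using i by (simp add: a_def b_def)
  qed
  have inju: "inj_on u {1..m}"
  proof (rule inj_onI, rule ccontr)
    fix i j assume ij: "i \<in> {1..m}" "j \<in> {1..m}" "u i = u j" "i \<noteq> j"
    define t where "t k = (if k = i then 1 else if k = j then -1 else 0 :: real)" for k
    have "(\<Sum>k = 1..m. t k *\<^sub>R u k) = (\<Sum>k\<in>{i, j}. t k *\<^sub>R u k)"
      using ij(1,2) by (intro sum.mono_neutral_right) (auto simp: t_def)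
    also have "\<dots> = 0" using ij by (simp add: t_def)
    finally have "t i = 0" using indep ij(1) by blast
    then show False by (simp add: t_def)
  qed
  have "independent (u ` {1..m})"
  proof
    assume "dependent (u ` {1..m})"
    then obtain w v where w: "v \<in> u ` {1..m}" "w v \<noteq> 0" "(\<Sum>v\<in>u ` {1..m}. w v *\<^sub>R v) = 0"
      using dependent_finite[of "u ` {1..m}"] by auto
    have "(\<Sum>j = 1..m. w (u j) *\<^sub>R u j) = 0" using w(3) inju by (simp add: sum.reindex)
    then have "w (u j) = 0" if "j \<in> {1..m}" for j by (rule indep[OF _ that])
    then show False using w(1,2) by blast
  qed
  moreover have "card (u ` {1..m}) = m" using card_image[OF inju] by simp
  ultimately have "?z \<subseteq> span (u ` {1..m})"
    using uz m by (intro card_ge_dim_independent) auto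
  show ?thesis
  proof
    fix X assume "X \<in> ?z"
    then have "X \<in> range (\<lambda>w. \<Sum>v\<in>u ` {1..m}. w v *\<^sub>R v)"
      using \<open>?z \<subseteq> _\<close> span_finite[of "u ` {1..m}"] by blast
    then obtain w where "X = (\<Sum>v\<in>u ` {1..m}. w v *\<^sub>R v)" by (rule rangeE)
    then have "X = (\<Sum>j = 1..m. w (u j) *\<^sub>R u j)" using inju by (simp add: sum.reindex)
    then show "\<exists>t. X = (\<Sum>j = 1..m. t j *\<^sub>R u j)" by (intro exI[of _ "\<lambda>j. w (u j)"])
  next
    fix c :: "nat \<Rightarrow> int"
    have "mexp (\<Sum>j\<in>I. (2 * pi * of_int (c j)) *\<^sub>R u j) = mat 1" if "finite I" "I \<subseteq> {1..m}" for I
      using that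
    proof (induction I rule: finite_induct)
      case (insert i I)
      then show ?case using mexp_insert[of I i "\<lambda>j. 2 * pi * of_int (c j)"] period[of i "c i"] by simp
    qed simp
    from this[of "{1..m}"] show "mexp ((2 * pi) *\<^sub>R (\<Sum>j = 1..m. of_int (c j) *\<^sub>R u j)) = mat 1"
      by (simp add: scaleR_sum_right)
  qed (rule uz)
qed

section \<open>The closedness criterion\<close>

context lie_extension
begin

lemma subspace_extension: "subspace extension"
proof (rule subspaceI)
  have "0 = 0 + (0 + f 0)" by (simp add: linear_0[OF f_linear])
  then show "0 \<in> extension" unfolding extension_def using subspace_0[OF N] subspace_0[OF sub] by blast
next
  fix x y assume "x \<in> extension" "y \<in> extension"
  then obtain \<nu> A \<mu> B where "\<nu> \<in> N" "A \<in> h" "\<mu> \<in> N" "B \<in> h" "x = \<nu> + (A + f A)" "y = \<mu> + (B + f B)"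
    unfolding extension_def by blast
  moreover from this have "x + y = (\<nu> + \<mu>) + ((A + B) + f (A + B))"
    by (simp add: linear_add[OF f_linear])
  ultimately show "x + y \<in> extension"
    unfolding extension_def using subspace_add[OF N] subspace_add[OF sub] by blast
next
  fix c x assume "x \<in> extension"
  then obtain \<nu> A where "\<nu> \<in> N" "A \<in> h" "x = \<nu> + (A + f A)"
    unfolding extension_def by blast
  moreover from this have "c *\<^sub>R x = c *\<^sub>R \<nu> + (c *\<^sub>R A + f (c *\<^sub>R A))"
    by (simp add: linear_scale[OF f_linear] scaleR_add_right)
  ultimately show "c *\<^sub>R x \<in> extension"
    unfolding extension_def using subspace_scale[OF N] subspace_scale[OF sub] by blast
qed

theorem extension_closed_iff:
  assumes SO: "\<And>A. A \<in> extension \<Longrightarrow> mexp A \<in> SO \<eta>" "\<And>Z. Z \<in> lie_center h \<Longrightarrow> mexp Z \<in> SO \<eta>"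
  shows "closedin (top_of_set (SO \<eta>)) (connected_lie_subgroup \<eta> extension) \<longleftrightarrow> has_integer_basis m u kernel"
proof -
  have eq: "connected_lie_subgroup \<eta> extension = lie_group extension"
    by (rule connected_lie_subgroup_eq[OF subspace_extension SO(1)])
  have "x \<in> SO \<eta>" if "x \<in> lie_group extension" for x
    using that
  proof (induction x rule: lie_group.induct)
    case (step A x)
    then show ?case
      using SO(1)[OF step(1)] by (simp add: SO_def det_mul flip: matrix_vector_mul_assoc)
  qed (simp add: SO_def)
  then have "lie_group extension \<subseteq> SO \<eta>" by blast
  then show ?thesis
    unfolding eq using closed_extension integer_basis_kernel[OF _ SO(2)] closed_subset by blast
qed

end

text \<open>Composition with the orthogonal projection onto \<open>S\<close>. Meant for
  \<open>\<phi>\<close> and \<open>\<psi>\<close>, whose values off \<open>h\<close> are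
  arbitrary.\<close>

lemma linear_on_extend:
  fixes S :: "'a::euclidean_space set"
  assumes "linear_on S f" and S: "subspace S"
  obtains F where "linear F" "\<And>x. x \<in> S \<Longrightarrow> F x = f x"
proof -
  obtain \<pi> where \<pi>: "linear \<pi>" "\<And>x. \<pi> x \<in> S" "\<And>x s. s \<in> S \<Longrightarrow> (x - \<pi> x) \<bullet> s = 0"
    "\<And>x. x \<in> S \<Longrightarrow> \<pi> x = x"
    using orthogonal_projection_exists[OF S] by metis
  show ?thesis
  proof (rule that[of "\<lambda>x. f (\<pi> x)"])
    show "linear (\<lambda>x. f (\<pi> x))"
      using assms(1) \<pi>(2) unfolding linear_on_def
      by (intro linearI) (simp_all add: linear_add[OF \<pi>(1)] linear_scale[OF \<pi>(1)])
  qed (simp add: \<pi>(4))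
qed

lemma matrix_apply:
  fixes f :: "real^'k \<Rightarrow> real^'k"
  shows "linear f \<Longrightarrow> matrix f *v x = f x"
  by (simp add: matrix_works)

lemma matrix_vector_minus: "(A :: real^'k^'k) *v (- x) = - (A *v x)"
  by (simp add: matrix_vector_mult_def vec_eq_iff sum_negf)

subsection \<open>Witt bases\<close>

locale witt_space =
  fixes \<eta> :: "real^'k \<Rightarrow> real^'k \<Rightarrow> real" and n :: nat and p :: "real^'k"
    and e :: "nat \<Rightarrow> real^'k" and q :: "real^'k"
  assumes witt: "witt_basis \<eta> n p e q"
begin

abbreviation "E \<equiv> span (e ` {1..n})"

lemma bb: "bounded_bilinear \<eta>"
  using witt by (simp add: witt_basis_def bilinear_conv_bounded_bilinear)

sublocale \<eta>: bounded_bilinear \<eta> by (rule bb)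

lemma sym: "\<eta> v w = \<eta> w v"
  using witt by (simp add: witt_basis_def)

lemma eta_basis [simp]: "\<eta> p p = 0" "\<eta> q q = 0" "\<eta> p q = 1" "\<eta> q p = 1"
  using witt sym[of q p] by (simp_all add: witt_basis_def)

lemma eta_e:
  assumes "i \<in> {1..n}"
  shows "\<eta> p (e i) = 0" "\<eta> q (e i) = 0" "\<eta> (e i) p = 0" "\<eta> (e i) q = 0"
    "j \<in> {1..n} \<Longrightarrow> \<eta> (e i) (e j) = (if i = j then - 1 else 0)"
  using witt assms sym[of "e i"] by (simp_all add: witt_basis_def)

text \<open>The \<open>\<eta>\<close>-dual of the Witt basis: \<open>p\<close> and \<open>q\<close>
  are swapped, and \<open>e i\<close> changes sign since \<open>\<eta> (e i) (e i) = - 1\<close>.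
  Pairing with \<open>dual x\<close> reads off the coordinate along \<open>x\<close>.\<close>

definition dual :: "real^'k \<Rightarrow> real^'k" where
  "dual x = (if x = p then q else if x = q then p else - x)"

abbreviation "basis \<equiv> {p, q} \<union> e ` {1..n}"

lemma distinct_basis: "p \<noteq> q" "i \<in> {1..n} \<Longrightarrow> e i \<noteq> p" "i \<in> {1..n} \<Longrightarrow> e i \<noteq> q"
  "i \<in> {1..n} \<Longrightarrow> j \<in> {1..n} \<Longrightarrow> e i = e j \<Longrightarrow> i = j"
proof -
  show "p \<noteq> q" using eta_basis(1,3) by (metis zero_neq_one)
  show "e i \<noteq> p" "e i \<noteq> q" if "i \<in> {1..n}"
  proof -
    have "\<eta> (e i) (e i) \<noteq> \<eta> p p" "\<eta> (e i) (e i) \<noteq> \<eta> q q" using eta_e(5)[OF that that] by simp_all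
    then show "e i \<noteq> p" "e i \<noteq> q" by metis+
  qed
  show "i = j" if "i \<in> {1..n}" "j \<in> {1..n}" "e i = e j"
    using eta_e(5)[OF that(1,1)] eta_e(5)[OF that(1,2)] that(3) by (auto split: if_splits)
qed

lemma eta_dual:
  assumes "x \<in> basis" "y \<in> basis"
  shows "\<eta> (dual x) y = (if x = y then 1 else 0)"
proof -
  have d: "dual p = q" "dual q = p" "i \<in> {1..n} \<Longrightarrow> dual (e i) = - e i" for i
    using distinct_basis(1-3) by (auto simp: dual_def)
  have e_inj: "(e i = e j) = (i = j)" if "i \<in> {1..n}" "j \<in> {1..n}" for i j
    using distinct_basis(4)[OF that] by blast
  have cases: "y = p \<or> y = q \<or> (\<exists>i\<in>{1..n}. y = e i)" if "y \<in> basis" for y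
    using that by blast
  consider "x = p" | "x = q" | i where "i \<in> {1..n}" "x = e i" using cases[OF assms(1)] by blast
  then show ?thesis
  proof cases
    case 1
    then show ?thesis
      using cases[OF assms(2)] distinct_basis(1) distinct_basis(2,3)[THEN not_sym] eta_e(2) by (elim disjE bexE) (simp_all add: d)
  next
    case 2
    then show ?thesis
      using cases[OF assms(2)] distinct_basis(1)[symmetric] distinct_basis(2,3)[THEN not_sym] eta_e(1) by (elim disjE bexE) (simp_all add: d)
  next
    case (3 i)
    then have x: "dual x = - e i" "x = e i" "x \<noteq> p" "x \<noteq> q" using d(3) distinct_basis(2,3) by auto
    from cases[OF assms(2)] show ?thesis
    proof (elim disjE bexE)
      fix j assume j: "j \<in> {1..n}" "y = e j"
      show ?thesis
        unfolding x(1) unfolding x(2) j(2) e_inj[OF 3(1) j(1)] \<eta>.minus_left eta_e(5)[OF 3(1) j(1)] by simp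
    qed (use x eta_e(3,4)[OF 3(1)] in \<open>simp_all add: \<eta>.minus_left\<close>)
  qed
qed

lemma card_basis: "card basis = CARD('k)"
proof -
  have "card (e ` {1..n}) = n"
    using card_image[OF inj_onI[OF distinct_basis(4)], of "{1..n}"] by simp
  moreover have "p \<notin> e ` {1..n}" "q \<notin> e ` {1..n}" using distinct_basis(2,3) by blast+
  ultimately have "card basis = n + 2" using distinct_basis(1) by simp
  then show ?thesis using witt by (simp add: witt_basis_def)
qed

text \<open>\<open>M\<close> has the Witt basis as columns, indexed by \<open>'k\<close> through
  equality of cardinalities, and \<open>M'\<close> collects the dual coordinates.\<close>

lemma frame_exists:
  "\<exists>M M' b. M ** M' = mat 1 \<and> M' ** M = mat 1 \<and> bij_betw b (UNIV :: 'k set) basis \<and>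
    (\<forall>j. M *v axis j 1 = b j) \<and> (\<forall>w i. (M' *v w) $ i = \<eta> (dual (b i)) w)"
proof -
  obtain b where b: "bij_betw b (UNIV :: 'k set) basis"
    using finite_same_card_bij[of "UNIV :: 'k set" basis] card_basis by auto
  have bin: "b i \<in> basis" for i using b by (auto simp: bij_betw_def)
  have binj: "b i = b j \<longleftrightarrow> i = j" for i j using b by (auto simp: bij_betw_def inj_on_def)
  define L where "L x = (\<Sum>k\<in>UNIV. x $ k *\<^sub>R b k)" for x :: "real^'k"
  define L' where "L' w = (\<chi> k. \<eta> (dual (b k)) w)" for w
  have lin: "linear L" "linear L'"
    unfolding L_def L'_def
    by (auto intro!: linearI simp: scaleR_add_left sum.distrib scaleR_sum_right vec_eq_iff \<eta>.add_right \<eta>.scaleR_right)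
  have LL: "L' (L x) = x" for x
  proof -
    have "\<eta> (dual (b i)) (L x) = x $ i" for i
    proof -
      have "\<eta> (dual (b i)) (L x) = (\<Sum>k\<in>UNIV. x $ k * (if i = k then 1 else 0))"
        unfolding L_def \<eta>.sum_right \<eta>.scaleR_right by (simp add: eta_dual[OF bin bin] binj)
      then show ?thesis by (simp add: if_distrib[of "\<lambda>c. _ * c"] cong: if_cong)
    qed
    then show ?thesis by (simp add: L'_def vec_eq_iff)
  qed
  have M'M: "matrix L' ** matrix L = mat 1"
    by (simp add: matrix_eq matrix_vector_mul_assoc[symmetric] matrix_apply[OF lin(1)] matrix_apply[OF lin(2)] LL)
  show ?thesis
  proof (rule exI[of _ "matrix L"], rule exI[of _ "matrix L'"], rule exI[of _ b], intro conjI allI)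
    show "matrix L' ** matrix L = mat 1" "bij_betw b UNIV basis" by fact+
    show "matrix L ** matrix L' = mat 1" using M'M by (simp add: matrix_left_right_inverse)
    show "matrix L *v axis j 1 = b j" for j
      by (simp add: matrix_apply[OF lin(1)] L_def axis_def if_distrib[of "\<lambda>c. c *\<^sub>R _"] cong: if_cong)
    show "(matrix L' *v w) $ i = \<eta> (dual (b i)) w" for w i
      by (simp add: matrix_apply[OF lin(2)] L'_def)
  qed
qed

section \<open>Isometries of the form and coordinates in \<open>E\<close>\<close>

lemma nondegenerate: "(\<And>v. \<eta> v w = 0) \<Longrightarrow> w = 0"
proof -
  assume w: "\<And>v. \<eta> v w = 0"
  obtain M M' :: "real^'k^'k" and b :: "'k \<Rightarrow> real^'k" where M: "M ** M' = mat 1" and M': "\<And>w i. (M' *v w) $ i = \<eta> (dual (b i)) w"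
    using frame_exists by blast
  have "M' *v w = 0" by (simp add: vec_eq_iff M' w)
  then have "M *v (M' *v w) = 0" by simp
  then show "w = 0" by (simp add: matrix_vector_mul_assoc M)
qed

definition skew :: "real^'k^'k \<Rightarrow> bool" where
  "skew A \<longleftrightarrow> (\<forall>v w. \<eta> (A *v v) w + \<eta> v (A *v w) = 0)"

lemma skew_swap: "skew A \<Longrightarrow> \<eta> v (A *v w) = - \<eta> (A *v v) w"
  by (simp add: skew_def eq_neg_iff_add_eq_0 add.commute)

lemma skew_add: "skew A \<Longrightarrow> skew B \<Longrightarrow> skew (A + B)"
  unfolding skew_def matrix_vector_mult_add_rdistrib \<eta>.add_left \<eta>.add_right
  by (smt (verit))

lemma skew_scale: "skew A \<Longrightarrow> skew (c *\<^sub>R A)"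
  by (simp add: skew_def \<eta>.scaleR_left \<eta>.scaleR_right flip: scaleR_matrix_vector_assoc distrib_left)

text \<open>With \<open>H\<close> the Gram matrix of \<open>\<eta>\<close>, invariance reads
  \<open>transpose g ** H ** g = H\<close>; nondegeneracy allows \<open>det H\<close> to be
  cancelled.\<close>

lemma det_sq_eq_1:
  assumes "\<And>v w. \<eta> (g *v v) (g *v w) = \<eta> v w"
  shows "det g * det g = 1"
proof -
  define H where "H = matrix (\<lambda>w. \<chi> i. \<eta> (axis i 1) w)"
  have "linear (\<lambda>w. \<chi> i. \<eta> (axis i 1) w)"
    by (intro linearI) (simp_all add: vec_eq_iff \<eta>.add_right \<eta>.scaleR_right)
  then have H: "v \<bullet> (H *v w) = \<eta> v w" for v w
  proof -
    have "v \<bullet> (H *v w) = (\<Sum>i\<in>UNIV. v $ i * \<eta> (axis i 1) w)"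
      unfolding H_def matrix_apply[OF \<open>linear _\<close>] by (simp add: inner_vec_def)
    also have "\<dots> = \<eta> (\<Sum>i\<in>UNIV. v $ i *\<^sub>R axis i 1) w"
      by (simp add: \<eta>.sum_left \<eta>.scaleR_left)
    also have "(\<Sum>i\<in>UNIV. v $ i *\<^sub>R axis i 1) = v"
      using basis_expansion[of v] by (simp add: scalar_mult_eq_scaleR)
    finally show ?thesis .
  qed
  have "v \<bullet> ((transpose g ** H ** g) *v w) = v \<bullet> (H *v w)" for v w
    using assms[of v w] unfolding H[symmetric]
    by (metis dot_lmul_matrix transpose_matrix_vector transpose_transpose matrix_vector_mul_assoc)
  then have "(transpose g ** H ** g) *v w = H *v w" for w by (metis vector_eq_ldot)
  then have "transpose g ** H ** g = H" by (simp add: matrix_eq)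
  then have "det g * det H * det g = det H" by (metis det_mul det_transpose)
  moreover have "det H \<noteq> 0"
  proof -
    have "w = 0" if "H *v w = 0" for w
      using that H by (intro nondegenerate) (metis inner_zero_right)
    then have "invertible H"
      using matrix_left_invertible_ker[of H] invertible_left_inverse by blast
    then show ?thesis by (simp add: invertible_det_nz)
  qed
  ultimately show ?thesis by (simp add: mult.commute mult.left_commute)
qed

text \<open>The sign of the determinant is settled by a square root: \<open>mexp A\<close> is the
  square of \<open>mexp ((1/2) *\<^sub>R A)\<close>, itself an isometry of
  \<open>\<eta>\<close>.\<close>

lemma mexp_SO:
  assumes "skew A"
  shows "mexp A \<in> SO \<eta>"
proof -
  have pres: "\<eta> (mexp (c *\<^sub>R A) *v v) (mexp (c *\<^sub>R A) *v w) = \<eta> v w" for c v w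
    using skew_scale[OF assms, of c] by (intro mexp_bilinear_invariant[OF bb]) (simp add: skew_def)
  have "mexp A = mexp ((1/2) *\<^sub>R A) ** mexp ((1/2) *\<^sub>R A)"
    using mexp_scaleR_add[of "1/2" "1/2" A] by simp
  then have "det (mexp A) = det (mexp ((1/2) *\<^sub>R A)) * det (mexp ((1/2) *\<^sub>R A))" by (simp add: det_mul)
  also have "\<dots> = 1" using pres by (rule det_sq_eq_1)
  finally show ?thesis using pres[of 1] by (simp add: SO_def)
qed

lemma E_orth: "x \<in> E \<Longrightarrow> \<eta> p x = 0" "x \<in> E \<Longrightarrow> \<eta> q x = 0" "x \<in> E \<Longrightarrow> \<eta> x p = 0" "x \<in> E \<Longrightarrow> \<eta> x q = 0"
proof -
  have *: "\<eta> r x = 0" if "x \<in> E" "\<And>i. i \<in> {1..n} \<Longrightarrow> \<eta> r (e i) = 0" for r x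
  proof -
    have "subspace {x. \<eta> r x = 0}"
      using linear_subspace_kernel[OF bounded_linear.linear[OF \<eta>.bounded_linear_right]] .
    then show ?thesis using span_minimal[of "e ` {1..n}" "{x. \<eta> r x = 0}"] that by blast
  qed
  show "\<eta> p x = 0" "\<eta> q x = 0" if "x \<in> E" using *[OF that] eta_e by blast+
  then show "\<eta> x p = 0" "\<eta> x q = 0" if "x \<in> E" using that sym by metis+
qed

lemma E_expansion: "x \<in> E \<Longrightarrow> x = (\<Sum>i = 1..n. - \<eta> (e i) x *\<^sub>R e i)"
proof -
  assume x: "x \<in> E"
  let ?F = "\<lambda>x. x + (\<Sum>i = 1..n. \<eta> (e i) x *\<^sub>R e i)"
  have "linear ?F"
    by (intro linearI) (simp_all add: \<eta>.add_right \<eta>.scaleR_right sum.distrib scaleR_sum_right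
        scaleR_add_left scaleR_add_right)
  then have "subspace {x. ?F x = 0}" by (rule linear_subspace_kernel)
  moreover have "e ` {1..n} \<subseteq> {x. ?F x = 0}"
  proof clarify
    fix j assume j: "j \<in> {1..n}"
    have "(\<Sum>i = 1..n. \<eta> (e i) (e j) *\<^sub>R e i) = (\<Sum>i\<in>{j}. \<eta> (e i) (e j) *\<^sub>R e i)"
      using j by (intro sum.mono_neutral_right) (auto simp: eta_e)
    then show "?F (e j) = 0" using j by (simp add: eta_e)
  qed
  ultimately have "?F x = 0" using x span_minimal[of "e ` {1..n}" "{x. ?F x = 0}"] by blast
  then show ?thesis by (simp add: sum_negf eq_neg_iff_add_eq_0)
qed

lemma E_zero: "x \<in> E \<Longrightarrow> (\<And>i. i \<in> {1..n} \<Longrightarrow> \<eta> (e i) x = 0) \<Longrightarrow> x = 0"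
  using E_expansion[of x] by simp

lemma E_norm:
  assumes "x \<in> E" and "\<And>i. i \<in> {1..n} \<Longrightarrow> \<bar>\<eta> (e i) x\<bar> \<le> B i"
  shows "norm x \<le> (\<Sum>i = 1..n. B i * norm (e i))"
proof -
  have "norm (\<Sum>i = 1..n. - \<eta> (e i) x *\<^sub>R e i) \<le> (\<Sum>i = 1..n. B i * norm (e i))"
    using assms(2) by (intro sum_norm_le) (simp add: mult_right_mono)
  then show ?thesis using E_expansion[OF assms(1)] by simp
qed

lemma E_square: "x \<in> E \<Longrightarrow> - \<eta> x x = (\<Sum>i = 1..n. (\<eta> (e i) x)\<^sup>2)"
proof -
  assume x: "x \<in> E"
  have "\<eta> x x = \<eta> (\<Sum>i = 1..n. - \<eta> (e i) x *\<^sub>R e i) x" using E_expansion[OF x] by simp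
  also have "\<dots> = - (\<Sum>i = 1..n. (\<eta> (e i) x)\<^sup>2)"
    by (simp add: \<eta>.sum_left \<eta>.scaleR_left \<eta>.minus_left power2_eq_square sum_negf)
  finally show ?thesis by simp
qed

section \<open>Bivectors and their exponentials\<close>

lemma wedge_apply: "wedge \<eta> u v *v w = \<eta> u w *\<^sub>R v - \<eta> v w *\<^sub>R u"
proof -
  have "linear (\<lambda>w. \<eta> u w *\<^sub>R v - \<eta> v w *\<^sub>R u)"
    by (intro linearI) (simp_all add: \<eta>.add_right \<eta>.scaleR_right algebra_simps)
  then show ?thesis unfolding wedge_def by (rule matrix_apply)
qed

lemma linear_wedge: "linear (wedge \<eta> u)"
  by (intro linearI) (simp_all add: matrix_eq wedge_apply matrix_vector_mult_add_rdistrib \<eta>.add_left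
      \<eta>.scaleR_left scaleR_matrix_vector_assoc[symmetric] algebra_simps)

lemma skew_wedge: "skew (wedge \<eta> u v)"
proof -
  have "\<eta> (wedge \<eta> u v *v x) y + \<eta> x (wedge \<eta> u v *v y) = 0" for x y
    using sym[of x u] sym[of x v]
    by (simp add: wedge_apply \<eta>.diff_left \<eta>.diff_right \<eta>.scaleR_left \<eta>.scaleR_right)
  then show ?thesis by (simp add: skew_def)
qed

lemma bracket_wedge:
  assumes "skew A"
  shows "lie_bracket A (wedge \<eta> u v) = wedge \<eta> (A *v u) v + wedge \<eta> u (A *v v)"
  by (simp add: matrix_eq lie_bracket_def matrix_vector_mult_diff_rdistrib matrix_vector_mult_add_rdistrib
      matrix_vector_mul_assoc[symmetric] wedge_apply matrix_vector_mult_diff_distrib matrix_vector_mult_scaleR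
      skew_swap[OF assms] algebra_simps)

lemma so_on_skew: "A \<in> so_on \<eta> W \<Longrightarrow> skew A"
  by (simp add: so_on_def skew_def)

lemma so_on_kills: "A \<in> so_on \<eta> W \<Longrightarrow> (\<And>w. w \<in> W \<Longrightarrow> \<eta> w x = 0) \<Longrightarrow> A *v x = 0"
  by (simp add: so_on_def)

text \<open>Elements of \<open>h\<close> kill \<open>p\<close> and \<open>q\<close>, and on the
  \<open>e i\<close> the form is minus the standard one; so in the frame their matrices are skew in
  the ordinary sense.\<close>

lemma compact_lie_algebra_so:
  assumes "lie_subalgebra h (so_on \<eta> E)"
  shows "compact_lie_algebra h"
proof -
  have h: "subspace h" "h \<subseteq> so_on \<eta> E" "\<And>A B. A \<in> h \<Longrightarrow> B \<in> h \<Longrightarrow> lie_bracket A B \<in> h"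
    using assms by (auto simp: lie_subalgebra_def)
  obtain M M' :: "real^'k^'k" and b :: "'k \<Rightarrow> real^'k" where M: "M ** M' = mat 1" "M' ** M = mat 1" and b: "bij_betw b (UNIV :: 'k set) basis"
    and Mb: "\<And>j. M *v axis j 1 = b j" and M': "\<And>w i. (M' *v w) $ i = \<eta> (dual (b i)) w"
    using frame_exists by blast
  show ?thesis
  proof (rule compact_lie_algebra_conjugate[OF M h(1,3)])
    fix A assume "A \<in> h"
    then have A: "A \<in> so_on \<eta> E" using h(2) by blast
    have A0: "A *v p = 0" "A *v q = 0" using so_on_kills[OF A] E_orth by blast+
    have A0': "\<eta> v (A *v w) = 0" if "v \<in> {p, q} \<or> w \<in> {p, q}" for v w
      using that A0 skew_swap[OF so_on_skew[OF A], of v w] by (auto simp: \<eta>.zero_left \<eta>.zero_right)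
    have entry: "(M' ** A ** M) $ i $ j = \<eta> (dual (b i)) (A *v b j)" for i j
    proof -
      have "(M' ** A ** M) $ i $ j = ((M' ** A ** M) *v axis j 1) $ i"
        by (simp add: matrix_vector_mult_basis column_def)
      also have "\<dots> = (M' *v (A *v (M *v axis j 1))) $ i"
        by (simp only: matrix_vector_mul_assoc matrix_mul_assoc)
      finally show ?thesis by (simp add: Mb M')
    qed
    \<comment> \<open>If an index is \<open>p\<close> or \<open>q\<close>, both entries vanish, as
      \<open>dual\<close> permutes these two; otherwise \<open>dual\<close> is a sign and skewness
      for \<open>\<eta>\<close> applies.\<close>
    have anti: "\<eta> (dual x) (A *v y) = - \<eta> (dual y) (A *v x)" if "x \<in> basis" "y \<in> basis" for x y
    proof (cases "x \<in> {p, q} \<or> y \<in> {p, q}")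
      case True
      have "dual z \<in> {p, q}" if "z \<in> {p, q}" for z using that by (auto simp: dual_def)
      then have "\<eta> (dual x) (A *v y) = 0" "\<eta> (dual y) (A *v x) = 0" using True by (auto intro!: A0')
      then show ?thesis by simp
    next
      case False
      then have "dual x = - x" "dual y = - y" by (auto simp: dual_def)
      then show ?thesis
        using skew_swap[OF so_on_skew[OF A], of x y] sym[of y] by (simp add: \<eta>.minus_left)
    qed
    have "b i \<in> basis" for i using b by (auto simp: bij_betw_def)
    then have swap: "(M' ** A ** M) $ j $ i = - (M' ** A ** M) $ i $ j" for i j
      unfolding entry by (rule_tac anti)
    show "transpose (M' ** A ** M) = - (M' ** A ** M)"
      by (simp add: vec_eq_iff transpose_def, intro allI, rule swap)
  qed
qed

lemma mexp_wedge_q: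
  assumes "x \<in> E"
  shows "mexp (wedge \<eta> p x) *v q = q + x - (\<eta> x x / 2) *\<^sub>R p"
  using assms by (subst mexp_nilpotent)
    (simp_all add: wedge_apply E_orth matrix_vector_mult_scaleR matrix_vector_minus \<eta>.minus_right \<eta>.scaleR_right)

lemma mexp_wedge_p: "x \<in> E \<Longrightarrow> mexp (wedge \<eta> p x) *v p = p"
  by (rule mexp_fixes) (simp add: wedge_apply E_orth)

lemma mexp_wedge_E:
  assumes "x \<in> E" "y \<in> E"
  shows "mexp (wedge \<eta> p x) *v y = y - \<eta> x y *\<^sub>R p"
  using assms by (subst mexp_nilpotent)
    (simp_all add: wedge_apply E_orth matrix_vector_mult_scaleR \<eta>.minus_right \<eta>.scaleR_right)

text \<open>Either product sends \<open>w\<close> to \<open>- \<eta> p w * \<eta> x y\<close> times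
  \<open>p\<close>, which is symmetric in \<open>x\<close> and \<open>y\<close>.\<close>

lemma wedge_p_commute:
  assumes "x \<in> E" "y \<in> E"
  shows "wedge \<eta> p x ** wedge \<eta> p y = wedge \<eta> p y ** wedge \<eta> p x"
  using assms by (simp add: matrix_eq matrix_vector_mul_assoc[symmetric] wedge_apply E_orth \<eta>.diff_right
      \<eta>.scaleR_right sym[of y x])

lemma eta_matrix_bound:
  fixes v w :: "real^'k"
  shows "\<exists>K>0. \<forall>T :: real^'k^'k. \<bar>\<eta> v (T *v w)\<bar> \<le> norm T * K"
proof -
  have "bounded_linear (\<lambda>T. \<eta> v (T *v w))"
    by (rule bounded_linear_compose[OF \<eta>.bounded_linear_right bounded_linear_matrix_vector])
  from bounded_linear.pos_bounded[OF this] show ?thesis by simp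
qed

lemma eta_matrix_bound_e:
  "\<exists>k. (\<forall>i. k i > 0) \<and> (\<forall>i. \<forall>T :: real^'k^'k. \<bar>\<eta> (e i) (T *v q)\<bar> \<le> norm T * k i)"
  using choice[of "\<lambda>i K. K > 0 \<and> (\<forall>T :: real^'k^'k. \<bar>\<eta> (e i) (T *v q)\<bar> \<le> norm T * K)"]
    eta_matrix_bound[of "e _" q] by blast

lemma wedge_norm_bound: "\<exists>K>0. \<forall>x. norm (wedge \<eta> p x) \<le> norm x * K"
  using bounded_linear.pos_bounded[OF linear_wedge[unfolded linear_conv_bounded_linear], of p] by blast

end

section \<open>Types 3 and 4 as instances of the common frame\<close>

context witt_space
begin

lemma mexp_orthogonal_wedge:
  assumes h: "h \<subseteq> so_on \<eta> E" and g: "g \<in> lie_group h"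
  shows "g *v p = p" and "g *v q = q"
proof -
  have "A *v p = 0" "A *v q = 0" if "A \<in> h" for A
    using so_on_kills[of A E p] so_on_kills[of A E q] that h E_orth by blast+
  then show "g *v p = p" "g *v q = q" using lie_group_fixes[OF g] by blast+
qed

text \<open>By skewness the range is orthogonal to \<open>p\<close> and \<open>q\<close>.
  Subtracting the \<open>E\<close>-component leaves a vector that pairs to zero with the whole dual
  basis.\<close>

lemma skew_range:
  assumes A: "skew A" and kills: "A *v p = 0" "A *v q = 0"
  shows "A *v x \<in> E"
proof -
  let ?y = "A *v x" and ?z = "\<Sum>i = 1..n. - \<eta> (e i) (A *v x) *\<^sub>R e i"
  have z: "?z \<in> E" by (intro span_sum span_scale span_base) auto
  obtain M M' :: "real^'k^'k" and b :: "'k \<Rightarrow> real^'k" where M: "M ** M' = mat 1"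
    and b: "bij_betw b (UNIV :: 'k set) basis" and M': "\<And>w i. (M' *v w) $ i = \<eta> (dual (b i)) w"
    using frame_exists by blast
  have pq: "\<eta> p (?y - ?z) = 0" "\<eta> q (?y - ?z) = 0"
    unfolding \<eta>.diff_right E_orth(1,2)[OF z]
    using skew_swap[OF A, of p x] skew_swap[OF A, of q x] kills by (simp_all add: \<eta>.zero_left)
  have ej: "\<eta> (e j) (?y - ?z) = 0" if j: "j \<in> {1..n}" for j
  proof -
    have "\<eta> (e j) ?z = (\<Sum>i = 1..n. - \<eta> (e i) ?y * \<eta> (e j) (e i))"
      by (simp only: \<eta>.sum_right \<eta>.scaleR_right real_scaleR_def)
    also have "\<dots> = (\<Sum>i\<in>{j}. - \<eta> (e i) ?y * \<eta> (e j) (e i))"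
      using j by (intro sum.mono_neutral_right) (auto simp: eta_e)
    also have "\<dots> = \<eta> (e j) ?y" using j by (simp add: eta_e)
    finally show ?thesis by (simp only: \<eta>.diff_right)
  qed
  have "\<eta> (dual x') (?y - ?z) = 0" if "x' \<in> basis" for x'
  proof -
    have "dual x' = p \<or> dual x' = q \<or> (\<exists>j\<in>{1..n}. dual x' = - e j)"
      using that unfolding dual_def by auto
    then show ?thesis using pq ej by (elim disjE bexE) (simp_all only: \<eta>.minus_left minus_zero)
  qed
  moreover have "b i \<in> basis" for i using b by (auto simp: bij_betw_def)
  ultimately have "M' *v (?y - ?z) = 0" by (simp only: vec_eq_iff M' zero_index) blast
  then have "M *v (M' *v (?y - ?z)) = 0" by simp
  then have "?y - ?z = 0" by (simp only: matrix_vector_mul_assoc M matrix_vector_mul_lid)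
  then show ?thesis using z by (simp only: right_minus_eq)
qed

text \<open>The product \<open>T\<close> satisfies \<open>T p = exp (- c) p\<close>, and
  \<open>T q\<close> is \<open>exp c\<close> times \<open>q + x\<close> up to a multiple of
  \<open>p\<close>. So \<open>\<eta> p (T q)\<close> and \<open>\<eta> q (T p)\<close> control
  \<open>c\<close> from both sides, and the \<open>E\<close>-coordinates of \<open>T q\<close> then
  control \<open>x\<close>.\<close>

lemma type3_extension:
  assumes h: "lie_subalgebra h (so_on \<eta> E)" and torus: "torus_lattice h m u"
    and \<phi>: "linear \<phi>" "\<And>A. A \<in> commutant h \<Longrightarrow> \<phi> A = 0"
  shows "lie_extension h m u (wedge \<eta> p ` E) (range (\<lambda>c. c *\<^sub>R wedge \<eta> p q)) (\<lambda>A. \<phi> A *\<^sub>R wedge \<eta> p q)"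
proof -
  interpret torus_lattice h m u by fact
  have hso: "h \<subseteq> so_on \<eta> E" using h by (simp add: lie_subalgebra_def)
  have kills: "A *v p = 0" "A *v q = 0" if "A \<in> h" for A
    using so_on_kills[of A E p] so_on_kills[of A E q] that hso E_orth by blast+
  have hskew: "skew A" if "A \<in> h" for A using so_on_skew that hso by blast
  have hE: "A *v x \<in> E" if "A \<in> h" for A x
    using skew_range[OF hskew kills] that by blast
  have pq_p: "wedge \<eta> p q *v p = - p" and pq_q: "wedge \<eta> p q *v q = q"
    and pq_E: "wedge \<eta> p q *v x = 0" if "x \<in> E" for x
    using that by (simp_all add: wedge_apply E_orth)
  have lin: "linear (\<lambda>c. c *\<^sub>R wedge \<eta> p q)" by (intro linearI) (simp_all add: scaleR_add_left)
  show ?thesis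
  proof (rule lie_extension.intro[OF torus], rule lie_extension_axioms.intro, goal_cases)
    case 1
    then show ?case by (intro linear_subspace_image linear_wedge subspace_span)
  next
    case (2 X Y)
    then show ?case using wedge_p_commute by blast
  next
    case (3 A X)
    then obtain x where x: "x \<in> E" "X = wedge \<eta> p x" by blast
    have "lie_bracket A X = wedge \<eta> p (A *v x)"
      unfolding x(2) bracket_wedge[OF hskew[OF 3(1)]] kills[OF 3(1)]
      by (simp add: matrix_eq wedge_apply \<eta>.zero_left matrix_vector_mult_add_rdistrib)
    then show ?case using hE[OF 3(1), of x] by blast
  next
    case (4 b X)
    then obtain c x where x: "x \<in> E" "X = wedge \<eta> p x" "b = c *\<^sub>R wedge \<eta> p q" by blast
    have "lie_bracket b X = wedge \<eta> (b *v p) x + wedge \<eta> p (b *v x)"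
      unfolding x(2) using bracket_wedge[OF skew_scale[OF skew_wedge]] x(3) by blast
    also have "\<dots> = wedge \<eta> p (- c *\<^sub>R x)"
      unfolding x(3) scaleR_matrix_vector_assoc[symmetric] pq_E[OF x(1)] pq_p[OF x(1)]
      by (simp add: matrix_eq wedge_apply \<eta>.zero_left matrix_vector_mult_add_rdistrib \<eta>.minus_left \<eta>.scaleR_left
          algebra_simps)
    finally show ?case using x(1) span_scale by blast
  next
    case 5
    show ?case by (rule linear_subspace_image[OF lin subspace_UNIV])
  next
    case (6 b c)
    then show ?case by (auto simp: mat_mult.scaleR_left mat_mult.scaleR_right)
  next
    case (7 b A)
    then obtain c where b: "b = c *\<^sub>R wedge \<eta> p q" by blast
    have "lie_bracket A (wedge \<eta> p q) = 0"
      unfolding bracket_wedge[OF hskew[OF 7(2)]] kills[OF 7(2)]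
      by (simp add: matrix_eq wedge_apply \<eta>.zero_left matrix_vector_mult_add_rdistrib)
    then show ?case unfolding b by (simp add: lie_bracket_def mat_mult.scaleR_left mat_mult.scaleR_right)
  next
    case 8
    show ?case by (intro linearI) (simp_all add: linear_add[OF \<phi>(1)] linear_scale[OF \<phi>(1)] scaleR_add_left)
  next
    case (9 A)
    show ?case by blast
  next
    case (10 A)
    then show ?case using \<phi>(2) by simp
  next
    case (11 R)
    obtain K1 where K1: "K1 > 0" "\<And>T. \<bar>\<eta> p (T *v q)\<bar> \<le> norm T * K1" using eta_matrix_bound[of p q] by blast
    obtain K2 where K2: "K2 > 0" "\<And>T. \<bar>\<eta> q (T *v p)\<bar> \<le> norm T * K2" using eta_matrix_bound[of q p] by blast
    obtain k where k: "\<And>i. k i > 0" "\<And>i T. \<bar>\<eta> (e i) (T *v q)\<bar> \<le> norm T * k i"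
      using eta_matrix_bound_e by blast
    obtain B where B: "B > 0" "\<And>x. norm (wedge \<eta> p x) \<le> norm x * B" using wedge_norm_bound by blast
    \<comment> \<open>\<open>R * k i\<close> bounds \<open>exp c\<close> times the coordinate of
      \<open>x\<close>, and \<open>R * K2\<close> bounds \<open>exp (- c)\<close>.\<close>
    define X where "X = (\<Sum>i = 1..n. (R * K2) * (R * k i) * norm (e i))"
    define C where "C = max (R * K1) (R * K2) * norm (wedge \<eta> p q)"
    show ?case
    proof (intro exI[of _ "max (X * B) C"] ballI impI)
      fix \<nu> g b assume "\<nu> \<in> wedge \<eta> p ` E" and g: "g \<in> lie_group h" and "b \<in> range (\<lambda>c. c *\<^sub>R wedge \<eta> p q)"
        and le: "norm (mexp \<nu> ** g ** mexp b) \<le> R"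
      then obtain x c where x: "x \<in> E" "\<nu> = wedge \<eta> p x" and b: "b = c *\<^sub>R wedge \<eta> p q" by blast
      let ?T = "mexp \<nu> ** g ** mexp b"
      have bq: "mexp b *v q = exp c *\<^sub>R q" "mexp b *v p = exp (- c) *\<^sub>R p"
        unfolding b using pq_q[OF x(1)] pq_p[OF x(1)]
        by (auto intro!: mexp_eigenvector simp: scaleR_matrix_vector_assoc[symmetric])
      have Tq: "?T *v q = exp c *\<^sub>R (q + x - (\<eta> x x / 2) *\<^sub>R p)"
        by (simp add: matrix_vector_mul_assoc[symmetric] bq matrix_vector_mult_scaleR mexp_orthogonal_wedge[OF hso g]
            x(2) mexp_wedge_q[OF x(1)])
      have Tp: "?T *v p = exp (- c) *\<^sub>R p"
        by (simp add: matrix_vector_mul_assoc[symmetric] bq matrix_vector_mult_scaleR mexp_orthogonal_wedge[OF hso g]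
            x(2) mexp_wedge_p[OF x(1)])
      have mono: "norm ?T * K \<le> R * K" if "K > 0" for K using le that by simp
      have "\<eta> p (?T *v q) = exp c" unfolding Tq using x(1)
        by (simp add: \<eta>.scaleR_right \<eta>.add_right \<eta>.diff_right E_orth)
      then have c1: "exp c \<le> R * K1" using K1(2)[of ?T] mono[OF K1(1)] by simp
      have "\<eta> q (?T *v p) = exp (- c)" unfolding Tp by (simp add: \<eta>.scaleR_right)
      then have c2: "exp (- c) \<le> R * K2" using K2(2)[of ?T] mono[OF K2(1)] by simp
      have "\<bar>c\<bar> \<le> max (R * K1) (R * K2)"
        using c1 c2 exp_ge_add_one_self[of c] exp_ge_add_one_self[of "- c"] by linarith
      then have "norm b \<le> C" unfolding b C_def by (simp add: mult_right_mono)
      moreover have "norm x \<le> X"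
        unfolding X_def
      proof (rule E_norm[OF x(1)])
        fix i assume i: "i \<in> {1..n}"
        have "\<eta> (e i) (?T *v q) = exp c * \<eta> (e i) x" unfolding Tq using i
          by (simp add: \<eta>.scaleR_right \<eta>.add_right \<eta>.diff_right eta_e)
        then have "exp c * \<bar>\<eta> (e i) x\<bar> \<le> R * k i"
          using k(2)[of i ?T] mono[OF k(1)[of i]] by (simp add: abs_mult)
        then have "exp (- c) * (exp c * \<bar>\<eta> (e i) x\<bar>) \<le> (R * K2) * (R * k i)"
          using order_trans[OF exp_ge_zero c2] by (intro mult_mono[OF c2]) auto
        then show "\<bar>\<eta> (e i) x\<bar> \<le> R * K2 * (R * k i)"
          by (simp add: mult.assoc[symmetric] flip: exp_add)
      qed
      then have "norm \<nu> \<le> X * B" using B(2)[of x] B(1) x(2) by (meson mult_right_mono less_imp_le order_trans)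
      ultimately show "norm \<nu> \<le> max (X * B) C \<and> norm b \<le> max (X * B) C"
        unfolding le_max_iff_disj by blast
    qed
  next
    case (12 \<nu> g g' b)
    then obtain x c where x: "x \<in> E" "\<nu> = wedge \<eta> p x" and b: "b = c *\<^sub>R wedge \<eta> p q" by blast
    have bq: "mexp b *v q = exp c *\<^sub>R q" "mexp b *v p = exp (- c) *\<^sub>R p"
      unfolding b using pq_q[OF x(1)] pq_p[OF x(1)]
      by (auto intro!: mexp_eigenvector simp: scaleR_matrix_vector_assoc[symmetric])
    have "(mexp \<nu> ** g ** mexp b) *v q = exp c *\<^sub>R (q + x - (\<eta> x x / 2) *\<^sub>R p)"
      by (simp add: matrix_vector_mul_assoc[symmetric] bq matrix_vector_mult_scaleR mexp_orthogonal_wedge[OF hso 12(2)]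
          x(2) mexp_wedge_q[OF x(1)])
    then have q: "exp c *\<^sub>R (q + x - (\<eta> x x / 2) *\<^sub>R p) = q"
      unfolding 12(5) mexp_orthogonal_wedge[OF hso 12(3)] by simp
    have "\<eta> p (exp c *\<^sub>R (q + x - (\<eta> x x / 2) *\<^sub>R p)) = exp c"
      using x(1) by (simp add: \<eta>.scaleR_right \<eta>.add_right \<eta>.diff_right E_orth)
    then have c: "c = 0" unfolding q by simp
    have "\<eta> (e i) x = 0" if i: "i \<in> {1..n}" for i
    proof -
      have "\<eta> (e i) (q + x - (\<eta> x x / 2) *\<^sub>R p) = \<eta> (e i) q" using q c by simp
      then show ?thesis using i by (simp add: \<eta>.scaleR_right \<eta>.add_right \<eta>.diff_right eta_e)
    qed
    then have "x = 0" using E_zero[OF x(1)] by blast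
    then show ?case using x(2) b c linear_0[OF linear_wedge] by simp
  qed
qed

text \<open>The group of \<open>h\<close> fixes \<open>E0\<close> pointwise, so the product sends
  \<open>q\<close> to a vector with the \<open>E\<close>-coordinates of \<open>x + y\<close>.
  Definiteness on \<open>E\<close> and orthogonality of \<open>E0\<close> and \<open>E1\<close> then
  control \<open>x\<close> and \<open>y\<close> separately.\<close>

lemma type4_extension:
  assumes h: "lie_subalgebra h (so_on \<eta> E)" and torus: "torus_lattice h m u"
    and E0: "subspace E0" and E1: "subspace E1" and sum: "{x + y | x y. x \<in> E0 \<and> y \<in> E1} = E"
    and int: "E0 \<inter> E1 = {0}" and orth: "\<And>x y. x \<in> E0 \<Longrightarrow> y \<in> E1 \<Longrightarrow> \<eta> x y = 0"
    and hE1: "h \<subseteq> so_on \<eta> E1"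
    and \<psi>: "linear \<psi>" "\<And>A. A \<in> commutant h \<Longrightarrow> \<psi> A = 0" "\<And>A. A \<in> h \<Longrightarrow> \<psi> A \<in> E0"
  shows "lie_extension h m u (wedge \<eta> p ` E1) (wedge \<eta> p ` E0) (\<lambda>A. wedge \<eta> p (\<psi> A))"
proof -
  interpret torus_lattice h m u by fact
  have hso: "h \<subseteq> so_on \<eta> E" using h by (simp add: lie_subalgebra_def)
  have in_E: "x \<in> E" "y \<in> E" if "x \<in> E0" "y \<in> E1" for x y
  proof -
    have "x + 0 \<in> E" unfolding sum[symmetric] using that subspace_0[OF E1] by blast
    then show "x \<in> E" by simp
    have "0 + y \<in> E" unfolding sum[symmetric] using that subspace_0[OF E0] by blast
    then show "y \<in> E" by simp
  qed
  have E0E: "x \<in> E" if "x \<in> E0" for x using in_E[OF that subspace_0[OF E1]] by blast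
  have E1E: "y \<in> E" if "y \<in> E1" for y using in_E[OF subspace_0[OF E0] that] by blast
  have kills: "A *v p = 0" "A *v q = 0" if "A \<in> h" for A
    using so_on_kills[of A E p] so_on_kills[of A E q] that hso E_orth by blast+
  have kills0: "A *v x = 0" if "A \<in> h" "x \<in> E0" for A x
    using that hE1 orth sym[of _ x] by (intro so_on_kills[of A E1 x]) auto
  have hskew: "skew A" if "A \<in> h" for A using so_on_skew that hso by blast
  have hE1': "A *v x \<in> E1" if A: "A \<in> h" and x: "x \<in> E1" for A x
  proof -
    have "A *v x \<in> E" by (rule skew_range[OF hskew[OF A] kills[OF A]])
    then obtain a b where ab: "a \<in> E0" "b \<in> E1" "A *v x = a + b" unfolding sum[symmetric] by blast
    \<comment> \<open>\<open>A\<close> kills \<open>E0\<close>, so by skewness \<open>A *v x\<close>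
      is orthogonal to its own \<open>E0\<close>-component \<open>a\<close>; hence
      \<open>\<eta> a a = 0\<close>, and definiteness gives \<open>a = 0\<close>.\<close>
    have "\<eta> a (A *v x) = 0" using skew_swap[OF hskew[OF A], of a x] kills0[OF A ab(1)] by (simp add: \<eta>.zero_left)
    then have "\<eta> a a = 0" using orth[OF ab(1,2)] by (simp add: ab(3) \<eta>.add_right)
    then have "(\<Sum>i = 1..n. (\<eta> (e i) a)\<^sup>2) = 0" using E_square[OF E0E[OF ab(1)]] by simp
    then have "\<eta> (e i) a = 0" if "i \<in> {1..n}" for i
      using that by (simp add: sum_nonneg_eq_0_iff)
    then have "a = 0" using E_zero[OF E0E[OF ab(1)]] by blast
    then show ?thesis using ab by simp
  qed
  have Tq: "\<eta> (e i) ((mexp (wedge \<eta> p x) ** g ** mexp (wedge \<eta> p y)) *v q) = \<eta> (e i) (x + y)"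
    if x: "x \<in> E1" and y: "y \<in> E0" and g: "g \<in> lie_group h" and i: "i \<in> {1..n}" for x y g i
  proof -
    have gy: "g *v y = y" using lie_group_fixes[OF g] kills0[OF _ y] by blast
    have "mexp (wedge \<eta> p x) *v (g *v (mexp (wedge \<eta> p y) *v q)) =
      q + x - (\<eta> x x / 2) *\<^sub>R p + (y - \<eta> x y *\<^sub>R p) - (\<eta> y y / 2) *\<^sub>R p"
      by (simp add: mexp_wedge_q[OF E0E[OF y]] mexp_wedge_q[OF E1E[OF x]] mexp_wedge_p[OF E1E[OF x]]
          mexp_wedge_E[OF E1E[OF x] E0E[OF y]] matrix_vector_right_distrib matrix_vector_mult_diff_distrib
          matrix_vector_mult_scaleR mexp_orthogonal_wedge[OF hso g] gy)
    then show ?thesis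
      unfolding matrix_vector_mul_assoc[symmetric]
      using i by (simp add: \<eta>.add_right \<eta>.diff_right \<eta>.scaleR_right eta_e)
  qed
  show ?thesis
  proof (rule lie_extension.intro[OF torus], rule lie_extension_axioms.intro, goal_cases)
    case 1
    show ?case by (intro linear_subspace_image linear_wedge E1)
  next
    case (2 X Y)
    then show ?case using wedge_p_commute E1E by blast
  next
    case (3 A X)
    then obtain x where x: "x \<in> E1" "X = wedge \<eta> p x" by blast
    have "lie_bracket A X = wedge \<eta> p (A *v x)"
      unfolding x(2) bracket_wedge[OF hskew[OF 3(1)]] kills[OF 3(1)]
      by (simp add: matrix_eq wedge_apply \<eta>.zero_left matrix_vector_mult_add_rdistrib)
    then show ?case using hE1'[OF 3(1) x(1)] by blast
  next
    case (4 b X)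
    then obtain x y where xy: "x \<in> E1" "X = wedge \<eta> p x" "y \<in> E0" "b = wedge \<eta> p y" by blast
    have "lie_bracket b X = wedge \<eta> p 0"
      unfolding xy lie_bracket_def using wedge_p_commute[OF E1E[OF xy(1)] E0E[OF xy(3)]]
      by (simp add: linear_0[OF linear_wedge])
    then show ?case using subspace_0[OF E1] by blast
  next
    case 5
    show ?case by (intro linear_subspace_image linear_wedge E0)
  next
    case (6 b c)
    then show ?case using wedge_p_commute E0E by blast
  next
    case (7 b A)
    then obtain y where y: "y \<in> E0" "b = wedge \<eta> p y" by blast
    have "lie_bracket A b = 0"
      unfolding y(2) bracket_wedge[OF hskew[OF 7(2)]] kills[OF 7(2)] kills0[OF 7(2) y(1)]
      by (simp add: matrix_eq wedge_apply \<eta>.zero_left matrix_vector_mult_add_rdistrib)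
    then show ?case by (simp add: lie_bracket_def)
  next
    case 8
    show ?case using linear_compose[OF \<psi>(1) linear_wedge] by (simp add: o_def)
  next
    case (9 A)
    then show ?case using \<psi>(3) by blast
  next
    case (10 A)
    then show ?case using \<psi>(2) linear_0[OF linear_wedge] by simp
  next
    case (11 R)
    obtain k where k: "\<And>i. k i > 0" "\<And>i T. \<bar>\<eta> (e i) (T *v q)\<bar> \<le> norm T * k i"
      using eta_matrix_bound_e by blast
    obtain B where B: "B > 0" "\<And>x. norm (wedge \<eta> p x) \<le> norm x * B" using wedge_norm_bound by blast
    \<comment> \<open>Bounds the squared length of \<open>x + y\<close>, hence by orthogonality
      those of \<open>x\<close> and \<open>y\<close>, whose coordinates are then at most
      \<open>sqrt D\<close>.\<close>
    define D where "D = (\<Sum>i = 1..n. (R * k i)\<^sup>2)"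
    define X where "X = (\<Sum>i = 1..n. sqrt D * norm (e i))"
    show ?case
    proof (intro exI[of _ "X * B"] ballI impI)
      fix \<nu> g b assume "\<nu> \<in> wedge \<eta> p ` E1" and g: "g \<in> lie_group h" and "b \<in> wedge \<eta> p ` E0"
        and le: "norm (mexp \<nu> ** g ** mexp b) \<le> R"
      then obtain x y where xy: "x \<in> E1" "\<nu> = wedge \<eta> p x" "y \<in> E0" "b = wedge \<eta> p y" by blast
      have s: "\<bar>\<eta> (e i) (x + y)\<bar> \<le> R * k i" if "i \<in> {1..n}" for i
      proof -
        have "\<bar>\<eta> (e i) (x + y)\<bar> \<le> norm (mexp \<nu> ** g ** mexp b) * k i"
          using k(2)[of i "mexp \<nu> ** g ** mexp b"] unfolding xy Tq[OF xy(1,3) g that] .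
        also have "\<dots> \<le> R * k i" using le k(1)[of i] by simp
        finally show ?thesis .
      qed
      have sE: "x + y \<in> E" using span_add[OF E1E[OF xy(1)] E0E[OF xy(3)]] .
      have "- \<eta> (x + y) (x + y) \<le> D"
        unfolding E_square[OF sE] D_def
        by (intro sum_mono abs_le_square_iff[THEN iffD1] order_trans[OF s abs_ge_self])
      moreover have "\<eta> (x + y) (x + y) = \<eta> x x + \<eta> y y"
        using orth[OF xy(3,1)] sym[of x y] by (simp add: \<eta>.add_left \<eta>.add_right)
      moreover have nonneg: "0 \<le> - \<eta> z z" if "z \<in> E" for z
        unfolding E_square[OF that] by (intro sum_nonneg) simp
      ultimately have D: "- \<eta> x x \<le> D" "- \<eta> y y \<le> D"
        using nonneg[OF E1E[OF xy(1)]] nonneg[OF E0E[OF xy(3)]] by simp_all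
      have bound: "norm z \<le> X" if z: "z \<in> E" "- \<eta> z z \<le> D" for z
        unfolding X_def
      proof (rule E_norm[OF z(1)])
        fix i assume i: "i \<in> {1..n}"
        have "(\<eta> (e i) z)\<^sup>2 \<le> (\<Sum>i = 1..n. (\<eta> (e i) z)\<^sup>2)"
          using i by (intro member_le_sum) auto
        also have "\<dots> \<le> D" using z by (simp only: E_square[symmetric])
        finally show "\<bar>\<eta> (e i) z\<bar> \<le> sqrt D" by (intro real_le_rsqrt) simp
      qed
      have W: "norm (wedge \<eta> p z) \<le> X * B" if "norm z \<le> X" for z
        using B(2)[of z] mult_right_mono[OF that less_imp_le[OF B(1)]] by linarith
      show "norm \<nu> \<le> X * B \<and> norm b \<le> X * B"
        unfolding xy(2,4) using W bound[OF E1E[OF xy(1)] D(1)] bound[OF E0E[OF xy(3)] D(2)] by blast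
    qed
  next
    case (12 \<nu> g g' b)
    then obtain x y where xy: "x \<in> E1" "\<nu> = wedge \<eta> p x" "y \<in> E0" "b = wedge \<eta> p y" by blast
    have "\<eta> (e i) (x + y) = 0" if i: "i \<in> {1..n}" for i
    proof -
      have "\<eta> (e i) (x + y) = \<eta> (e i) (g' *v q)"
        using Tq[OF xy(1,3) 12(2) i] 12(5) unfolding xy by simp
      then show ?thesis using mexp_orthogonal_wedge(2)[OF hso 12(3)] eta_e[OF i] by simp
    qed
    then have "x + y = 0" using E_zero[OF span_add[OF E1E[OF xy(1)] E0E[OF xy(3)]]] by blast
    then have "y = - x" by (simp add: eq_neg_iff_add_eq_0 add.commute)
    then have "y \<in> E0 \<inter> E1" using xy(1,3) subspace_neg[OF E1] by simp
    then have "y = 0" using int by blast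
    then show ?case using xy \<open>y = - x\<close> linear_0[OF linear_wedge] by simp
  qed
qed

end

section \<open>The equivalences for both types\<close>

theorem mainTheorem6:
  fixes \<eta> :: "real^'k \<Rightarrow> real^'k \<Rightarrow> real"
    and p q :: "real^'k"
    and e :: "nat \<Rightarrow> real^'k"
    and E :: "(real^'k) set"
    and h :: "(real^'k^'k) set"
    and u :: "nat \<Rightarrow> real^'k^'k"
    and n m :: nat
  assumes "witt_basis \<eta> n p e q"
    and "E = span (e ` {1..n})"
    and "weak_berger \<eta> E h"
    and "lie_center h \<noteq> {0}"
    and "m = dim (lie_center h)"
    and "torus_basis (connected_lie_subgroup \<eta> (lie_center h)) m u"
  shows
    "(\<forall>\<phi>. type3_data h \<phi> \<longrightarrow>
        (closedin (top_of_set (SO \<eta>)) (connected_lie_subgroup \<eta> (g3 \<eta> p q E h \<phi>)) \<longleftrightarrow>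
         has_integer_basis m u (center_kernel h \<phi>))) \<and>
     (\<forall>E0 E1 \<psi>. type4_data \<eta> E E0 E1 h \<psi> \<longrightarrow>
        (closedin (top_of_set (SO \<eta>)) (connected_lie_subgroup \<eta> (g4 \<eta> p E1 h \<psi>)) \<longleftrightarrow>
         has_integer_basis m u (center_kernel h \<psi>)))"
proof -
  interpret witt_space \<eta> n p e q using assms(1) by unfold_locales
  have E: "E = span (e ` {1..n})" by fact
  have h: "lie_subalgebra h (so_on \<eta> (span (e ` {1..n})))"
    using assms(3) by (simp add: weak_berger_def E)
  then have hsub: "subspace h" and hso: "h \<subseteq> so_on \<eta> (span (e ` {1..n}))" by (simp_all add: lie_subalgebra_def)
  interpret compact_lie_algebra h by (rule compact_lie_algebra_so[OF h])
  have hskew: "skew A" if "A \<in> h" for A using so_on_skew that hso by blast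
  have center_SO: "mexp Z \<in> SO \<eta>" if "Z \<in> lie_center h" for Z
    using mexp_SO[OF hskew] that center_subset by blast
  have "connected_lie_subgroup \<eta> (lie_center h) = lie_group (lie_center h)"
    by (rule connected_lie_subgroup_eq[OF subspace_lie_center[OF hsub] center_SO])
  then have torus: "torus_lattice h m u"
    using torus_lattice_of_torus_basis[OF compact_lie_algebra_axioms assms(5)] assms(6) by simp
  have wedge_q: "wedge \<eta> p x *v q = x" if "x \<in> span (e ` {1..n})" for x
    using that by (simp add: wedge_apply E_orth)
  show ?thesis
  proof (intro conjI allI impI)
    fix \<phi> assume "type3_data h \<phi>"
    then have \<phi>: "linear_on h \<phi>" "\<And>A. A \<in> commutant h \<Longrightarrow> \<phi> A = 0" by (auto simp: type3_data_def)
    obtain F where F: "linear F" "\<And>A. A \<in> h \<Longrightarrow> F A = \<phi> A" using linear_on_extend[OF \<phi>(1) hsub] by blast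
    interpret t: lie_extension h m u "wedge \<eta> p ` span (e ` {1..n})" "range (\<lambda>c. c *\<^sub>R wedge \<eta> p q)"
      "\<lambda>A. F A *\<^sub>R wedge \<eta> p q"
    proof (rule type3_extension[OF h torus F(1)])
      show "F A = 0" if "A \<in> commutant h" for A
        using F(2)[of A] \<phi>(2)[OF that] that commutant_subset by auto
    qed
    have ext: "t.extension = g3 \<eta> p q E h \<phi>"
      unfolding t.extension_def g3_def E using F(2) by (auto, metis, metis imageI)
    \<comment> \<open>As \<open>wedge \<eta> p q\<close> is nonzero, multiplying it by
      \<open>F\<close> does not enlarge the kernel.\<close>
    have "wedge \<eta> p q *v q = q" by (simp add: wedge_apply)
    moreover have "q \<noteq> 0" using eta_basis(3) \<eta>.zero_right[of p] by (metis zero_neq_one)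
    ultimately have "wedge \<eta> p q \<noteq> 0" by auto
    then have ker: "t.kernel = center_kernel h \<phi>"
      unfolding t.kernel_def center_kernel_def using F(2) center_subset by auto
    have SO: "mexp A \<in> SO \<eta>" if "A \<in> t.extension" for A
    proof -
      from that obtain x B where "B \<in> h" "A = wedge \<eta> p x + (B + F B *\<^sub>R wedge \<eta> p q)"
        unfolding t.extension_def by blast
      then show ?thesis by (simp add: mexp_SO skew_add skew_scale skew_wedge hskew)
    qed
    show "closedin (top_of_set (SO \<eta>)) (connected_lie_subgroup \<eta> (g3 \<eta> p q E h \<phi>)) \<longleftrightarrow>
         has_integer_basis m u (center_kernel h \<phi>)"
      using t.extension_closed_iff[OF SO center_SO] unfolding ext ker .
  next
    fix E0 E1 \<psi> assume t4: "type4_data \<eta> E E0 E1 h \<psi>"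
    then have \<psi>: "linear_on h \<psi>" "\<And>A. A \<in> commutant h \<Longrightarrow> \<psi> A = 0" "\<psi> ` lie_center h = E0"
      and E01: "subspace E0" "subspace E1" "{x + y | x y. x \<in> E0 \<and> y \<in> E1} = span (e ` {1..n})" "E0 \<inter> E1 = {0}"
        "\<And>x y. x \<in> E0 \<Longrightarrow> y \<in> E1 \<Longrightarrow> \<eta> x y = 0"
      and hE1: "h \<subseteq> so_on \<eta> E1"
      by (auto simp: type4_data_def E)
    \<comment> \<open>The image is prescribed on the centre; other elements of \<open>h\<close>
      differ from central ones by the commutant, where \<open>\<psi>\<close> vanishes.\<close>
    have \<psi>E0: "\<psi> A \<in> E0" if A: "A \<in> h" for A
    proof -
      obtain Z where Z: "Z \<in> lie_center h" "A - Z \<in> commutant h" using decomposition[OF A] by blast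
      have "\<psi> (A - Z + Z) = \<psi> (A - Z) + \<psi> Z"
        using \<psi>(1) Z commutant_subset center_subset unfolding linear_on_def by blast
      then show ?thesis using \<psi>(2)[OF Z(2)] \<psi>(3) Z(1) by auto
    qed
    have E0E: "x \<in> span (e ` {1..n})" if "x \<in> E0" for x
    proof -
      have "x + 0 \<in> span (e ` {1..n})" unfolding E01(3)[symmetric] using that subspace_0[OF E01(2)] by blast
      then show ?thesis by simp
    qed
    obtain F where F: "linear F" "\<And>A. A \<in> h \<Longrightarrow> F A = \<psi> A" using linear_on_extend[OF \<psi>(1) hsub] by blast
    interpret t: lie_extension h m u "wedge \<eta> p ` E1" "wedge \<eta> p ` E0" "\<lambda>A. wedge \<eta> p (F A)"
    proof (rule type4_extension[OF h torus E01 hE1 F(1)])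
      show "F A = 0" if "A \<in> commutant h" for A
        using F(2)[of A] \<psi>(2)[OF that] that commutant_subset by auto
      show "F A \<in> E0" if "A \<in> h" for A using F(2)[OF that] \<psi>E0[OF that] by simp
    qed
    have ext: "t.extension = g4 \<eta> p E1 h \<psi>"
      unfolding t.extension_def g4_def using F(2) by (auto, metis, metis imageI)
    have "wedge \<eta> p (F Z) = 0 \<longleftrightarrow> \<psi> Z = 0" if Z: "Z \<in> lie_center h" for Z
    proof
      assume "wedge \<eta> p (F Z) = 0"
      then show "\<psi> Z = 0"
        using wedge_q[OF E0E[OF \<psi>E0], of Z] F(2)[of Z] Z center_subset by auto
    next
      assume "\<psi> Z = 0"
      then show "wedge \<eta> p (F Z) = 0"
        using F(2)[of Z] Z center_subset linear_0[OF linear_wedge] by auto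
    qed
    then have ker: "t.kernel = center_kernel h \<psi>"
      unfolding t.kernel_def center_kernel_def by blast
    have SO: "mexp A \<in> SO \<eta>" if "A \<in> t.extension" for A
    proof -
      from that obtain x B where "B \<in> h" "A = wedge \<eta> p x + (B + wedge \<eta> p (F B))"
        unfolding t.extension_def by blast
      then show ?thesis by (simp add: mexp_SO skew_add skew_wedge hskew)
    qed
    show "closedin (top_of_set (SO \<eta>)) (connected_lie_subgroup \<eta> (g4 \<eta> p E1 h \<psi>)) \<longleftrightarrow>
         has_integer_basis m u (center_kernel h \<psi>)"
      using t.extension_closed_iff[OF SO center_SO] unfolding ext ker .
  qed
qed

end
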